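(* Let $0<a<b$, $\lambda\ge0$, and let $\Omega_\lambda$ be an optimal set (a minimizer of $J_\lambda$ over $\mathscr{C}_{a,b}$) belonging to the class $\mathscr{K}_{a,b}$. Then: (1) for $\lambda\ne 2/a$ there exists $\theta\in(0,\frac\pi2)$ such that if $\mathscr{A}^a$ is not empty, then $\mathscr{A}^a=\{\theta\}$ (a single element); (2) there exist $x,y\in(0,\frac\pi2)$ such that if $\mathscr{A}_b$ is not empty, then either it is a singleton, or $\mathscr{A}_b=\{x,\dots,x\}$ (finitely many copies of one angle), or $\mathscr{A}_b=\{x,\dots,x,y\}$ (finitely many copies of $x$ and exactly one copy of $y$) with $x>y$ and $\cos x+\cos y=\frac{1}{b\lambda}$.
   Context: $D_r$ is the closed disc in $\mathbb{R}^2$ of radius $r$ centered at the origin $O$. $|\Omega|$ is the area and $P(\Omega)$ the perimeter; $J_\lambda(\Omega)=\lambda|\Omega|-P(\Omega)$. $\mathscr{C}_{a,b}$ is the class of compact convex $K\subseteq\mathbb{R}^2$ with $D_a\subseteq K\subseteq D_b$. Let $\xi_0\in(0,\pi/2)$ be defined by $\cos\xi_0=a/b$. A chord of $D_b$ is a segment with both endpoints on $\partial D_b$. For $\Omega\in\mathscr{C}_{a,b}$, segments contained in $\partial\Omega$ are sorted into three classes (counted with multiplicity): - $\mathscr{L}^a$: tangent sides to $D_a$ which are not chords of $D_b$, counted via their portions as follows: two segments $P_iP_j$, $P_jP_k$ tangent to $D_a$ with tangency points $P_i,P_k\in\partial D_a$ and common vertex $P_j\notin\partial D_b$ are identified and count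 as one element; each has length $a\tan\theta$, where $\theta\in(0,\xi_0)$ is the angle it subtends at $O$. - $\mathscr{L}_b$: chords of $D_b$ not tangent to $D_a$; the two halves of such a chord (cut at its midpoint) are identified and count as one element; each half has length $b\sin\eta$, where $\eta\in(0,\xi_0)$ is the angle it subtends at $O$. - $\mathscr{L}^a_b$: segments $P_iP_j$ tangent to $D_a$ at $P_j\in\partial D_a$ with $P_i\in\partial D_b$ (halves of chords of $D_b$ tangent to $D_a$); each has length $\sqrt{b^2-a^2}$ and subtends the angle $\xi_0$ at $O$; they are counted in couples (two such segments count as one element). $\mathscr{A}^a,\mathscr{A}_b,\mathscr{A}^a_b$ are the corresponding multisets of central angles ($\theta$'s, $\eta$'s, and copies of $\xi_0$, one per element). $\mathscr{K}_{a,b}$ is the class of sets $\Omega\in\mathscr{C}_{a,b}$ with $\partial\Omega=\bigcup_{i\in I}L_i$, $L_i\in\mathscr{L}^a_b\cup\mathscr{L}^a\cup\mathscr{L}_b$ (with $I$ not assumed finite). *)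

theory Defs
  imports "HOL-Analysis.Analysis" "HOL-Library.Multiset" "HOL-Library.Extended_Nat"
begin

section \<open>Area, perimeter and the minimization problem\<close>

definition C_class :: "real \<Rightarrow> real \<Rightarrow> (real^2) set set" where
  "C_class a b = {K. compact K \<and> convex K \<and> cball 0 a \<subseteq> K \<and> K \<subseteq> cball 0 b}"

definition area :: "(real^2) set \<Rightarrow> real" where
  "area K = measure lebesgue K"

text \<open>The length of a curve is the supremum of the lengths of its inscribed polygonal lines.\<close>

definition curve_length :: "(real \<Rightarrow> 'a::metric_space) \<Rightarrow> real \<Rightarrow> real \<Rightarrow> real" where
  "curve_length \<gamma> s t =
     Sup {(\<Sum>i<n. dist (\<gamma> (p i)) (\<gamma> (p (Suc i)))) | (n::nat) p.
            p 0 = s \<and> p n = t \<and> (\<forall>i<n. p i \<le> p (Suc i))}"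

definition direction :: "real \<Rightarrow> real^2" where
  "direction t = vector [cos t, sin t]"

text \<open>If \<open>K\<close> is compact and convex with the origin in its interior, then every ray from the
  origin meets the boundary of \<open>K\<close> in exactly one point, so that \<open>boundary_curve K\<close> on
  \<open>[0, 2\<pi>]\<close> runs through the boundary exactly once. The perimeter is the length of this closed
  curve. It is used only for members of \<open>C_class a b\<close> with \<open>0 < a\<close>; for these the origin is an
  interior point and the supremum in \<open>curve_length\<close> is finite.\<close>

definition boundary_curve :: "(real^2) set \<Rightarrow> real \<Rightarrow> real^2" where
  "boundary_curve K t = Sup {r. r *\<^sub>R direction t \<in> K} *\<^sub>R direction t"

definition perimeter :: "(real^2) set \<Rightarrow> real" where
  "perimeter K = curve_length (boundary_curve K) 0 (2 * pi)"

definition J :: "real \<Rightarrow> (real^2) set \<Rightarrow> real" where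
  "J lam K = lam * area K - perimeter K"

definition optimal :: "real \<Rightarrow> real \<Rightarrow> real \<Rightarrow> (real^2) set \<Rightarrow> bool" where
  "optimal a b lam \<Omega> \<longleftrightarrow> \<Omega> \<in> C_class a b \<and> (\<forall>K \<in> C_class a b. J lam \<Omega> \<le> J lam K)"

section \<open>Boundary segments\<close>

text \<open>The angle at the origin between two nonzero vectors.\<close>

definition angle_at_O :: "real^2 \<Rightarrow> real^2 \<Rightarrow> real" where
  "angle_at_O P Q = arccos (P \<bullet> Q / (norm P * norm Q))"

text \<open>The line through two distinct points is tangent to the disc of radius \<open>a\<close> at \<open>T\<close> if
  \<open>T\<close> is the only point it shares with the disc.\<close>

definition line_tangent_at :: "real \<Rightarrow> real^2 \<Rightarrow> real^2 \<Rightarrow> real^2 \<Rightarrow> bool" where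
  "line_tangent_at a P Q T \<longleftrightarrow> P \<noteq> Q \<and> affine hull {P, Q} \<inter> cball 0 a = {T}"

text \<open>The two tangent segments from a common vertex \<open>Q\<close> off the outer circle are identified:
  an element of the class is their union, and \<open>\<theta>\<close> is the angle subtended by each of them.
  By symmetry \<open>angle_at_O P Q = angle_at_O R Q\<close>, and \<open>cos \<theta> = a / norm Q\<close>.\<close>

definition upper_a_element ::
    "real \<Rightarrow> real \<Rightarrow> (real^2) set \<Rightarrow> real \<Rightarrow> (real^2) set \<Rightarrow> bool" where
  "upper_a_element a b \<Omega> \<theta> E \<longleftrightarrow>
     (\<exists>P Q R. P \<noteq> R \<and> norm Q \<noteq> b \<and>
        line_tangent_at a P Q P \<and> line_tangent_at a R Q R \<and>
        closed_segment P Q \<subseteq> frontier \<Omega> \<and> closed_segment Q R \<subseteq> frontier \<Omega> \<and>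
        E = closed_segment P Q \<union> closed_segment Q R \<and> \<theta> = angle_at_O P Q)"

text \<open>An element is a whole chord, \<open>\<eta>\<close> the angle subtended by each half of it.\<close>

definition lower_b_element ::
    "real \<Rightarrow> real \<Rightarrow> (real^2) set \<Rightarrow> real \<Rightarrow> (real^2) set \<Rightarrow> bool" where
  "lower_b_element a b \<Omega> \<eta> E \<longleftrightarrow>
     (\<exists>P Q. P \<noteq> Q \<and> norm P = b \<and> norm Q = b \<and>
        \<not> (\<exists>T. line_tangent_at a P Q T) \<and>
        closed_segment P Q \<subseteq> frontier \<Omega> \<and>
        E = closed_segment P Q \<and> \<eta> = angle_at_O P (midpoint P Q))"

definition L_upper_a :: "real \<Rightarrow> real \<Rightarrow> (real^2) set \<Rightarrow> (real^2) set set" where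
  "L_upper_a a b \<Omega> = {E. \<exists>\<theta>. upper_a_element a b \<Omega> \<theta> E}"

definition L_lower_b :: "real \<Rightarrow> real \<Rightarrow> (real^2) set \<Rightarrow> (real^2) set set" where
  "L_lower_b a b \<Omega> = {E. \<exists>\<eta>. lower_b_element a b \<Omega> \<eta> E}"

text \<open>Here the segments are not grouped in couples: the grouping only affects the multiplicity of
  the constant angle \<open>arccos (a / b)\<close>, not the union of the segments.\<close>

definition L_upper_a_lower_b :: "real \<Rightarrow> real \<Rightarrow> (real^2) set \<Rightarrow> (real^2) set set" where
  "L_upper_a_lower_b a b \<Omega> =
     {closed_segment P Q | P Q. norm P = b \<and> line_tangent_at a P Q Q \<and>
        closed_segment P Q \<subseteq> frontier \<Omega>}"

definition K_class :: "real \<Rightarrow> real \<Rightarrow> (real^2) set set" where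
  "K_class a b = {\<Omega> \<in> C_class a b.
     \<exists>\<L>. \<L> \<subseteq> L_upper_a_lower_b a b \<Omega> \<union> L_upper_a a b \<Omega> \<union> L_lower_b a b \<Omega> \<and>
         frontier \<Omega> = \<Union>\<L>}"

section \<open>Multisets of angles\<close>

text \<open>Nothing excludes a priori infinitely many boundary segments, so a multiset of angles is
  given by its multiplicity function with values in \<open>enat\<close>; \<open>of_mset\<close> embeds the finite
  multisets.\<close>

definition ecard :: "'a set \<Rightarrow> enat" where
  "ecard S = (if finite S then enat (card S) else \<infinity>)"

definition of_mset :: "'a multiset \<Rightarrow> 'a \<Rightarrow> enat" where
  "of_mset M = (\<lambda>t. enat (count M t))"

definition A_upper_a :: "real \<Rightarrow> real \<Rightarrow> (real^2) set \<Rightarrow> real \<Rightarrow> enat" where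
  "A_upper_a a b \<Omega> = (\<lambda>\<theta>. ecard {E. upper_a_element a b \<Omega> \<theta> E})"

definition A_lower_b :: "real \<Rightarrow> real \<Rightarrow> (real^2) set \<Rightarrow> real \<Rightarrow> enat" where
  "A_lower_b a b \<Omega> = (\<lambda>\<eta>. ecard {E. lower_b_element a b \<Omega> \<eta> E})"

end

theory Submission
  imports Defs
begin

text \<open>
  The boundary of a member of \<^term>\<open>C_class a b\<close> is described by \<open>u\<close>, the restriction of its
  Minkowski functional to the unit circle, that is, the reciprocal of the radial function. In this
  description the functional \<^const>\<open>J\<close> is additive over angular intervals and invariant under
  rotation, and convexity is the inequality
  \<open>2 * cos h * u x \<le> u (x - h) + u (x + h)\<close>, which has to be checked only for small \<open>h\<close>
  (\<open>convex_polar_region\<close>). So a closed curve may be cut into arcs, and the arcs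
  may be rotated and glued again in any order. Where two arcs are glued on one
  of the two circles, convexity follows if both arcs stay on the inner side of the tangent there:
  on the outer circle because they stay inside the disc, on the inner circle because they did so
  in the set from which they were cut.
  Hence a competitor is known as soon as the angles and the values of its arcs are known
  (\<open>closed_arc_competitor\<close>).

  An element of \<open>L_upper_a\<close> spans a kite between two tangency points on the inner circle. It
  contributes \<open>a * (lam * a - 2) * tan \<theta>\<close> to the functional. A chord of the outer circle
  contributes \<open>lam * b\<^sup>2 * (sin \<eta> * cos \<eta>) - 2 * b * sin \<eta>\<close>. Two pieces of the same kind may
  exchange some angle, the rest of the boundary being rotated accordingly, and optimality says that
  no such exchange lowers the sum of the two contributions (\<open>exchange_pieces\<close>).

  If \<open>lam * a < 2\<close>, the contribution of a kite is strictly concave in the angle, so that two kites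
  cannot coexist. If \<open>lam * a > 2\<close>, cutting off the vertex of a kite by a tangent of the inner disc
  replaces it by two kites of half the angle and lowers the functional, so that there are no kites.

  For two chords of half-angles \<open>x \<noteq> y\<close> the first variation of the exchange gives
  \<open>lam * b * (cos x + cos y) = 1\<close>; so at most two angles occur. For two chords of the same
  half-angle \<open>y\<close> the second variation gives \<open>2 * lam * b * cos y \<le> 1\<close>, which the smaller of two
  different angles violates; so the smaller angle occurs only once. Chords with the same angle
  occupy disjoint arcs of the same length, so that there are finitely many.
\<close>

section \<open>Polar coordinates in the plane\<close>

lemma direction_component [simp]: "direction t $ 1 = cos t" "direction t $ 2 = sin t"
  by (simp_all add: direction_def)

lemma plane_eq_iff: "(x::real^2) = y \<longleftrightarrow> x $ 1 = y $ 1 \<and> x $ 2 = y $ 2"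
  by (simp add: vec_eq_iff forall_2)

lemma inner_plane: "(x::real^2) \<bullet> y = x $ 1 * y $ 1 + x $ 2 * y $ 2"
  by (simp add: inner_vec_def sum_2)

lemma inner_direction: "direction s \<bullet> direction t = cos (s - t)"
  by (simp add: inner_plane cos_diff)

lemma norm_direction [simp]: "norm (direction t) = 1"
  unfolding norm_eq_1 inner_direction by simp

lemma direction_periodic: "direction (t + 2 * pi * of_int n) = direction t"
  by (simp add: plane_eq_iff cos_add sin_add)

lemma direction_eq_within_period:
  assumes "direction s = direction t" "s \<le> t" "t \<le> s + 2 * pi"
  shows "t = s \<or> t = s + 2 * pi"
proof -
  have "cos (t - s) = 1" using inner_direction[of t s] assms(1) inner_direction[of s s] by simp
  then obtain n :: int where n: "t - s = of_int n * 2 * pi" unfolding cos_one_2pi_int by blast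
  have "0 \<le> real_of_int n * (2 * pi)" "real_of_int n * (2 * pi) \<le> 1 * (2 * pi)"
    using n assms(2,3) by linarith+
  then have "0 \<le> real_of_int n" "real_of_int n \<le> 1"
    using pi_gt_zero by (auto simp: zero_le_mult_iff mult_le_cancel_right)
  then have "n = 0 \<or> n = 1" by linarith
  then show ?thesis using n by auto
qed

lemma polar_form:
  obtains t where "s \<le> t" "t < s + 2 * pi" "x = norm x *\<^sub>R direction t"
proof -
  obtain t where t: "x = norm x *\<^sub>R direction t"
  proof (cases "x = 0")
    case False
    then have n0: "norm x \<noteq> 0" by simp
    have "(norm x)\<^sup>2 = (x $ 1)\<^sup>2 + (x $ 2)\<^sup>2"
      unfolding power2_norm_eq_inner inner_plane by (simp add: power2_eq_square)
    then have "(x $ 1 / norm x)\<^sup>2 + (x $ 2 / norm x)\<^sup>2 = 1"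
      using n0 unfolding power_divide add_divide_distrib[symmetric] by (metis divide_self_if power_not_zero)
    then obtain t where t: "x $ 1 / norm x = cos t" "x $ 2 / norm x = sin t"
      by (rule sincos_total_2pi)
    have "x = norm x *\<^sub>R direction t"
      unfolding plane_eq_iff vector_scaleR_component direction_component t[symmetric]
      using n0 by simp
    then show ?thesis by (rule that)
  qed (use that in simp)
  define n where "n = \<lfloor>(t - s) / (2 * pi)\<rfloor>"
  have "of_int n \<le> (t - s) / (2 * pi)" "(t - s) / (2 * pi) < of_int n + 1"
    unfolding n_def by linarith+
  then have "s \<le> t + 2 * pi * of_int (- n)" "t + 2 * pi * of_int (- n) < s + 2 * pi"
    by (simp_all add: field_simps)
  then show ?thesis using t by (intro that[of "t + 2 * pi * of_int (- n)"]) (simp_all only: direction_periodic)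
qed

lemma dist_polar:
  "(dist (r *\<^sub>R direction s) (q *\<^sub>R direction t))\<^sup>2 = r\<^sup>2 + q\<^sup>2 - 2 * r * q * cos (s - t)"
proof -
  have "cos (t - s) = cos (s - t)" using cos_minus[of "s - t"] by simp
  then show ?thesis
    unfolding dist_norm power2_norm_eq_inner inner_diff inner_scaleR_left inner_scaleR_right
      inner_direction
    by (simp add: power2_eq_square algebra_simps)
qed

lemma dist_direction_le: "dist (direction s) (direction t) \<le> \<bar>s - t\<bar>"
proof -
  have "(dist (direction s) (direction t))\<^sup>2 = 2 - 2 * cos (2 * ((s - t) / 2))"
    using dist_polar[of 1 s 1 t] unfolding mult_2 field_sum_of_halves by simp
  also have "\<dots> = 4 * (sin ((s - t) / 2))\<^sup>2" by (subst cos_double_sin) simp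
  also have "\<dots> \<le> 4 * ((s - t) / 2)\<^sup>2"
    using abs_sin_x_le_abs_x[of "(s - t) / 2"] by (simp only: abs_le_square_iff)
  also have "\<dots> = \<bar>s - t\<bar>\<^sup>2" by (simp add: power_divide)
  finally show ?thesis by (rule power2_le_imp_le) simp
qed

lemma line_in_polar_coordinates:
  assumes "cos (x - m) \<noteq> 0"
  shows "(p / cos (x - m)) *\<^sub>R direction x
           = p *\<^sub>R direction m + (p * tan (x - m)) *\<^sub>R direction (m + pi / 2)"
proof -
  have c: "cos x = cos (x - m) * cos m - sin (x - m) * sin m"
    using cos_add[of "x - m" m] by simp
  have s: "sin x = sin (x - m) * cos m + cos (x - m) * sin m"
    using sin_add[of "x - m" m] by simp
  have t: "sin (x - m) = tan (x - m) * cos (x - m)" using assms by (simp add: tan_def)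
  have "(p / cos (x - m)) * cos x = p * cos m + (p * tan (x - m)) * cos (m + pi / 2)"
    "(p / cos (x - m)) * sin x = p * sin m + (p * tan (x - m)) * sin (m + pi / 2)"
    unfolding c s t using assms
    by (simp_all add: cos_add sin_add algebra_simps del: minus_diff_eq)
  then show ?thesis by (simp add: plane_eq_iff)
qed

section \<open>Length of curves\<close>

definition inscribed_lengths :: "(real \<Rightarrow> 'a::metric_space) \<Rightarrow> real \<Rightarrow> real \<Rightarrow> real set" where
  "inscribed_lengths \<gamma> s t =
     {(\<Sum>i<n. dist (\<gamma> (p i)) (\<gamma> (p (Suc i)))) | (n::nat) p.
        p 0 = s \<and> p n = t \<and> (\<forall>i<n. p i \<le> p (Suc i))}"

lemma curve_length_eq_Sup: "curve_length \<gamma> s t = Sup (inscribed_lengths \<gamma> s t)"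
  by (simp add: curve_length_def inscribed_lengths_def)

lemma partition_mono:
  fixes p :: "nat \<Rightarrow> real"
  assumes "\<forall>i<n. p i \<le> p (Suc i)" "j \<le> n" "i \<le> j"
  shows "p i \<le> p j"
  using assms(3,2)
proof (induction j rule: dec_induct)
  case (step k)
  then show ?case using assms(1) by (metis Suc_le_lessD Suc_leD order.trans)
qed simp

lemma partition_in_interval:
  fixes p :: "nat \<Rightarrow> real"
  assumes "p 0 = s" "p n = t" "\<forall>i<n. p i \<le> p (Suc i)" "i \<le> n"
  shows "p i \<in> {s..t}"
  using partition_mono[OF assms(3), of i 0] partition_mono[OF assms(3), of n i] assms by simp

lemma inscribed_lengths_nonempty:
  "s \<le> t \<Longrightarrow> dist (\<gamma> s) (\<gamma> t) \<in> inscribed_lengths \<gamma> s t"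
  unfolding inscribed_lengths_def
  by (intro CollectI exI[of _ 1] exI[of _ "\<lambda>i. if i = 0 then s else t"]) simp

lemma inscribed_lengths_isometric_subset:
  assumes "\<And>x y. x \<in> {s..t} \<Longrightarrow> y \<in> {s..t} \<Longrightarrow> dist (\<gamma>' (x + d)) (\<gamma>' (y + d)) = dist (\<gamma> x) (\<gamma> y)"
  shows "inscribed_lengths \<gamma> s t \<subseteq> inscribed_lengths \<gamma>' (s + d) (t + d)"
proof
  fix l assume "l \<in> inscribed_lengths \<gamma> s t"
  then obtain n p where l: "l = (\<Sum>i<n. dist (\<gamma> (p i)) (\<gamma> (p (Suc i))))"
    and p: "p 0 = s" "p n = t" "\<forall>i<n. p i \<le> p (Suc i)"
    unfolding inscribed_lengths_def by auto
  have "l = (\<Sum>i<n. dist (\<gamma>' (p i + d)) (\<gamma>' (p (Suc i) + d)))"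
    unfolding l by (intro sum.cong refl assms[symmetric] partition_in_interval[OF p]) auto
  then show "l \<in> inscribed_lengths \<gamma>' (s + d) (t + d)"
    unfolding inscribed_lengths_def using p
    by (intro CollectI exI[of _ n] exI[of _ "\<lambda>i. p i + d"]) auto
qed

lemma curve_length_isometric:
  assumes iso: "\<And>x y. x \<in> {s..t} \<Longrightarrow> y \<in> {s..t} \<Longrightarrow>
                  dist (\<gamma>' (x + d)) (\<gamma>' (y + d)) = dist (\<gamma> x) (\<gamma> y)"
  shows "curve_length \<gamma>' (s + d) (t + d) = curve_length \<gamma> s t"
proof -
  have "inscribed_lengths \<gamma>' (s + d) (t + d) \<subseteq> inscribed_lengths \<gamma> (s + d + (- d)) (t + d + (- d))"
  proof (rule inscribed_lengths_isometric_subset)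
    fix x y assume "x \<in> {s + d..t + d}" "y \<in> {s + d..t + d}"
    then have "dist (\<gamma>' (x - d + d)) (\<gamma>' (y - d + d)) = dist (\<gamma> (x - d)) (\<gamma> (y - d))"
      by (intro iso) auto
    then show "dist (\<gamma> (x + - d)) (\<gamma> (y + - d)) = dist (\<gamma>' x) (\<gamma>' y)" by simp
  qed
  moreover have "inscribed_lengths \<gamma> s t \<subseteq> inscribed_lengths \<gamma>' (s + d) (t + d)"
    by (rule inscribed_lengths_isometric_subset) (rule iso)
  ultimately show ?thesis by (simp add: curve_length_eq_Sup)
qed

text \<open>Along a curve that runs through a segment monotonically every inscribed polygonal line has
  the same length, because the distances telescope.\<close>

lemma curve_length_straight:
  assumes "s \<le> t"
    and dist: "\<And>x y. s \<le> x \<Longrightarrow> x \<le> y \<Longrightarrow> y \<le> t \<Longrightarrow> dist (\<gamma> x) (\<gamma> y) = g y - g x"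
  shows "curve_length \<gamma> s t = g t - g s"
proof -
  have "l = g t - g s" if l: "l \<in> inscribed_lengths \<gamma> s t" for l
  proof -
    obtain n p where l: "l = (\<Sum>i<n. dist (\<gamma> (p i)) (\<gamma> (p (Suc i))))"
      and p: "p 0 = s" "p n = t" "\<forall>i<n. p i \<le> p (Suc i)"
      using l unfolding inscribed_lengths_def by auto
    have "l = (\<Sum>i<n. g (p (Suc i)) - g (p i))" unfolding l
    proof (intro sum.cong refl)
      fix i assume "i \<in> {..<n}"
      then show "dist (\<gamma> (p i)) (\<gamma> (p (Suc i))) = g (p (Suc i)) - g (p i)"
        using p(3) partition_in_interval[OF p, of i] partition_in_interval[OF p, of "Suc i"]
        by (intro dist) auto
    qed
    also have "\<dots> = g t - g s" using p(1,2) sum_lessThan_telescope[of "\<lambda>i. g (p i)" n] by simp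
    finally show ?thesis .
  qed
  then have "inscribed_lengths \<gamma> s t \<subseteq> {g t - g s}" by (intro subsetI singletonI) simp
  moreover have "inscribed_lengths \<gamma> s t \<noteq> {}"
    using inscribed_lengths_nonempty[OF assms(1), of \<gamma>] by (metis empty_iff)
  ultimately have "inscribed_lengths \<gamma> s t = {g t - g s}" by (metis subset_singletonD)
  then show ?thesis by (simp add: curve_length_eq_Sup)
qed

lemma lipschitz_imp_bounded_inscribed_lengths:
  assumes "L-lipschitz_on {s..t} \<gamma>"
  shows "bdd_above (inscribed_lengths \<gamma> s t)"
proof (rule bdd_aboveI)
  fix l assume "l \<in> inscribed_lengths \<gamma> s t"
  then obtain n p where l: "l = (\<Sum>i<n. dist (\<gamma> (p i)) (\<gamma> (p (Suc i))))"
    and p: "p 0 = s" "p n = t" "\<forall>i<n. p i \<le> p (Suc i)"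
    unfolding inscribed_lengths_def by auto
  have "l \<le> (\<Sum>i<n. L * (p (Suc i) - p i))" unfolding l
  proof (intro sum_mono)
    fix i assume "i \<in> {..<n}"
    then have "p i \<in> {s..t}" "p (Suc i) \<in> {s..t}" "p i \<le> p (Suc i)"
      using p(3) partition_in_interval[OF p, of i] partition_in_interval[OF p, of "Suc i"] by auto
    then show "dist (\<gamma> (p i)) (\<gamma> (p (Suc i))) \<le> L * (p (Suc i) - p i)"
      using lipschitz_onD[OF assms, of "p i" "p (Suc i)"] by (simp add: dist_real_def)
  qed
  also have "\<dots> = L * (\<Sum>i<n. p (Suc i) - p i)" by (simp add: sum_distrib_left)
  also have "\<dots> = L * (t - s)" using p(1,2) by (simp add: sum_lessThan_telescope)
  finally show "l \<le> L * (t - s)" .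
qed

lemma concat_inscribed_lengths:
  assumes "l \<in> inscribed_lengths \<gamma> s m" "l' \<in> inscribed_lengths \<gamma> m t"
  shows "l + l' \<in> inscribed_lengths \<gamma> s t"
proof -
  obtain n p where l: "l = (\<Sum>i<n. dist (\<gamma> (p i)) (\<gamma> (p (Suc i))))"
    and p: "p 0 = s" "p n = m" "\<forall>i<n. p i \<le> p (Suc i)"
    using assms(1) unfolding inscribed_lengths_def by auto
  obtain n' p' where l': "l' = (\<Sum>i<n'. dist (\<gamma> (p' i)) (\<gamma> (p' (Suc i))))"
    and p': "p' 0 = m" "p' n' = t" "\<forall>i<n'. p' i \<le> p' (Suc i)"
    using assms(2) unfolding inscribed_lengths_def by auto
  define r where "r i = (if i \<le> n then p i else p' (i - n))" for i
  have r1: "r i = p i" if "i \<le> n" for i using that by (simp add: r_def)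
  have r2: "r (n + i) = p' i" for i using p(2) p'(1) by (simp add: r_def)
  have "(\<Sum>i<n + k. dist (\<gamma> (r i)) (\<gamma> (r (Suc i)))) =
        (\<Sum>i<n. dist (\<gamma> (p i)) (\<gamma> (p (Suc i)))) + (\<Sum>i<k. dist (\<gamma> (p' i)) (\<gamma> (p' (Suc i))))" for k
  proof (induction k)
    case 0
    show ?case by (auto intro!: sum.cong simp: r1)
  next
    case (Suc k)
    then show ?case using r2[of k] r2[of "Suc k"] by simp
  qed
  then have "l + l' = (\<Sum>i<n + n'. dist (\<gamma> (r i)) (\<gamma> (r (Suc i))))" using l l' by simp
  moreover have "r 0 = s" "r (n + n') = t" using p(1) p'(2) r1[of 0] r2[of n'] by simp_all
  moreover have "r i \<le> r (Suc i)" if "i < n + n'" for i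
  proof (cases "i < n")
    case True
    then show ?thesis using p(3) r1[of i] r1[of "Suc i"] by auto
  next
    case False
    then have "i = n + (i - n)" "i - n < n'" using that by auto
    then obtain k where "i = n + k" "k < n'" by blast
    then show ?thesis using p'(3) r2[of k] r2[of "Suc k"] by auto
  qed
  ultimately show ?thesis
    unfolding inscribed_lengths_def by (intro CollectI exI[of _ "n + n'"] exI[of _ r]) simp
qed

text \<open>Clipping a partition of \<open>[s, t]\<close> at \<open>m\<close> by \<open>min\<close> and \<open>max\<close> yields partitions of both
  halves, and by the triangle inequality the two clipped polygonal lines are together at least as
  long as the original one.\<close>

lemma curve_length_add:
  assumes lip: "L-lipschitz_on {s..t} \<gamma>" and m: "s \<le> m" "m \<le> t"
  shows "curve_length \<gamma> s t = curve_length \<gamma> s m + curve_length \<gamma> m t"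
proof (rule antisym)
  have bdd: "bdd_above (inscribed_lengths \<gamma> s t)"
    by (rule lipschitz_imp_bounded_inscribed_lengths[OF lip])
  have bdd_lo: "bdd_above (inscribed_lengths \<gamma> s m)"
    by (rule lipschitz_imp_bounded_inscribed_lengths[OF lipschitz_on_subset[OF lip]]) (use m in auto)
  have bdd_hi: "bdd_above (inscribed_lengths \<gamma> m t)"
    by (rule lipschitz_imp_bounded_inscribed_lengths[OF lipschitz_on_subset[OF lip]]) (use m in auto)
  have ne: "inscribed_lengths \<gamma> s t \<noteq> {}" "inscribed_lengths \<gamma> s m \<noteq> {}" "inscribed_lengths \<gamma> m t \<noteq> {}"
    using inscribed_lengths_nonempty[of s t \<gamma>] inscribed_lengths_nonempty[of s m \<gamma>]
      inscribed_lengths_nonempty[of m t \<gamma>] m by (metis empty_iff order.trans)+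
  show "curve_length \<gamma> s t \<le> curve_length \<gamma> s m + curve_length \<gamma> m t"
    unfolding curve_length_eq_Sup
  proof (rule cSup_least[OF ne(1)])
    fix l assume "l \<in> inscribed_lengths \<gamma> s t"
    then obtain n p where l: "l = (\<Sum>i<n. dist (\<gamma> (p i)) (\<gamma> (p (Suc i))))"
      and p: "p 0 = s" "p n = t" "\<forall>i<n. p i \<le> p (Suc i)"
      unfolding inscribed_lengths_def by auto
    define lo hi where "lo i = min (p i) m" and "hi i = max (p i) m" for i
    have "l \<le> (\<Sum>i<n. dist (\<gamma> (lo i)) (\<gamma> (lo (Suc i))) + dist (\<gamma> (hi i)) (\<gamma> (hi (Suc i))))"
      unfolding l
    proof (intro sum_mono)
      fix i assume "i \<in> {..<n}"
      then have "p i \<le> p (Suc i)" using p(3) by simp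
      then show "dist (\<gamma> (p i)) (\<gamma> (p (Suc i)))
          \<le> dist (\<gamma> (lo i)) (\<gamma> (lo (Suc i))) + dist (\<gamma> (hi i)) (\<gamma> (hi (Suc i)))"
        using dist_triangle[of "\<gamma> (p i)" "\<gamma> (p (Suc i))" "\<gamma> m"] by (auto simp: lo_def hi_def min_def max_def)
    qed
    also have "\<dots> = (\<Sum>i<n. dist (\<gamma> (lo i)) (\<gamma> (lo (Suc i)))) + (\<Sum>i<n. dist (\<gamma> (hi i)) (\<gamma> (hi (Suc i))))"
      by (rule sum.distrib)
    also have "\<dots> \<le> Sup (inscribed_lengths \<gamma> s m) + Sup (inscribed_lengths \<gamma> m t)"
    proof (intro add_mono cSup_upper bdd_lo bdd_hi)
      show "(\<Sum>i<n. dist (\<gamma> (lo i)) (\<gamma> (lo (Suc i)))) \<in> inscribed_lengths \<gamma> s m"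
        unfolding inscribed_lengths_def using p m
        by (intro CollectI exI[of _ n] exI[of _ lo]) (simp add: lo_def min.coboundedI1)
      show "(\<Sum>i<n. dist (\<gamma> (hi i)) (\<gamma> (hi (Suc i)))) \<in> inscribed_lengths \<gamma> m t"
        unfolding inscribed_lengths_def using p m
        by (intro CollectI exI[of _ n] exI[of _ hi]) (simp add: hi_def max.coboundedI1)
    qed
    finally show "l \<le> Sup (inscribed_lengths \<gamma> s m) + Sup (inscribed_lengths \<gamma> m t)" .
  qed
  have "Sup (inscribed_lengths \<gamma> s m) \<le> Sup (inscribed_lengths \<gamma> s t) - Sup (inscribed_lengths \<gamma> m t)"
  proof (rule cSup_least[OF ne(2)])
    fix l assume l: "l \<in> inscribed_lengths \<gamma> s m"
    have "Sup (inscribed_lengths \<gamma> m t) \<le> Sup (inscribed_lengths \<gamma> s t) - l"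
    proof (rule cSup_least[OF ne(3)])
      fix l' assume "l' \<in> inscribed_lengths \<gamma> m t"
      then show "l' \<le> Sup (inscribed_lengths \<gamma> s t) - l"
        using cSup_upper[OF concat_inscribed_lengths[OF l] bdd] by force
    qed
    then show "l \<le> Sup (inscribed_lengths \<gamma> s t) - Sup (inscribed_lengths \<gamma> m t)" by simp
  qed
  then show "curve_length \<gamma> s m + curve_length \<gamma> m t \<le> curve_length \<gamma> s t"
    by (simp add: curve_length_eq_Sup)
qed

section \<open>Area and length of polar arcs\<close>

text \<open>Here and below \<open>u\<close> is the reciprocal of a radial function: the boundary point in direction
  \<open>x\<close> has norm \<open>1 / u x\<close>. A straight line then corresponds to a sinusoid.\<close>

definition polar_curve :: "(real \<Rightarrow> real) \<Rightarrow> real \<Rightarrow> real^2" where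
  "polar_curve u x = (1 / u x) *\<^sub>R direction x"

definition polar_sector :: "(real \<Rightarrow> real) \<Rightarrow> real \<Rightarrow> real \<Rightarrow> (real^2) set" where
  "polar_sector u s t = {r *\<^sub>R direction x | r x. 0 \<le> r \<and> s \<le> x \<and> x \<le> t \<and> r * u x \<le> 1}"

definition arc_J :: "real \<Rightarrow> (real \<Rightarrow> real) \<Rightarrow> real \<Rightarrow> real \<Rightarrow> real" where
  "arc_J lam u s t
     = lam * measure lebesgue (polar_sector u s t) - curve_length (polar_curve u) s t"

lemma polar_sectorI:
  "0 \<le> r \<Longrightarrow> s \<le> x \<Longrightarrow> x \<le> t \<Longrightarrow> r * u x \<le> 1 \<Longrightarrow> r *\<^sub>R direction x \<in> polar_sector u s t"
  unfolding polar_sector_def by blast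

lemma polar_sectorE:
  assumes "z \<in> polar_sector u s t"
  obtains r x where "z = r *\<^sub>R direction x" "0 \<le> r" "s \<le> x" "x \<le> t" "r * u x \<le> 1"
  using assms unfolding polar_sector_def by blast

lemma continuous_on_direction: "continuous_on S direction"
proof (rule continuous_on_subset[OF lipschitz_on_continuous_on])
  show "1-lipschitz_on UNIV direction"
    by (rule lipschitz_onI) (simp_all add: dist_direction_le dist_real_def)
qed simp

lemma compact_polar_sector:
  assumes u: "continuous_on {s..t} u" and pos: "\<And>x. x \<in> {s..t} \<Longrightarrow> 0 < u x"
  shows "compact (polar_sector u s t)"
proof -
  let ?g = "\<lambda>(x, k). (k / u x) *\<^sub>R direction x"
  have "continuous_on ({s..t} \<times> {0..1}) ?g"
    unfolding case_prod_beta
  proof (intro continuous_intros)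
    show "continuous_on ({s..t} \<times> {0..1}) (\<lambda>p. u (fst p))"
      by (rule continuous_on_compose2[OF u continuous_on_fst[OF continuous_on_id]]) auto
    show "\<forall>p\<in>{s..t} \<times> {0..1::real}. u (fst p) \<noteq> 0" using pos by fastforce
    show "continuous_on ({s..t} \<times> {0..1::real}) (\<lambda>p. direction (fst p))"
      by (rule continuous_on_compose2[OF continuous_on_direction continuous_on_fst[OF continuous_on_id]])
        (rule subset_UNIV)
  qed
  then have "compact (?g ` ({s..t} \<times> {0..1}))"
    by (rule compact_continuous_image) (intro compact_Times compact_Icc)
  moreover have "?g ` ({s..t} \<times> {0..1}) = polar_sector u s t"
  proof (intro equalityI subsetI)
    fix z assume "z \<in> ?g ` ({s..t} \<times> {0..1})"
    then obtain x k where "x \<in> {s..t}" "0 \<le> k" "k \<le> 1" "z = (k / u x) *\<^sub>R direction x" by auto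
    moreover have "0 < u x" using pos calculation(1) .
    ultimately show "z \<in> polar_sector u s t" by (auto intro!: polar_sectorI)
  next
    fix z assume "z \<in> polar_sector u s t"
    then obtain r x where z: "z = r *\<^sub>R direction x" "0 \<le> r" "s \<le> x" "x \<le> t" "r * u x \<le> 1"
      by (rule polar_sectorE)
    then have p: "0 < u x" using pos by simp
    have "z = ?g (x, r * u x)" using p z by simp
    moreover have "(x, r * u x) \<in> {s..t} \<times> {0..1}" using p z by simp
    ultimately show "z \<in> ?g ` ({s..t} \<times> {0..1})" by (rule image_eqI)
  qed
  ultimately show ?thesis by simp
qed

lemma polar_sector_split:
  assumes "s \<le> m" "m \<le> t"
  shows "polar_sector u s t = polar_sector u s m \<union> polar_sector u m t"
proof (intro equalityI subsetI)
  fix z assume "z \<in> polar_sector u s t"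
  then obtain r x where "z = r *\<^sub>R direction x" "0 \<le> r" "s \<le> x" "x \<le> t" "r * u x \<le> 1"
    by (rule polar_sectorE)
  then show "z \<in> polar_sector u s m \<union> polar_sector u m t"
    by (cases "x \<le> m") (auto intro: polar_sectorI)
next
  fix z assume "z \<in> polar_sector u s m \<union> polar_sector u m t"
  then show "z \<in> polar_sector u s t"
    using assms by (auto elim!: polar_sectorE intro!: polar_sectorI)
qed

lemma negligible_ray_line: "negligible {r *\<^sub>R direction x | r. True}"
proof (rule negligible_subset[OF negligible_hyperplane])
  show "{r *\<^sub>R direction x | r. True} \<subseteq> {z. direction (x + pi / 2) \<bullet> z = 0}"
    by (auto simp: inner_direction)
  show "direction (x + pi / 2) \<noteq> 0 \<or> (0::real) \<noteq> 0"
    using norm_direction[of "x + pi / 2"] by (metis norm_zero zero_neq_one)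
qed

text \<open>Two adjacent sectors that together do not exceed a full turn overlap only in the rays that
  bound them.\<close>

lemma measure_polar_sector_add:
  assumes u: "continuous_on {s..t} u" and pos: "\<And>x. x \<in> {s..t} \<Longrightarrow> 0 < u x"
    and m: "s \<le> m" "m \<le> t" and turn: "t \<le> s + 2 * pi"
  shows "measure lebesgue (polar_sector u s t)
           = measure lebesgue (polar_sector u s m) + measure lebesgue (polar_sector u m t)"
proof -
  let ?A = "polar_sector u s m" and ?B = "polar_sector u m t"
  have "compact ?A" "compact ?B"
    by (rule compact_polar_sector; use m pos in \<open>auto intro: continuous_on_subset[OF u]\<close>)+
  then have meas: "?A \<in> lmeasurable" "?B \<in> lmeasurable" by (simp_all add: lmeasurable_compact)
  have "?A \<inter> ?B \<subseteq> {r *\<^sub>R direction s | r. True} \<union> {r *\<^sub>R direction m | r. True}"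
  proof
    fix z assume z: "z \<in> ?A \<inter> ?B"
    obtain r x where rx: "z = r *\<^sub>R direction x" "0 \<le> r" "s \<le> x" "x \<le> m"
      using z by (auto elim: polar_sectorE)
    obtain q y where qy: "z = q *\<^sub>R direction y" "0 \<le> q" "m \<le> y" "y \<le> t"
      using z by (auto elim: polar_sectorE)
    have "norm z = r" unfolding rx(1) using rx(2) by simp
    moreover have "norm z = q" unfolding qy(1) using qy(2) by simp
    ultimately have eq: "r = q" by simp
    show "z \<in> {r *\<^sub>R direction s | r. True} \<union> {r *\<^sub>R direction m | r. True}"
    proof (cases "r = 0")
      case True
      then have "z = 0 *\<^sub>R direction s" using rx(1) by simp
      then show ?thesis by blast
    next
      case False
      then have "direction x = direction y" using rx(1) qy(1) eq by simp
      then have "y = x \<or> y = x + 2 * pi"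
        by (rule direction_eq_within_period) (use rx qy turn in linarith)+
      then have "x = m \<or> x = s" using rx qy turn by linarith
      then show ?thesis using rx(1) by blast
    qed
  qed
  then have "negligible (?A \<inter> ?B)"
    by (rule negligible_subset[rotated]) (intro negligible_Un negligible_ray_line)
  then have "measure lebesgue (?A \<inter> ?B) = 0" by (rule negligible_imp_measure0)
  then show ?thesis
    unfolding polar_sector_split[OF m] using measure_Un3[OF meas] by simp
qed

definition rotation :: "real \<Rightarrow> real^2 \<Rightarrow> real^2" where
  "rotation d z = vector [cos d * z $ 1 - sin d * z $ 2, sin d * z $ 1 + cos d * z $ 2]"

lemma rotation_direction: "rotation d (r *\<^sub>R direction x) = r *\<^sub>R direction (x + d)"
  unfolding plane_eq_iff by (simp add: rotation_def cos_add sin_add algebra_simps)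

lemma measure_rotation:
  assumes "S \<in> lmeasurable"
  shows "measure lebesgue (rotation d ` S) = measure lebesgue S"
proof -
  have lin: "linear (rotation d)"
    by (rule linearI) (simp_all add: rotation_def plane_eq_iff algebra_simps)
  have "det (matrix (rotation d)) = (cos d)\<^sup>2 + (sin d)\<^sup>2"
    by (simp add: det_2 matrix_def rotation_def axis_def power2_eq_square)
  then show ?thesis using measure_linear_image[OF lin assms] by simp
qed

lemma polar_sector_shift:
  assumes "\<And>x. x \<in> {s..t} \<Longrightarrow> u' (x + d) = u x"
  shows "polar_sector u' (s + d) (t + d) = rotation d ` polar_sector u s t"
proof (intro equalityI subsetI)
  fix z assume "z \<in> polar_sector u' (s + d) (t + d)"
  then obtain r x where z: "z = r *\<^sub>R direction x" "0 \<le> r" "s + d \<le> x" "x \<le> t + d" "r * u' x \<le> 1"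
    by (rule polar_sectorE)
  then have "u' x = u (x - d)" using assms[of "x - d"] by simp
  then have "r *\<^sub>R direction (x - d) \<in> polar_sector u s t" using z by (intro polar_sectorI) auto
  moreover have "z = rotation d (r *\<^sub>R direction (x - d))" using z(1) by (simp add: rotation_direction)
  ultimately show "z \<in> rotation d ` polar_sector u s t" by (rule image_eqI[rotated])
next
  fix z assume "z \<in> rotation d ` polar_sector u s t"
  then obtain w where w: "w \<in> polar_sector u s t" "z = rotation d w" by blast
  from w(1) obtain r x where "w = r *\<^sub>R direction x" "0 \<le> r" "s \<le> x" "x \<le> t" "r * u x \<le> 1"
    by (rule polar_sectorE)
  then show "z \<in> polar_sector u' (s + d) (t + d)"
    using w(2) assms[of x] by (simp add: rotation_direction polar_sectorI)
qed

lemma dist_polar_shift: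
  "dist (r *\<^sub>R direction (s + d)) (q *\<^sub>R direction (t + d)) = dist (r *\<^sub>R direction s) (q *\<^sub>R direction t)"
proof -
  have "(dist (r *\<^sub>R direction (s + d)) (q *\<^sub>R direction (t + d)))\<^sup>2
          = (dist (r *\<^sub>R direction s) (q *\<^sub>R direction t))\<^sup>2"
    unfolding dist_polar by simp
  then show ?thesis by (simp add: power2_eq_iff_nonneg)
qed

lemma arc_J_shift:
  assumes u: "continuous_on {s..t} u" and pos: "\<And>x. x \<in> {s..t} \<Longrightarrow> 0 < u x"
    and eq: "\<And>x. x \<in> {s..t} \<Longrightarrow> u' (x + d) = u x"
  shows "arc_J lam u' (s + d) (t + d) = arc_J lam u s t"
proof -
  have "polar_sector u s t \<in> lmeasurable"
    using compact_polar_sector[OF u pos] by (simp add: lmeasurable_compact)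
  moreover have "polar_sector u' (s + d) (t + d) = rotation d ` polar_sector u s t"
    by (rule polar_sector_shift) (rule eq)
  ultimately have "measure lebesgue (polar_sector u' (s + d) (t + d)) = measure lebesgue (polar_sector u s t)"
    by (simp add: measure_rotation)
  moreover have "curve_length (polar_curve u') (s + d) (t + d) = curve_length (polar_curve u) s t"
    by (rule curve_length_isometric) (simp add: polar_curve_def eq dist_polar_shift)
  ultimately show ?thesis by (simp add: arc_J_def)
qed

lemma arc_J_cong:
  assumes "continuous_on {s..t} u" "\<And>x. x \<in> {s..t} \<Longrightarrow> 0 < u x" "\<And>x. x \<in> {s..t} \<Longrightarrow> u' x = u x"
  shows "arc_J lam u' s t = arc_J lam u s t"
  using arc_J_shift[of s t u u' 0 lam] assms by simp

text \<open>The points of a straight arc at distance \<open>p\<close> from the origin are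
  \<open>p (1, tan x)\<close> in the coordinates adapted to the foot of the perpendicular.\<close>

lemma polar_sector_straight:
  assumes p: "0 < p" and st: "- (pi / 2) < s" "s \<le> t" "t < pi / 2"
  shows "polar_sector (\<lambda>x. cos x / p) s t
           = convex hull {0, vector [p, p * tan s], vector [p, p * tan t]}"
    (is "?S = convex hull {0, ?B, ?C}")
proof (intro equalityI subsetI)
  fix z assume "z \<in> ?S"
  then obtain r x where z: "z = r *\<^sub>R direction x" "0 \<le> r" "s \<le> x" "x \<le> t" "r * (cos x / p) \<le> 1"
    by (rule polar_sectorE)
  have c: "0 < cos x" using z st by (intro cos_gt_zero_pi) auto
  have "tan s \<le> tan x" "tan x \<le> tan t" using z st by (auto intro!: tan_mono_le)
  then have "tan x \<in> closed_segment (tan s) (tan t)" by (simp add: closed_segment_eq_real_ivl)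
  then obtain \<mu> where \<mu>: "0 \<le> \<mu>" "\<mu> \<le> 1" "tan x = (1 - \<mu>) * tan s + \<mu> * tan t"
    by (auto simp: closed_segment_def)
  define k where "k = r * cos x / p"
  have k: "0 \<le> k" "k \<le> 1" using z p c by (simp_all add: k_def)
  have rc: "r * cos x = k * p" using p by (simp add: k_def)
  have "r * sin x = k * p * tan x" using c unfolding rc[symmetric] tan_def by simp
  then have "z = (1 - k) *\<^sub>R 0 + (k * (1 - \<mu>)) *\<^sub>R ?B + (k * \<mu>) *\<^sub>R ?C"
    unfolding z(1) plane_eq_iff using rc \<mu>(3) by (simp add: algebra_simps)
  moreover have "0 \<le> k * (1 - \<mu>)" "0 \<le> k * \<mu>"
    using k \<mu> by (intro mult_nonneg_nonneg; simp)+
  moreover have "0 \<le> 1 - k" "(1 - k) + k * (1 - \<mu>) + k * \<mu> = 1"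
    using k by (simp_all add: algebra_simps)
  ultimately show "z \<in> convex hull {0, ?B, ?C}" unfolding convex_hull_3 by blast
next
  fix z assume "z \<in> convex hull {0, ?B, ?C}"
  then obtain w v l where wvl: "0 \<le> l" "0 \<le> v" "0 \<le> w" "l + v + w = 1"
    and z: "z = v *\<^sub>R ?B + w *\<^sub>R ?C"
    unfolding convex_hull_3 by auto
  show "z \<in> ?S"
  proof (cases "v + w = 0")
    case True
    then have "v = 0" "w = 0" using wvl by linarith+
    then have "z = 0 *\<^sub>R direction s" using z by simp
    then show ?thesis using polar_sectorI[of 0 s s t "\<lambda>x. cos x / p"] st by simp
  next
    case False
    then have vw: "0 < v + w" using wvl by linarith
    define T where "T = (v * tan s + w * tan t) / (v + w)"
    have le: "tan s \<le> tan t" using st by (intro tan_mono_le) auto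
    have T: "tan s \<le> T" "T \<le> tan t"
      using vw wvl le mult_left_mono[OF le wvl(3)] mult_left_mono[OF le wvl(2)]
      by (simp_all add: T_def field_simps)
    define x where "x = arctan T"
    have tx: "tan x = T" by (simp add: x_def tan_arctan)
    have c: "0 < cos x" unfolding x_def by (rule cos_gt_zero_pi[OF arctan_lbound arctan_ubound])
    have "arctan (tan s) \<le> x" "x \<le> arctan (tan t)" unfolding x_def using T by (auto intro: arctan_monotone')
    then have x: "s \<le> x" "x \<le> t" using st by (simp_all add: arctan_tan)
    define r where "r = (v + w) * p / cos x"
    have "0 \<le> r" using vw p c by (simp add: r_def)
    moreover have "r * (cos x / p) \<le> 1" using c p wvl by (simp add: r_def)
    moreover have "z = r *\<^sub>R direction x"
    proof -
      have cx: "r * cos x = (v + w) * p" using c by (simp add: r_def)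
      have "r * sin x = p * ((v + w) * tan x)" using c by (simp add: r_def tan_def)
      also have "(v + w) * tan x = v * tan s + w * tan t" unfolding tx using vw by (simp add: T_def)
      finally show ?thesis unfolding z plane_eq_iff using cx by (simp add: algebra_simps)
    qed
    ultimately show ?thesis using x by (auto intro: polar_sectorI)
  qed
qed

lemma arc_J_straight:
  assumes p: "0 < p" and st: "m - pi / 2 < s" "s \<le> t" "t < m + pi / 2"
    and u: "\<And>x. x \<in> {s..t} \<Longrightarrow> u x = cos (x - m) / p"
  shows "arc_J lam u s t = (lam * p\<^sup>2 / 2 - p) * (tan (t - m) - tan (s - m))"
proof -
  let ?v = "\<lambda>x. cos x / p" and ?s = "s - m" and ?t = "t - m"
  have st': "- (pi / 2) < ?s" "?s \<le> ?t" "?t < pi / 2" using st by auto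
  have cpos: "0 < cos x" if "x \<in> {?s..?t}" for x using that st' by (intro cos_gt_zero_pi) auto
  have "arc_J lam u (?s + m) (?t + m) = arc_J lam ?v ?s ?t"
    by (rule arc_J_shift) (use cpos p in \<open>auto intro!: continuous_intros simp: u\<close>)
  moreover have "measure lebesgue (polar_sector ?v ?s ?t) = p\<^sup>2 / 2 * (tan ?t - tan ?s)"
  proof -
    let ?H = "convex hull {0, vector [p, p * tan ?s], vector [p, p * tan ?t]} :: (real^2) set"
    have "compact ?H" by (intro finite_imp_compact_convex_hull) simp
    then have "measure lebesgue ?H = measure lborel ?H"
      by (intro measure_completion) (simp add: compact_imp_closed)
    also have "\<dots> = \<bar>p * (p * tan ?s) - p * (p * tan ?t)\<bar> / 2" by (simp add: content_triangle)
    also have "\<dots> = p\<^sup>2 / 2 * (tan ?t - tan ?s)"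
    proof -
      have "tan ?s \<le> tan ?t" using st' by (intro tan_mono_le) auto
      then have "p * p * tan ?s \<le> p * p * tan ?t" by (intro mult_left_mono) auto
      then show ?thesis by (simp add: power2_eq_square field_simps)
    qed
    finally show ?thesis using polar_sector_straight[OF p st'] by simp
  qed
  moreover have "curve_length (polar_curve ?v) ?s ?t = p * tan ?t - p * tan ?s"
  proof (rule curve_length_straight[OF st'(2)])
    fix x y assume xy: "?s \<le> x" "x \<le> y" "y \<le> ?t"
    have pc: "polar_curve ?v x = p *\<^sub>R direction 0 + (p * tan x) *\<^sub>R direction (pi / 2)"
      if "x \<in> {?s..?t}" for x
      using line_in_polar_coordinates[of x 0 p] cpos[OF that] by (simp add: polar_curve_def)
    have "tan x \<le> tan y" using xy st' by (intro tan_mono_le) auto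
    then have le: "p * tan x \<le> p * tan y" using p by (intro mult_left_mono) auto
    have "dist (polar_curve ?v x) (polar_curve ?v y)
        = norm ((p * tan x - p * tan y) *\<^sub>R direction (pi / 2))"
      using pc[of x] pc[of y] xy by (simp add: dist_norm algebra_simps)
    also have "\<dots> = p * tan y - p * tan x" using le unfolding norm_scaleR by simp
    finally show "dist (polar_curve ?v x) (polar_curve ?v y) = p * tan y - p * tan x" .
  qed
  ultimately show ?thesis by (simp add: arc_J_def algebra_simps)
qed

section \<open>Profiles\<close>

text \<open>The two bounds confine the curve to the closed annulus between the two circles. The Lipschitz
  condition makes its length finite, without which lengths would not be additive.\<close>

definition profile :: "real \<Rightarrow> real \<Rightarrow> (real \<Rightarrow> real) \<Rightarrow> real \<Rightarrow> real \<Rightarrow> bool" where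
  "profile a b u s t \<longleftrightarrow>
     (\<exists>L. L-lipschitz_on {s..t} u) \<and> (\<forall>x\<in>{s..t}. 1 / b \<le> u x \<and> u x \<le> 1 / a)"

lemma profile_continuous: "profile a b u s t \<Longrightarrow> continuous_on {s..t} u"
  unfolding profile_def by (blast intro: lipschitz_on_continuous_on)

lemma profile_pos: "0 < b \<Longrightarrow> profile a b u s t \<Longrightarrow> x \<in> {s..t} \<Longrightarrow> 0 < u x"
  unfolding profile_def by (meson less_le_trans zero_less_divide_1_iff)

lemma lipschitz_polar_curve:
  assumes "0 < b" "profile a b u s t"
  shows "\<exists>L. L-lipschitz_on {s..t} (polar_curve u)"
proof -
  obtain L where L: "L-lipschitz_on {s..t} u" using assms(2) by (auto simp: profile_def)
  have L0: "0 \<le> L" using lipschitz_on_nonneg[OF L] .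
  have inv: "0 < 1 / u x" "1 / u x \<le> b" if "x \<in> {s..t}" for x
  proof -
    have "0 < u x" "1 / b \<le> u x" using assms profile_pos that by (auto simp: profile_def)
    then show "0 < 1 / u x" "1 / u x \<le> b" using assms(1) by (simp_all add: field_simps)
  qed
  have "(b * b * L + b)-lipschitz_on {s..t} (polar_curve u)"
  proof (rule lipschitz_onI)
    fix x y assume x: "x \<in> {s..t}" and y: "y \<in> {s..t}"
    let ?X = "1 / u x" and ?Y = "1 / u y"
    have "polar_curve u x - polar_curve u y = (?X - ?Y) *\<^sub>R direction x + ?Y *\<^sub>R (direction x - direction y)"
      by (simp add: polar_curve_def algebra_simps)
    then have "dist (polar_curve u x) (polar_curve u y)
        \<le> norm ((?X - ?Y) *\<^sub>R direction x) + norm (?Y *\<^sub>R (direction x - direction y))"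
      unfolding dist_norm by (metis norm_triangle_ineq)
    also have "\<dots> = \<bar>?X - ?Y\<bar> + ?Y * dist (direction x) (direction y)"
      using inv(1)[OF y] by (simp add: dist_norm)
    also have "\<dots> \<le> b * b * (L * \<bar>x - y\<bar>) + b * \<bar>x - y\<bar>"
    proof (intro add_mono mult_mono dist_direction_le inv y)
      have "?X - ?Y = ?X * ?Y * (u y - u x)" using inv(1)[OF x] inv(1)[OF y] by (simp add: field_simps)
      then have "\<bar>?X - ?Y\<bar> = ?X * ?Y * \<bar>u y - u x\<bar>"
        using inv(1)[OF x] inv(1)[OF y] by (simp only: abs_mult abs_of_pos)
      also have "\<dots> \<le> b * b * (L * \<bar>x - y\<bar>)"
        using lipschitz_onD[OF L y x] inv[OF x] inv[OF y] L0 assms(1)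
        by (intro mult_mono) (auto simp: dist_real_def abs_minus_commute)
      finally show "\<bar>?X - ?Y\<bar> \<le> b * b * (L * \<bar>x - y\<bar>)" .
    qed (use assms(1) in auto)
    finally show "dist (polar_curve u x) (polar_curve u y) \<le> (b * b * L + b) * dist x y"
      by (simp add: dist_real_def algebra_simps)
  qed (use L0 assms(1) in simp)
  then show ?thesis by blast
qed

lemma arc_J_add:
  assumes b: "0 < b" and u: "profile a b u s t" and m: "s \<le> m" "m \<le> t" "t \<le> s + 2 * pi"
  shows "arc_J lam u s t = arc_J lam u s m + arc_J lam u m t"
proof -
  obtain L where "L-lipschitz_on {s..t} (polar_curve u)" using lipschitz_polar_curve[OF b u] by blast
  from curve_length_add[OF this m(1,2)]
    measure_polar_sector_add[OF profile_continuous[OF u] profile_pos[OF b u] m]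
  show ?thesis by (simp add: arc_J_def algebra_simps)
qed

section \<open>The polar gauge of a convex set\<close>

locale annulus =
  fixes a b :: real
  assumes a_pos: "0 < a" and a_less_b: "a < b"

text \<open>The Minkowski functional of \<open>K\<close> on the unit circle.\<close>

definition polar_gauge :: "(real^2) set \<Rightarrow> real \<Rightarrow> real" where
  "polar_gauge K t = 1 / Sup {r. r *\<^sub>R direction t \<in> K}"

context annulus
begin

lemma b_pos: "0 < b" using a_pos a_less_b by linarith

lemma radius_facts:
  assumes K: "K \<in> C_class a b"
  defines "\<rho> \<equiv> \<lambda>t. Sup {r. r *\<^sub>R direction t \<in> K}"
  shows "a \<le> \<rho> t" "\<rho> t \<le> b" "\<rho> t *\<^sub>R direction t \<in> K" "0 \<le> r \<Longrightarrow> r *\<^sub>R direction t \<in> K \<longleftrightarrow> r \<le> \<rho> t"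
proof -
  have K': "compact K" "convex K" "cball 0 a \<subseteq> K" "K \<subseteq> cball 0 b" using K by (auto simp: C_class_def)
  let ?S = "{r. r *\<^sub>R direction t \<in> K}"
  have aS: "a \<in> ?S" using K'(3) a_pos by (auto simp: subset_iff)
  have bS: "r \<le> b" if "r \<in> ?S" for r
  proof -
    have "norm (r *\<^sub>R direction t) \<le> b" using that K'(4) by (auto simp: subset_iff)
    then show ?thesis by simp
  qed
  have bdd: "bdd_above ?S" using bS by (rule bdd_aboveI)
  have "closed ((\<lambda>r. r *\<^sub>R direction t) -` K)"
    by (rule closed_vimage[OF compact_imp_closed[OF K'(1)]]) (intro continuous_intros)
  then have cl: "closed ?S" by (simp add: vimage_def)
  have "Sup ?S \<in> ?S" using aS by (intro closed_contains_Sup bdd cl) blast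
  then show mem: "\<rho> t *\<^sub>R direction t \<in> K" by (simp add: \<rho>_def)
  show le: "a \<le> \<rho> t" unfolding \<rho>_def by (rule cSup_upper[OF aS bdd])
  show "\<rho> t \<le> b" unfolding \<rho>_def using aS bS by (intro cSup_least) blast+
  show "r *\<^sub>R direction t \<in> K \<longleftrightarrow> r \<le> \<rho> t" if r: "0 \<le> r"
  proof
    assume "r *\<^sub>R direction t \<in> K"
    then show "r \<le> \<rho> t" unfolding \<rho>_def by (intro cSup_upper[OF _ bdd]) simp
  next
    assume "r \<le> \<rho> t"
    have pos: "0 < \<rho> t" using le a_pos by linarith
    have "0 \<in> K" using K'(3) a_pos by (auto simp: subset_iff)
    then have "(1 - r / \<rho> t) *\<^sub>R 0 + (r / \<rho> t) *\<^sub>R (\<rho> t *\<^sub>R direction t) \<in> K"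
      using pos r \<open>r \<le> \<rho> t\<close> mem by (intro convexD[OF K'(2)]) (auto simp: field_simps)
    then show "r *\<^sub>R direction t \<in> K" using pos by simp
  qed
qed

lemma gauge_bounds:
  assumes "K \<in> C_class a b"
  shows "0 < polar_gauge K t" "1 / b \<le> polar_gauge K t" "polar_gauge K t \<le> 1 / a"
  using radius_facts(1,2)[OF assms, of t] a_pos by (auto simp: polar_gauge_def frac_le)

lemma mem_iff_gauge:
  assumes "K \<in> C_class a b" "0 \<le> r"
  shows "r *\<^sub>R direction t \<in> K \<longleftrightarrow> r * polar_gauge K t \<le> 1"
  using radius_facts(1)[OF assms(1), of t] radius_facts(4)[OF assms, of t] a_pos
  by (simp add: polar_gauge_def field_simps)

lemma gauge_periodic: "polar_gauge K (t + 2 * pi * of_int n) = polar_gauge K t"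
  by (simp only: polar_gauge_def direction_periodic)

lemma polar_curve_gauge: "polar_curve (polar_gauge K) = boundary_curve K"
  by (rule ext) (simp add: polar_curve_def polar_gauge_def boundary_curve_def)

text \<open>The gauge of \<open>K\<close> is subadditive and at most \<open>norm / a\<close>, because \<open>K\<close> contains the
  disc of radius \<open>a\<close>; so it is Lipschitz with constant \<open>1 / a\<close>.\<close>

lemma gauge_lipschitz_aux:
  assumes K: "K \<in> C_class a b"
  shows "polar_gauge K x \<le> polar_gauge K y + dist (direction x) (direction y) / a"
proof (cases "direction x = direction y")
  case True
  then show ?thesis by (simp add: polar_gauge_def)
next
  case False
  let ?u = "polar_gauge K" and ?d = "dist (direction x) (direction y)"
  have d: "0 < ?d" using False by simp
  have u: "0 < ?u y" using gauge_bounds(1)[OF K] .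
  define w where "w = ?u y + ?d / a"
  have w: "0 < w" using u d a_pos by (simp add: w_def add_pos_pos)
  have conv: "convex K" and sub: "cball 0 a \<subseteq> K" using K by (auto simp: C_class_def)
  have "(1 / ?u y) *\<^sub>R direction y \<in> K" using mem_iff_gauge[OF K, of "1 / ?u y" y] u by simp
  moreover have "(a / ?d) *\<^sub>R (direction x - direction y) \<in> K"
    using sub a_pos d by (auto simp: subset_iff dist_norm)
  moreover have "?u y / w + ?d / a / w = 1" 
    using w unfolding add_divide_distrib[symmetric] w_def[symmetric] by simp
  moreover have "0 \<le> ?u y / w" "0 \<le> ?d / a / w" using u d w a_pos by simp_all
  ultimately have "(?u y / w) *\<^sub>R ((1 / ?u y) *\<^sub>R direction y)
      + (?d / a / w) *\<^sub>R ((a / ?d) *\<^sub>R (direction x - direction y)) \<in> K"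
    by (intro convexD[OF conv])
  also have "(?u y / w) *\<^sub>R ((1 / ?u y) *\<^sub>R direction y)
      + (?d / a / w) *\<^sub>R ((a / ?d) *\<^sub>R (direction x - direction y)) = (1 / w) *\<^sub>R direction x"
    using u d w a_pos by (simp add: scaleR_diff_right)
  finally have "(1 / w) * ?u x \<le> 1" using mem_iff_gauge[OF K, of "1 / w" x] w by simp
  then have "?u x \<le> w" using w by (simp add: field_simps)
  then show ?thesis by (simp only: w_def)
qed

lemma profile_gauge:
  assumes K: "K \<in> C_class a b"
  shows "profile a b (polar_gauge K) s t"
proof -
  have "(1 / a)-lipschitz_on {s..t} (polar_gauge K)"
  proof (rule lipschitz_onI)
    fix x y
    have "dist (direction x) (direction y) / a \<le> \<bar>x - y\<bar> / a"
      using dist_direction_le a_pos by (intro divide_right_mono) auto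
    then show "dist (polar_gauge K x) (polar_gauge K y) \<le> 1 / a * dist x y"
      using gauge_lipschitz_aux[OF K, of x y] gauge_lipschitz_aux[OF K, of y x]
      by (simp add: dist_real_def dist_commute[of "direction y"] abs_le_iff)
  qed (use a_pos in simp)
  then show ?thesis using gauge_bounds[OF K] by (auto simp: profile_def)
qed

lemma polar_sector_gauge:
  assumes K: "K \<in> C_class a b"
  shows "polar_sector (polar_gauge K) s (s + 2 * pi) = K"
proof (intro equalityI subsetI)
  fix z assume "z \<in> polar_sector (polar_gauge K) s (s + 2 * pi)"
  then show "z \<in> K" using mem_iff_gauge[OF K] by (auto elim: polar_sectorE)
next
  fix z assume z: "z \<in> K"
  obtain t where t: "s \<le> t" "t < s + 2 * pi" "z = norm z *\<^sub>R direction t" by (rule polar_form)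
  then have "norm z * polar_gauge K t \<le> 1" using mem_iff_gauge[OF K, of "norm z" t] z by simp
  then have "norm z *\<^sub>R direction t \<in> polar_sector (polar_gauge K) s (s + 2 * pi)"
    using t(1,2) by (intro polar_sectorI) auto
  then show "z \<in> polar_sector (polar_gauge K) s (s + 2 * pi)" using t(3) by simp
qed

lemma J_eq_arc_J:
  assumes K: "K \<in> C_class a b"
  shows "J lam K = arc_J lam (polar_gauge K) s (s + 2 * pi)"
proof -
  let ?u = "polar_gauge K"
  have prof: "profile a b ?u s t" for s t by (rule profile_gauge[OF K])
  have 0: "J lam K = arc_J lam ?u 0 (2 * pi)"
    using polar_sector_gauge[OF K, of 0]
    by (simp add: J_def area_def perimeter_def arc_J_def polar_curve_gauge)
  have shift: "arc_J lam ?u (x + 2 * pi * of_int n) (y + 2 * pi * of_int n) = arc_J lam ?u x y" for x y n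
    by (rule arc_J_shift[OF profile_continuous[OF prof] profile_pos[OF b_pos prof]])
      (simp_all only: gauge_periodic)
  define n where "n = \<lfloor>s / (2 * pi)\<rfloor>"
  define r where "r = s - 2 * pi * of_int n"
  have "of_int n \<le> s / (2 * pi)" "s / (2 * pi) < of_int n + 1" unfolding n_def by linarith+
  then have r: "0 \<le> r" "r \<le> 2 * pi" by (simp_all add: r_def field_simps)
  have "arc_J lam ?u 0 (2 * pi) = arc_J lam ?u r (2 * pi) + arc_J lam ?u 0 r"
    using arc_J_add[OF b_pos prof, of 0 r "2 * pi"] r by simp
  also have "arc_J lam ?u 0 r = arc_J lam ?u (2 * pi) (r + 2 * pi)" using shift[of 0 1 r] by simp
  also have "arc_J lam ?u r (2 * pi) + \<dots> = arc_J lam ?u r (r + 2 * pi)"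
    using arc_J_add[OF b_pos prof, of r "2 * pi" "r + 2 * pi"] r by simp
  also have "\<dots> = arc_J lam ?u s (s + 2 * pi)"
    using shift[of r n "r + 2 * pi"] by (simp add: r_def add.commute add.left_commute)
  finally show ?thesis using 0 by simp
qed

text \<open>Convexity in polar coordinates: the point of the chord between the boundary points in
  directions \<open>t - h\<close> and \<open>t + h\<close> that lies in direction \<open>t\<close> belongs to \<open>K\<close>.\<close>

lemma gauge_midpoint:
  assumes K: "K \<in> C_class a b" and h: "0 < cos h"
  shows "2 * cos h * polar_gauge K t \<le> polar_gauge K (t - h) + polar_gauge K (t + h)"
proof -
  let ?u = "polar_gauge K"
  define w where "w = ?u (t - h) + ?u (t + h)"
  have pos: "0 < ?u x" for x using gauge_bounds(1)[OF K] .
  have w: "0 < w" using pos[of "t - h"] pos[of "t + h"] by (simp add: w_def)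
  have mem: "(1 / ?u x) *\<^sub>R direction x \<in> K" for x
    using mem_iff_gauge[OF K, of "1 / ?u x" x] pos[of x] by simp
  have conv: "convex K" using K by (auto simp: C_class_def)
  have "(?u (t - h) / w) *\<^sub>R ((1 / ?u (t - h)) *\<^sub>R direction (t - h))
      + (?u (t + h) / w) *\<^sub>R ((1 / ?u (t + h)) *\<^sub>R direction (t + h)) \<in> K"
  proof (intro convexD[OF conv] mem)
    show "?u (t - h) / w + ?u (t + h) / w = 1"
      using w unfolding add_divide_distrib[symmetric] w_def[symmetric] by simp
  qed (use w pos in \<open>auto intro: divide_nonneg_nonneg less_imp_le\<close>)
  also have "(?u (t - h) / w) *\<^sub>R ((1 / ?u (t - h)) *\<^sub>R direction (t - h))
      + (?u (t + h) / w) *\<^sub>R ((1 / ?u (t + h)) *\<^sub>R direction (t + h))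
      = (2 * cos h / w) *\<^sub>R direction t"
    using pos[of "t - h"] pos[of "t + h"] unfolding plane_eq_iff
    by (simp add: cos_diff cos_add sin_diff sin_add add_divide_distrib[symmetric])
  finally have "(2 * cos h / w) * ?u t \<le> 1" using mem_iff_gauge[OF K, of "2 * cos h / w" t] w h by simp
  then have "2 * cos h * ?u t \<le> w" using w by (simp add: field_simps)
  then show ?thesis by (simp only: w_def)
qed

end

section \<open>Local convexity implies convexity\<close>

text \<open>If \<open>u\<close> is the reciprocal of a radial function, the inequality says that the boundary point in
  direction \<open>x\<close> is not nearer to the origin than the chord joining the boundary points in
  directions \<open>x - h\<close> and \<open>x + h\<close>.\<close>

definition midpoint_convex_at :: "(real \<Rightarrow> real) \<Rightarrow> real \<Rightarrow> bool" where
  "midpoint_convex_at u x \<longleftrightarrow>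
     (\<exists>\<delta>>0. \<forall>h. 0 < h \<and> h < \<delta> \<longrightarrow> 2 * cos h * u x \<le> u (x - h) + u (x + h))"

text \<open>If \<open>u\<close> exceeded the sinusoid through its end values, then the quotient of the excess \<open>w\<close>
  by the positive sinusoid \<open>cos (x - m)\<close> would have a positive maximum; at the leftmost
  maximum point the midpoint inequality fails.\<close>

lemma local_midpoint_imp_sinusoidal_convex:
  fixes u :: "real \<Rightarrow> real"
  assumes t: "t1 < t2" "t2 - t1 < pi" and cont: "continuous_on {t1..t2} u"
    and mid: "\<And>x. t1 < x \<Longrightarrow> x < t2 \<Longrightarrow> midpoint_convex_at u x"
    and x: "t1 \<le> x" "x \<le> t2"
  shows "u x * sin (t2 - t1) \<le> u t1 * sin (t2 - x) + u t2 * sin (x - t1)"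
proof (rule ccontr)
  assume neg: "\<not> ?thesis"
  define m where "m = (t1 + t2) / 2"
  define w where "w y = u y * sin (t2 - t1) - u t1 * sin (t2 - y) - u t2 * sin (y - t1)" for y
  define c where "c y = cos (y - m)" for y
  define f where "f y = w y / c y" for y
  have spos: "0 < sin (t2 - t1)" using t by (intro sin_gt_zero) auto
  have cpos: "0 < c y" if "y \<in> {t1..t2}" for y
    unfolding c_def using that t by (intro cos_gt_zero_pi) (auto simp: m_def field_simps)
  have "c y \<noteq> 0" if "y \<in> {t1..t2}" for y using cpos[OF that] by simp
  then have fcont: "continuous_on {t1..t2} f" unfolding f_def w_def c_def
    by (intro continuous_intros cont ballI)
  have "compact {t1..t2}" "{t1..t2} \<noteq> {}" using t by simp_all
  then obtain y0 where y0: "y0 \<in> {t1..t2}" "\<forall>y\<in>{t1..t2}. f y \<le> f y0"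
    using continuous_attains_sup[OF _ _ fcont] by blast
  note y0 = y0(1) bspec[OF y0(2)]
  have "0 < w x" using neg by (simp add: w_def)
  then have "0 < f x" using cpos x by (simp add: f_def)
  then have M: "0 < f y0" using y0(2)[of x] x by simp
  let ?A = "{y \<in> {t1..t2}. f y = f y0}"
  have "?A = {t1..t2} \<inter> f -` {f y0}" by auto
  moreover have "closed ({t1..t2} \<inter> f -` {f y0})"
    by (rule continuous_closed_preimage[OF fcont]) simp_all
  ultimately have "closed ?A" by simp
  moreover have Abd: "bdd_below ?A" by (rule bdd_belowI[of _ t1]) simp
  moreover have "?A \<noteq> {}" using y0(1) by blast
  ultimately have InfA: "Inf ?A \<in> ?A" by (intro closed_contains_Inf)
  define z where "z = Inf ?A"
  have z: "z \<in> {t1..t2}" "f z = f y0" using InfA unfolding z_def by simp_all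
  have left: "f y < f y0" if y: "y \<in> {t1..t2}" "y < z" for y
  proof -
    have "f y \<noteq> f y0"
    proof
      assume "f y = f y0"
      then have "y \<in> ?A" using y(1) by simp
      then have "z \<le> y" unfolding z_def by (rule cInf_lower[OF _ Abd])
      then show False using y(2) by simp
    qed
    then show ?thesis using y0(2)[OF y(1)] by simp
  qed
  have "f t1 = 0" "f t2 = 0" by (simp_all add: f_def w_def)
  then have "z \<noteq> t1" "z \<noteq> t2" using M z(2) by (metis less_irrefl)+
  then have zi: "t1 < z" "z < t2" using z(1) by simp_all
  obtain \<delta> where \<delta>: "0 < \<delta>" "\<And>h. 0 < h \<Longrightarrow> h < \<delta> \<Longrightarrow> 2 * cos h * u z \<le> u (z - h) + u (z + h)"
    using mid[OF zi] unfolding midpoint_convex_at_def by blast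
  define h where "h = Min {\<delta> / 2, z - t1, t2 - z}"
  have h: "0 < h" "h < \<delta>" "h \<le> z - t1" "h \<le> t2 - z" using \<delta>(1) zi by (auto simp: h_def)
  have S: "sin (t2 - (z - h)) + sin (t2 - (z + h)) = 2 * cos h * sin (t2 - z)"
    "sin (z - h - t1) + sin (z + h - t1) = 2 * cos h * sin (z - t1)"
    "c (z - h) + c (z + h) = 2 * cos h * c z"
  proof -
    have shift: "t2 - (z - h) = (t2 - z) + h" "t2 - (z + h) = (t2 - z) - h"
      "z - h - t1 = (z - t1) - h" "z + h - t1 = (z - t1) + h"
      "z - h - m = (z - m) - h" "z + h - m = (z - m) + h" by simp_all
    show "sin (t2 - (z - h)) + sin (t2 - (z + h)) = 2 * cos h * sin (t2 - z)"
      "sin (z - h - t1) + sin (z + h - t1) = 2 * cos h * sin (z - t1)"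
      "c (z - h) + c (z + h) = 2 * cos h * c z"
      unfolding c_def shift sin_add sin_diff[of _ h] cos_add cos_diff[of _ h] by simp_all
  qed
  have "w (z - h) + w (z + h) = (u (z - h) + u (z + h)) * sin (t2 - t1)
      - u t1 * (sin (t2 - (z - h)) + sin (t2 - (z + h))) - u t2 * (sin (z - h - t1) + sin (z + h - t1))"
    unfolding w_def by algebra
  also have "\<dots> \<ge> (2 * cos h * u z) * sin (t2 - t1)
      - u t1 * (2 * cos h * sin (t2 - z)) - u t2 * (2 * cos h * sin (z - t1))"
    unfolding S using \<delta>(2)[OF h(1,2)] spos by simp
  also have "(2 * cos h * u z) * sin (t2 - t1)
      - u t1 * (2 * cos h * sin (t2 - z)) - u t2 * (2 * cos h * sin (z - t1)) = 2 * cos h * w z"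
    unfolding w_def by algebra
  finally have ge: "2 * cos h * w z \<le> w (z - h) + w (z + h)" .
  have wf: "w y = f y * c y" if "y \<in> {t1..t2}" for y using cpos[OF that] by (simp add: f_def)
  have in1: "z - h \<in> {t1..t2}" and in2: "z + h \<in> {t1..t2}" using h z(1) by auto
  have "w (z - h) < f y0 * c (z - h)"
    unfolding wf[OF in1] using left[OF in1] cpos[OF in1] h(1) by (intro mult_strict_right_mono) auto
  moreover have "w (z + h) \<le> f y0 * c (z + h)"
    unfolding wf[OF in2] using y0(2)[OF in2] cpos[OF in2] by (intro mult_right_mono) auto
  ultimately have "w (z - h) + w (z + h) < f y0 * (c (z - h) + c (z + h))" by (simp add: distrib_left)
  also have "\<dots> = 2 * cos h * w z" unfolding S using wf[OF z(1)] z(2) by simp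
  finally show False using ge by simp
qed

text \<open>A function on the circle that satisfies the midpoint inequality locally is the polar gauge
  of a convex set.\<close>

lemma convex_polar_region:
  fixes v :: "real \<Rightarrow> real"
  assumes cont: "continuous_on UNIV v" and pos: "\<And>x. 0 < v x"
    and per: "\<And>x (n::int). v (x + 2 * pi * of_int n) = v x"
    and mid: "\<And>x. midpoint_convex_at v x"
  shows "convex {r *\<^sub>R direction x | r x. 0 \<le> r \<and> r * v x \<le> 1}" (is "convex ?K")
proof -
  have KI: "r *\<^sub>R direction x \<in> ?K" if "0 \<le> r" "r * v x \<le> 1" for r x using that by blast
  have lt: "p *\<^sub>R (r1 *\<^sub>R direction t1) + q *\<^sub>R (r2 *\<^sub>R direction t2) \<in> ?K"
    if r: "0 \<le> r1" "r1 * v t1 \<le> 1" "0 \<le> r2" "r2 * v t2 \<le> 1"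
      and pq: "0 \<le> p" "0 \<le> q" "p + q = 1" and t: "t1 < t2" "t2 - t1 < pi" for p q r1 r2 t1 t2
  proof -
    let ?z = "p *\<^sub>R (r1 *\<^sub>R direction t1) + q *\<^sub>R (r2 *\<^sub>R direction t2)"
    have spos: "0 < sin (t2 - t1)" using t by (intro sin_gt_zero) auto
    obtain x where x: "t1 \<le> x" "x < t1 + 2 * pi" "?z = norm ?z *\<^sub>R direction x" by (rule polar_form)
    define r where "r = norm ?z"
    have z: "?z = r *\<^sub>R direction x" and r0: "0 \<le> r" using x(3) by (simp_all add: r_def)
    show ?thesis
    proof (cases "r = 0")
      case True
      then show ?thesis using z KI[of 0 x] by simp
    next
      case False
      then have rpos: "0 < r" using r0 by simp
      (* The components of ?z normal to the two rays show that its direction x lies between them,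
         and they are the weights in the sinusoidal convexity inequality. *)
      have "?z \<bullet> direction (t1 + pi / 2) = r * sin (x - t1)"
        unfolding z by (simp add: inner_direction cos_diff sin_diff cos_add sin_add algebra_simps)
      moreover have "?z \<bullet> direction (t1 + pi / 2) = q * r2 * sin (t2 - t1)"
        by (simp add: inner_add_left inner_direction cos_diff sin_diff cos_add sin_add algebra_simps)
      ultimately have s1: "r * sin (x - t1) = q * r2 * sin (t2 - t1)" by simp
      have "?z \<bullet> direction (t2 - pi / 2) = r * sin (t2 - x)"
        unfolding z by (simp add: inner_direction cos_diff sin_diff cos_add sin_add algebra_simps)
      moreover have "?z \<bullet> direction (t2 - pi / 2) = p * r1 * sin (t2 - t1)"
        by (simp add: inner_add_left inner_direction cos_diff sin_diff cos_add sin_add algebra_simps)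
      ultimately have s2: "r * sin (t2 - x) = p * r1 * sin (t2 - t1)" by simp
      have "0 \<le> r * sin (x - t1)" "0 \<le> r * sin (t2 - x)" unfolding s1 s2 using r pq spos by simp_all
      then have nn: "0 \<le> sin (x - t1)" "0 \<le> sin (t2 - x)" using rpos by (simp_all add: zero_le_mult_iff)
      have "x - t1 \<le> pi"
      proof (rule ccontr)
        assume "\<not> x - t1 \<le> pi"
        then have "sin (x - t1) < 0" using x(2) by (intro sin_lt_zero) auto
        then show False using nn(1) by simp
      qed
      have "x \<le> t2"
      proof (rule ccontr)
        assume "\<not> x \<le> t2"
        then have "0 < sin (x - t2)" using \<open>x - t1 \<le> pi\<close> t(1) by (intro sin_gt_zero) auto
        then show False using nn(2) sin_minus[of "x - t2"] by simp
      qed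
      have "v x * sin (t2 - t1) \<le> v t1 * sin (t2 - x) + v t2 * sin (x - t1)"
        by (rule local_midpoint_imp_sinusoidal_convex[OF t continuous_on_subset[OF cont] mid x(1) \<open>x \<le> t2\<close>]) simp
      then have "r * (v x * sin (t2 - t1)) \<le> r * (v t1 * sin (t2 - x) + v t2 * sin (x - t1))"
        using rpos by simp
      also have "\<dots> = v t1 * (r * sin (t2 - x)) + v t2 * (r * sin (x - t1))" by (simp add: algebra_simps)
      also have "\<dots> = (p * (r1 * v t1) + q * (r2 * v t2)) * sin (t2 - t1)"
        unfolding s1 s2 by (simp add: algebra_simps)
      also have "\<dots> \<le> (p * 1 + q * 1) * sin (t2 - t1)"
        using r pq spos by (intro mult_right_mono add_mono mult_left_mono) auto
      finally have "(r * v x) * sin (t2 - t1) \<le> 1 * sin (t2 - t1)" using pq(3) by (simp add: mult.assoc)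
      then have "r * v x \<le> 1" using spos by (simp only: mult_le_cancel_right_pos)
      then show ?thesis unfolding z using r0 by (intro KI)
    qed
  qed
  have le: "p *\<^sub>R (r1 *\<^sub>R direction t1) + q *\<^sub>R (r2 *\<^sub>R direction t2) \<in> ?K"
    if r: "0 \<le> r1" "r1 * v t1 \<le> 1" "0 \<le> r2" "r2 * v t2 \<le> 1"
      and pq: "0 \<le> p" "0 \<le> q" "p + q = 1" and t: "t1 \<le> t2" "t2 - t1 \<le> pi" for p q r1 r2 t1 t2
  proof -
    have pr: "(p * r1) * v t1 \<le> p" and qr: "(q * r2) * v t2 \<le> q"
      using mult_left_mono[OF r(2) pq(1)] mult_left_mono[OF r(4) pq(2)] by (simp_all add: mult.assoc)
    have pq1: "p \<le> 1" "q \<le> 1" using pq by auto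
    consider "t1 = t2" | "t2 = t1 + pi" | "t1 < t2" "t2 - t1 < pi" using t by fastforce
    then show ?thesis
    proof cases
      case 1
      have "(p * r1 + q * r2) *\<^sub>R direction t2 \<in> ?K"
        using r pq pr qr 1 by (intro KI) (auto simp: distrib_right)
      then show ?thesis using 1 by (simp add: scaleR_add_left)
    next
      case 2
      have d: "direction t2 = - direction t1" unfolding plane_eq_iff by (simp add: 2)
      show ?thesis
      proof (cases "q * r2 \<le> p * r1")
        case True
        have "0 \<le> (q * r2) * v t1" using r pq pos[of t1] by simp
        then have "(p * r1 - q * r2) *\<^sub>R direction t1 \<in> ?K"
          using True pr pq1 by (intro KI) (auto simp: left_diff_distrib)
        then show ?thesis using d by (simp add: scaleR_diff_left)
      next
        case False
        have "0 \<le> (p * r1) * v t2" using r pq pos[of t2] by simp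
        then have "(q * r2 - p * r1) *\<^sub>R direction t2 \<in> ?K"
          using False qr pq1 by (intro KI) (auto simp: left_diff_distrib)
        then show ?thesis using d by (simp add: scaleR_diff_left)
      qed
    next
      case 3
      then show ?thesis by (intro lt r pq)
    qed
  qed
  show ?thesis
  proof (rule convexI)
    fix x y p q assume xy: "x \<in> ?K" "y \<in> ?K" and pq: "(0::real) \<le> p" "0 \<le> q" "p + q = 1"
    obtain r1 t1 where x: "x = r1 *\<^sub>R direction t1" "0 \<le> r1" "r1 * v t1 \<le> 1" using xy(1) by blast
    obtain r2 t where y: "y = r2 *\<^sub>R direction t" "0 \<le> r2" "r2 * v t \<le> 1" using xy(2) by blast
    obtain t2 where t2: "t1 \<le> t2" "t2 < t1 + 2 * pi" "y = r2 *\<^sub>R direction t2" "r2 * v t2 \<le> 1"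
    proof -
      define n where "n = \<lfloor>(t1 - t) / (2 * pi)\<rfloor> + 1"
      have "of_int (n - 1) \<le> (t1 - t) / (2 * pi)" "(t1 - t) / (2 * pi) < of_int n"
        unfolding n_def by linarith+
      then have "t1 \<le> t + 2 * pi * of_int n" "t + 2 * pi * of_int n \<le> t1 + 2 * pi"
        by (simp_all add: field_simps)
      moreover have "y = r2 *\<^sub>R direction (t + 2 * pi * of_int n)" "r2 * v (t + 2 * pi * of_int n) \<le> 1"
        using y per direction_periodic by simp_all
      moreover have "y = r2 *\<^sub>R direction t1" "r2 * v t1 \<le> 1" if "t + 2 * pi * of_int n = t1 + 2 * pi"
        using calculation(3,4) that direction_periodic[of t1 1] per[of t1 1] by simp_all
      ultimately show ?thesis using that[of t1] that[of "t + 2 * pi * of_int n"] by fastforce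
    qed
    show "p *\<^sub>R x + q *\<^sub>R y \<in> ?K"
    proof (cases "t2 - t1 \<le> pi")
      case True
      then show ?thesis unfolding x(1) t2(3) using x y t2 pq by (intro le)
    next
      case False
      have "q *\<^sub>R (r2 *\<^sub>R direction t2) + p *\<^sub>R (r1 *\<^sub>R direction (t1 + 2 * pi)) \<in> ?K"
        using x y t2 pq False per[of t1 1] by (intro le) auto
      then show ?thesis unfolding x(1) t2(3) using direction_periodic[of t1 1] by (simp add: add.commute)
    qed
  qed
qed

section \<open>Arcs and their concatenation\<close>

context annulus
begin

text \<open>An arc starts and ends on the circle of radius \<open>1 / k\<close>. The last two conditions say that near
  its end points it stays on the inner side of the tangents of that circle there. When two arcs meet,
  these one-sided conditions add up to the midpoint inequality at the common point.\<close>

definition polar_arc :: "real \<Rightarrow> (real \<Rightarrow> real) \<Rightarrow> real \<Rightarrow> real \<Rightarrow> bool" where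
  "polar_arc k u s t \<longleftrightarrow> s \<le> t \<and> profile a b u s t \<and> u s = k \<and> u t = k
     \<and> (\<forall>x. s < x \<and> x < t \<longrightarrow> midpoint_convex_at u x)
     \<and> (\<exists>\<delta>>0. \<forall>h. 0 < h \<and> h < \<delta> \<and> s + h \<le> t \<longrightarrow> k * cos h \<le> u (s + h))
     \<and> (\<exists>\<delta>>0. \<forall>h. 0 < h \<and> h < \<delta> \<and> s \<le> t - h \<longrightarrow> k * cos h \<le> u (t - h))"

lemma arcD:
  assumes "polar_arc k u s t"
  shows "s \<le> t" "profile a b u s t" "u s = k" "u t = k"
    "s < x \<Longrightarrow> x < t \<Longrightarrow> midpoint_convex_at u x"
    "\<exists>\<delta>>0. \<forall>h. 0 < h \<and> h < \<delta> \<and> s + h \<le> t \<longrightarrow> k * cos h \<le> u (s + h)"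
    "\<exists>\<delta>>0. \<forall>h. 0 < h \<and> h < \<delta> \<and> s \<le> t - h \<longrightarrow> k * cos h \<le> u (t - h)"
  using assms unfolding polar_arc_def by blast+

lemma arcI:
  assumes "s \<le> t" "profile a b u s t" "u s = k" "u t = k"
    "\<And>x. s < x \<Longrightarrow> x < t \<Longrightarrow> midpoint_convex_at u x"
    "\<exists>\<delta>>0. \<forall>h. 0 < h \<and> h < \<delta> \<and> s + h \<le> t \<longrightarrow> k * cos h \<le> u (s + h)"
    "\<exists>\<delta>>0. \<forall>h. 0 < h \<and> h < \<delta> \<and> s \<le> t - h \<longrightarrow> k * cos h \<le> u (t - h)"
  shows "polar_arc k u s t"
  using assms unfolding polar_arc_def by simp

lemma arc_shift:
  assumes arc: "polar_arc k u s t" and eq: "\<And>x. s \<le> x \<Longrightarrow> x \<le> t \<Longrightarrow> u' (x + d) = u x"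
  shows "polar_arc k u' (s + d) (t + d)"
proof -
  note A = arcD[OF arc]
  have eq': "u' x = u (x - d)" if "s + d \<le> x" "x \<le> t + d" for x
    using eq[of "x - d"] that by simp
  obtain L where L: "L-lipschitz_on {s..t} u" and bds: "\<forall>x\<in>{s..t}. 1 / b \<le> u x \<and> u x \<le> 1 / a"
    using A(2) by (auto simp: profile_def)
  have lip: "L-lipschitz_on {s + d..t + d} u'"
  proof (rule lipschitz_onI[OF _ lipschitz_on_nonneg[OF L]])
    fix x y assume "x \<in> {s + d..t + d}" "y \<in> {s + d..t + d}"
    then show "dist (u' x) (u' y) \<le> L * dist x y"
      using lipschitz_onD[OF L, of "x - d" "y - d"] eq' by (simp add: dist_real_def)
  qed
  then have prof: "profile a b u' (s + d) (t + d)"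
    unfolding profile_def using bds eq' by (intro conjI exI[of _ L]) simp_all
  have ends: "u' (s + d) = k" "u' (t + d) = k" using A(1,3,4) eq by simp_all
  have mid: "midpoint_convex_at u' x" if x: "s + d < x" "x < t + d" for x
  proof -
    have "midpoint_convex_at u (x - d)" using x by (intro A(5)) auto
    then obtain \<delta> where \<delta>: "0 < \<delta>"
      "\<And>h. 0 < h \<Longrightarrow> h < \<delta> \<Longrightarrow> 2 * cos h * u (x - d) \<le> u (x - d - h) + u (x - d + h)"
      unfolding midpoint_convex_at_def by blast
    show ?thesis unfolding midpoint_convex_at_def
    proof (intro exI[of _ "min \<delta> (min (x - (s + d)) (t + d - x))"] conjI allI impI)
      fix h assume h: "0 < h \<and> h < min \<delta> (min (x - (s + d)) (t + d - x))"
      then have "u' x = u (x - d)" "u' (x - h) = u (x - d - h)" "u' (x + h) = u (x - d + h)"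
        using x eq'[of x] eq'[of "x - h"] eq'[of "x + h"] by (simp_all add: algebra_simps)
      then show "2 * cos h * u' x \<le> u' (x - h) + u' (x + h)" using \<delta>(2)[of h] h by simp
    qed (use \<delta>(1) x in simp)
  qed
  have left: "\<exists>\<delta>>0. \<forall>h. 0 < h \<and> h < \<delta> \<and> s + d + h \<le> t + d \<longrightarrow> k * cos h \<le> u' (s + d + h)"
  proof -
    obtain \<delta> where \<delta>: "0 < \<delta>" "\<And>h. 0 < h \<Longrightarrow> h < \<delta> \<Longrightarrow> s + h \<le> t \<Longrightarrow> k * cos h \<le> u (s + h)"
      using A(6) by blast
    show ?thesis
    proof (intro exI[of _ \<delta>] conjI allI impI \<delta>(1))
      fix h assume "0 < h \<and> h < \<delta> \<and> s + d + h \<le> t + d"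
      then show "k * cos h \<le> u' (s + d + h)"
        using \<delta>(2)[of h] eq[of "s + h"] by (simp add: add.assoc add.commute[of d])
    qed
  qed
  have right: "\<exists>\<delta>>0. \<forall>h. 0 < h \<and> h < \<delta> \<and> s + d \<le> t + d - h \<longrightarrow> k * cos h \<le> u' (t + d - h)"
  proof -
    obtain \<delta> where \<delta>: "0 < \<delta>" "\<And>h. 0 < h \<Longrightarrow> h < \<delta> \<Longrightarrow> s \<le> t - h \<Longrightarrow> k * cos h \<le> u (t - h)"
      using A(7) by blast
    show ?thesis
    proof (intro exI[of _ \<delta>] conjI allI impI \<delta>(1))
      fix h assume h: "0 < h \<and> h < \<delta> \<and> s + d \<le> t + d - h"
      then have "u' (t + d - h) = u (t - h)" using eq[of "t - h"] by (simp add: algebra_simps)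
      then show "k * cos h \<le> u' (t + d - h)" using \<delta>(2)[of h] h by simp
    qed
  qed
  show ?thesis using A(1) by (intro arcI prof ends mid left right) auto
qed

lemma arc_concat:
  assumes sm: "polar_arc k u s m" and mt: "polar_arc k u m t"
  shows "polar_arc k u s t"
proof -
  note A = arcD[OF sm] and B = arcD[OF mt]
  obtain L M where L: "L-lipschitz_on {s..m} u" and M: "M-lipschitz_on {m..t} u"
    using A(2) B(2) by (auto simp: profile_def)
  have "(max L M)-lipschitz_on {s..t} (\<lambda>x. if x \<le> m then u x else u x)"
    by (rule lipschitz_on_concat_max[OF L M]) simp
  then have lip: "(max L M)-lipschitz_on {s..t} u" by simp
  have bds: "1 / b \<le> u x \<and> u x \<le> 1 / a" if "x \<in> {s..t}" for x
    using A(2) B(2) that by (cases "x \<le> m") (auto simp: profile_def)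
  obtain \<delta>1 where d1: "0 < \<delta>1" "\<And>h. 0 < h \<Longrightarrow> h < \<delta>1 \<Longrightarrow> s \<le> m - h \<Longrightarrow> k * cos h \<le> u (m - h)"
    using A(7) by blast
  obtain \<delta>2 where d2: "0 < \<delta>2" "\<And>h. 0 < h \<Longrightarrow> h < \<delta>2 \<Longrightarrow> m + h \<le> t \<Longrightarrow> k * cos h \<le> u (m + h)"
    using B(6) by blast
  have mid: "midpoint_convex_at u x" if x: "s < x" "x < t" for x
  proof -
    consider "x < m" | "m < x" | "x = m" by linarith
    then show ?thesis
    proof cases
      case 3
      show ?thesis unfolding midpoint_convex_at_def
      proof (intro exI[of _ "min (min \<delta>1 \<delta>2) (min (m - s) (t - m))"] conjI allI impI)
        fix h assume h: "0 < h \<and> h < min (min \<delta>1 \<delta>2) (min (m - s) (t - m))"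
        have "k * cos h \<le> u (m - h)" "k * cos h \<le> u (m + h)" using h by (auto intro: d1 d2)
        then have "2 * (k * cos h) \<le> u (m - h) + u (m + h)" by linarith
        then show "2 * cos h * u x \<le> u (x - h) + u (x + h)" using 3 A(4) by (simp add: mult_ac)
      qed (use 3 x d1 d2 in simp)
    qed (use x A(5) B(5) in auto)
  qed
  have left: "\<exists>\<delta>>0. \<forall>h. 0 < h \<and> h < \<delta> \<and> s + h \<le> t \<longrightarrow> k * cos h \<le> u (s + h)"
  proof (cases "s = m")
    case False
    then have "s < m" using A(1) by simp
    moreover obtain \<delta> where "0 < \<delta>" "\<And>h. 0 < h \<Longrightarrow> h < \<delta> \<Longrightarrow> s + h \<le> m \<Longrightarrow> k * cos h \<le> u (s + h)"
      using A(6) by blast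
    ultimately show ?thesis by (intro exI[of _ "min \<delta> (m - s)"]) auto
  qed (use B(6) in simp)
  have right: "\<exists>\<delta>>0. \<forall>h. 0 < h \<and> h < \<delta> \<and> s \<le> t - h \<longrightarrow> k * cos h \<le> u (t - h)"
  proof (cases "m = t")
    case False
    then have "m < t" using B(1) by simp
    moreover obtain \<delta> where "0 < \<delta>" "\<And>h. 0 < h \<Longrightarrow> h < \<delta> \<Longrightarrow> m \<le> t - h \<Longrightarrow> k * cos h \<le> u (t - h)"
      using B(7) by blast
    ultimately show ?thesis by (intro exI[of _ "min \<delta> (t - m)"]) auto
  qed (use A(7) in simp)
  have "profile a b u s t" unfolding profile_def using lip bds by blast
  then show ?thesis
    using A(1,3) B(1,4) by (intro arcI mid left right) auto
qed

lemma arc_J_shift_arc: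
  assumes arc: "polar_arc k u s t" and eq: "\<And>x. s \<le> x \<Longrightarrow> x \<le> t \<Longrightarrow> u' (x + d) = u x"
  shows "arc_J lam u' (s + d) (t + d) = arc_J lam u s t"
  using profile_continuous[OF arcD(2)[OF arc]] profile_pos[OF b_pos arcD(2)[OF arc]]
  by (rule arc_J_shift) (simp_all add: eq)

text \<open>Only the angle spanned by an arc and its contribution to the functional matter. Since arcs
  can be rotated and concatenated freely, a competitor is built by adding up angles and values.\<close>

definition arc_value :: "real \<Rightarrow> real \<Rightarrow> real \<Rightarrow> real \<Rightarrow> bool" where
  "arc_value lam k l v \<longleftrightarrow> (\<exists>u. polar_arc k u 0 l \<and> arc_J lam u 0 l = v)"

lemma arc_value_of_arc:
  assumes "polar_arc k u s t"
  shows "arc_value lam k (t - s) (arc_J lam u s t)"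
proof -
  let ?u' = "\<lambda>x. u (x + s)"
  have eq: "?u' (x + - s) = u x" for x by simp
  have "polar_arc k ?u' (s + - s) (t + - s)" by (rule arc_shift[OF assms]) (rule eq)
  moreover have "arc_J lam ?u' (s + - s) (t + - s) = arc_J lam u s t"
    by (rule arc_J_shift_arc[OF assms]) (rule eq)
  ultimately show ?thesis unfolding arc_value_def by (intro exI[of _ ?u']) simp
qed

lemma arc_value_add:
  assumes l: "arc_value lam k l v" and l': "arc_value lam k l' v'" and turn: "l + l' \<le> 2 * pi"
  shows "arc_value lam k (l + l') (v + v')"
proof -
  obtain u where u: "polar_arc k u 0 l" "arc_J lam u 0 l = v" using l by (auto simp: arc_value_def)
  obtain u' where u': "polar_arc k u' 0 l'" "arc_J lam u' 0 l' = v'" using l' by (auto simp: arc_value_def)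
  define w where "w x = (if x \<le> l then u x else u' (x - l))" for x
  have l0: "0 \<le> l" "0 \<le> l'" using arcD(1)[OF u(1)] arcD(1)[OF u'(1)] by auto
  have wu: "w (x + 0) = u x" if "0 \<le> x" "x \<le> l" for x using that by (simp add: w_def)
  have wu': "w (x + l) = u' x" if "0 \<le> x" "x \<le> l'" for x
  proof (cases "x = 0")
    case True
    then show ?thesis using arcD(4)[OF u(1)] arcD(3)[OF u'(1)] by (simp add: w_def)
  next
    case False
    then show ?thesis using that by (simp add: w_def)
  qed
  have 1: "polar_arc k w (0 + 0) (l + 0)" by (rule arc_shift[OF u(1)]) (rule wu)
  have 2: "polar_arc k w (0 + l) (l' + l)" by (rule arc_shift[OF u'(1)]) (rule wu')
  have 2: "polar_arc k w l (l + l')" using 2 unfolding add_0 by (subst add.commute)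
  have w: "polar_arc k w 0 (l + l')" using 1 2 unfolding add_0_right by (rule arc_concat)
  have "arc_J lam w (0 + 0) (l + 0) = v"
    unfolding u(2)[symmetric] by (rule arc_J_shift_arc[OF u(1)]) (rule wu)
  moreover have "arc_J lam w (0 + l) (l' + l) = v'"
    unfolding u'(2)[symmetric] by (rule arc_J_shift_arc[OF u'(1)]) (rule wu')
  moreover have "arc_J lam w 0 (l + l') = arc_J lam w 0 l + arc_J lam w l (l + l')"
    using l0 turn by (intro arc_J_add[OF b_pos arcD(2)[OF w]]) simp_all
  ultimately have "arc_J lam w 0 (l + l') = v + v'" by (metis add.commute add_0 add_0_right)
  then show ?thesis unfolding arc_value_def using w by blast
qed

lemma isCont_periodic_extension:
  fixes v :: "real \<Rightarrow> real"
  assumes cont: "continuous_on {0..2 * pi} v"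
    and per: "\<And>x (n::int). v (x + 2 * pi * of_int n) = v x"
  shows "isCont v x"
proof -
  have "continuous_on {- 2 * pi..0} (\<lambda>x. v (x + 2 * pi))"
    by (rule continuous_on_compose2[OF cont]) (auto intro!: continuous_intros)
  moreover have "v (x + 2 * pi) = v x" for x using per[of x 1] by simp
  ultimately have "continuous_on {- 2 * pi..0} v" by simp
  then have "continuous_on ({- 2 * pi..0} \<union> {0..2 * pi}) v"
    by (intro continuous_on_closed_Un cont) auto
  then have c2: "continuous_on {- 2 * pi..2 * pi} v"
    by (rule continuous_on_subset) auto
  define n where "n = \<lfloor>x / (2 * pi)\<rfloor>"
  have "of_int n \<le> x / (2 * pi)" "x / (2 * pi) < of_int n + 1" unfolding n_def by linarith+
  then have "0 \<le> x - 2 * pi * of_int n" "x - 2 * pi * of_int n < 2 * pi"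
    by (simp_all add: field_simps)
  then have "isCont v (x - 2 * pi * of_int n)"
    by (intro continuous_on_interior[OF c2]) simp
  then have "isCont (\<lambda>y. v (y - 2 * pi * of_int n)) x"
    by (intro isCont_o2[of x "\<lambda>y. y - 2 * pi * of_int n" v]) (auto intro!: continuous_intros)
  moreover have "v (y - 2 * pi * of_int n) = v y" for y
    using per[of "y - 2 * pi * of_int n" n] by simp
  ultimately show ?thesis by simp
qed

text \<open>An arc that makes a full turn closes up to the boundary of a convex set: its periodic extension
  satisfies the midpoint inequality at the seam for the same reason as at any point where two arcs
  are glued.\<close>

lemma closed_arc_competitor:
  assumes "arc_value lam k (2 * pi) V"
  shows "\<exists>K\<in>C_class a b. J lam K = V"
proof -
  obtain u where arc: "polar_arc k u 0 (2 * pi)" and V: "arc_J lam u 0 (2 * pi) = V"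
    using assms by (auto simp: arc_value_def)
  note A = arcD[OF arc]
  (* the representative of the angle x in the basic period *)
  define \<phi> where "\<phi> x = x - 2 * pi * of_int \<lfloor>x / (2 * pi)\<rfloor>" for x :: real
  have \<phi>: "0 \<le> \<phi> x" "\<phi> x < 2 * pi" for x
  proof -
    define n where "n = \<lfloor>x / (2 * pi)\<rfloor>"
    have "of_int n \<le> x / (2 * pi)" "x / (2 * pi) < of_int n + 1" unfolding n_def by linarith+
    then show "0 \<le> \<phi> x" "\<phi> x < 2 * pi" unfolding \<phi>_def n_def[symmetric] by (simp_all add: field_simps)
  qed
  have \<phi>_id: "\<phi> x = x" if "0 \<le> x" "x < 2 * pi" for x
  proof -
    have "\<lfloor>x / (2 * pi)\<rfloor> = 0" using that by (simp add: floor_eq_iff)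
    then show ?thesis by (simp add: \<phi>_def)
  qed
  have \<phi>_per: "\<phi> (x + 2 * pi * of_int n) = \<phi> x" for x and n :: int
  proof -
    have "(x + 2 * pi * of_int n) / (2 * pi) = x / (2 * pi) + of_int n" by (simp add: field_simps)
    then have "\<lfloor>(x + 2 * pi * of_int n) / (2 * pi)\<rfloor> = \<lfloor>x / (2 * pi)\<rfloor> + n" by simp
    then show ?thesis unfolding \<phi>_def by (simp add: distrib_left)
  qed
  have dir_\<phi>: "direction (\<phi> x) = direction x" for x
    using direction_periodic[of x "- \<lfloor>x / (2 * pi)\<rfloor>"] by (simp add: \<phi>_def)
  define v where "v x = u (\<phi> x)" for x
  have v_per: "v (x + 2 * pi * of_int n) = v x" for x and n :: int by (simp only: v_def \<phi>_per)
  have vu: "v x = u x" if "0 \<le> x" "x \<le> 2 * pi" for x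
  proof (cases "x = 2 * pi")
    case True
    then have "\<phi> x = 0" using \<phi>_per[of 0 1] \<phi>_id[of 0] by simp
    then show ?thesis using True A(3,4) by (simp add: v_def)
  qed (use that \<phi>_id in \<open>simp add: v_def\<close>)
  have v_bds: "0 < v x" "1 / b \<le> v x" "v x \<le> 1 / a" for x
    using A(2) \<phi>[of x] profile_pos[OF b_pos A(2), of "\<phi> x"] by (auto simp: v_def profile_def)
  have v_dir: "v x = v y" if "direction x = direction y" for x y
  proof -
    have eq: "direction (\<phi> x) = direction (\<phi> y)" using that dir_\<phi> by simp
    have "\<phi> x = \<phi> y"
    proof (cases "\<phi> x \<le> \<phi> y")
      case True
      then show ?thesis
        using direction_eq_within_period[OF eq] \<phi>[of x] \<phi>[of y] by linarith
    next
      case False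
      then show ?thesis
        using direction_eq_within_period[OF eq[symmetric]] \<phi>[of x] \<phi>[of y] by linarith
    qed
    then show ?thesis by (simp add: v_def)
  qed
  have "continuous_on {0..2 * pi} v"
    using profile_continuous[OF A(2)] by (rule continuous_on_eq) (simp add: vu)
  then have "isCont v x" for x using v_per by (rule isCont_periodic_extension)
  then have cont: "continuous_on UNIV v" by (intro continuous_at_imp_continuous_on) simp
  have mid: "midpoint_convex_at v x" for x
  proof -
    have red: "v (x + h) = v (\<phi> x + h)" for h
    proof -
      have "\<phi> x + h + 2 * pi * of_int \<lfloor>x / (2 * pi)\<rfloor> = x + h" by (simp add: \<phi>_def)
      then show ?thesis using v_per[of "\<phi> x + h" "\<lfloor>x / (2 * pi)\<rfloor>"] by metis
    qed
    have red': "v x = v (\<phi> x)" "v (x - h) = v (\<phi> x - h)" for h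
      using red[of 0] red[of "- h"] by simp_all
    have "midpoint_convex_at v (\<phi> x)"
    proof (cases "\<phi> x = 0")
      case False
      then have x: "0 < \<phi> x" using \<phi>(1)[of x] by simp
      then obtain \<delta> where \<delta>: "0 < \<delta>"
        "\<And>h. 0 < h \<Longrightarrow> h < \<delta> \<Longrightarrow> 2 * cos h * u (\<phi> x) \<le> u (\<phi> x - h) + u (\<phi> x + h)"
        using A(5)[of "\<phi> x"] \<phi>(2)[of x] unfolding midpoint_convex_at_def by blast
      show ?thesis unfolding midpoint_convex_at_def
      proof (intro exI[of _ "min \<delta> (min (\<phi> x) (2 * pi - \<phi> x))"] conjI allI impI)
        fix h assume "0 < h \<and> h < min \<delta> (min (\<phi> x) (2 * pi - \<phi> x))"
        then show "2 * cos h * v (\<phi> x) \<le> v (\<phi> x - h) + v (\<phi> x + h)"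
          using \<delta>(2)[of h] vu[of "\<phi> x"] vu[of "\<phi> x - h"] vu[of "\<phi> x + h"] x by simp
      qed (use \<delta>(1) x \<phi>(2)[of x] in simp)
    next
      case True
      obtain \<delta>1 where d1: "0 < \<delta>1" "\<And>h. 0 < h \<Longrightarrow> h < \<delta>1 \<Longrightarrow> 0 + h \<le> 2 * pi \<Longrightarrow> k * cos h \<le> u (0 + h)"
        using A(6) by blast
      obtain \<delta>2 where d2: "0 < \<delta>2"
        "\<And>h. 0 < h \<Longrightarrow> h < \<delta>2 \<Longrightarrow> 0 \<le> 2 * pi - h \<Longrightarrow> k * cos h \<le> u (2 * pi - h)"
        using A(7) by blast
      show ?thesis unfolding midpoint_convex_at_def
      proof (intro exI[of _ "min (min \<delta>1 \<delta>2) (2 * pi)"] conjI allI impI)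
        fix h assume h: "0 < h \<and> h < min (min \<delta>1 \<delta>2) (2 * pi)"
        have "v (\<phi> x - h) = u (2 * pi - h)" using True v_per[of "- h" 1] vu[of "2 * pi - h"] h by simp
        moreover have "v (\<phi> x + h) = u h" using True vu[of h] h by simp
        moreover have "v (\<phi> x) = k" using True vu[of 0] A(3) by simp
        ultimately show "2 * cos h * v (\<phi> x) \<le> v (\<phi> x - h) + v (\<phi> x + h)"
          using d1(2)[of h] d2(2)[of h] h by (simp add: mult_ac)
      qed (use d1 d2 in simp)
    qed
    then show ?thesis unfolding midpoint_convex_at_def red red' .
  qed
  define K where "K = {r *\<^sub>R direction x | r x. 0 \<le> r \<and> r * v x \<le> 1}"
  have mem: "r *\<^sub>R direction x \<in> K \<longleftrightarrow> r * v x \<le> 1" if r: "0 \<le> r" for r x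
  proof
    assume "r *\<^sub>R direction x \<in> K"
    then obtain q y where q: "r *\<^sub>R direction x = q *\<^sub>R direction y" "0 \<le> q" "q * v y \<le> 1"
      unfolding K_def by blast
    have "norm (r *\<^sub>R direction x) = norm (q *\<^sub>R direction y)" using q(1) by simp
    then have "r = q" using q(2) r by simp
    show "r * v x \<le> 1"
    proof (cases "r = 0")
      case False
      then have "direction x = direction y" using q(1) \<open>r = q\<close> by simp
      then have "v x = v y" by (rule v_dir)
      then show ?thesis using q(3) \<open>r = q\<close> by simp
    qed simp
  qed (use r in \<open>auto simp: K_def\<close>)
  have "K = polar_sector u 0 (2 * pi)"
  proof (intro equalityI subsetI)
    fix z assume "z \<in> K"
    then obtain r x where z: "z = r *\<^sub>R direction x" "0 \<le> r" "r * v x \<le> 1" unfolding K_def by blast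
    have "r *\<^sub>R direction (\<phi> x) \<in> polar_sector u 0 (2 * pi)"
      using z \<phi>[of x] by (intro polar_sectorI) (auto simp: v_def)
    then show "z \<in> polar_sector u 0 (2 * pi)" using z(1) dir_\<phi> by simp
  next
    fix z assume "z \<in> polar_sector u 0 (2 * pi)"
    then show "z \<in> K" using mem vu by (auto elim!: polar_sectorE)
  qed
  then have "compact K" using compact_polar_sector[OF profile_continuous[OF A(2)] profile_pos[OF b_pos A(2)]] by simp
  moreover have "convex K" unfolding K_def using cont v_bds(1) v_per mid by (rule convex_polar_region)
  moreover have "cball 0 a \<subseteq> K"
  proof
    fix z :: "real^2" assume z: "z \<in> cball 0 a"
    obtain x where x: "z = norm z *\<^sub>R direction x" by (rule polar_form)
    have "norm z * v x \<le> a * (1 / a)" using z v_bds[of x] a_pos by (intro mult_mono) auto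
    then show "z \<in> K" using mem[of "norm z" x] x a_pos by simp
  qed
  moreover have "K \<subseteq> cball 0 b"
  proof
    fix z assume "z \<in> K"
    then obtain r x where z: "z = r *\<^sub>R direction x" "0 \<le> r" "r * v x \<le> 1" unfolding K_def by blast
    have "r * (1 / b) \<le> r * v x" using z(2) v_bds(2)[of x] by (rule mult_left_mono[rotated])
    then have "r / b \<le> 1" using z(3) by simp
    then have "r \<le> b" using b_pos by simp
    then show "z \<in> cball 0 b" using z by simp
  qed
  ultimately have K: "K \<in> C_class a b" by (simp add: C_class_def)
  have gv: "polar_gauge K x = v x" for x
  proof (rule antisym)
    have g: "0 < polar_gauge K x" using gauge_bounds(1)[OF K] .
    have iff: "r * polar_gauge K x \<le> 1 \<longleftrightarrow> r * v x \<le> 1" if "0 \<le> r" for r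
      using mem_iff_gauge[OF K that] mem[OF that] by simp
    show "polar_gauge K x \<le> v x" using iff[of "1 / v x"] v_bds(1)[of x] by (simp add: field_simps)
    show "v x \<le> polar_gauge K x" using iff[of "1 / polar_gauge K x"] g by (simp add: field_simps)
  qed
  have "J lam K = arc_J lam (polar_gauge K) 0 (2 * pi)" using J_eq_arc_J[OF K, of lam 0] by simp
  also have "\<dots> = arc_J lam u 0 (2 * pi)"
    using profile_continuous[OF A(2)] profile_pos[OF b_pos A(2)]
    by (rule arc_J_cong) (simp_all add: gv vu)
  finally show ?thesis using K V by auto
qed

end

section \<open>Exchanging pieces of the boundary\<close>

context annulus
begin

lemma arc_gauge:
  assumes K: "K \<in> C_class a b" and "s \<le> t" "polar_gauge K s = k" "polar_gauge K t = k"
    and "\<exists>\<delta>>0. \<forall>h. 0 < h \<and> h < \<delta> \<longrightarrow> k * cos h \<le> polar_gauge K (s + h)"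
    and "\<exists>\<delta>>0. \<forall>h. 0 < h \<and> h < \<delta> \<longrightarrow> k * cos h \<le> polar_gauge K (t - h)"
  shows "polar_arc k (polar_gauge K) s t"
proof (rule arcI)
  show "midpoint_convex_at (polar_gauge K) x" for x
    unfolding midpoint_convex_at_def
  proof (intro exI[of _ "pi / 2"] conjI allI impI)
    fix h :: real assume "0 < h \<and> h < pi / 2"
    then show "2 * cos h * polar_gauge K x \<le> polar_gauge K (x - h) + polar_gauge K (x + h)"
      by (intro gauge_midpoint[OF K] cos_gt_zero_pi) auto
  qed simp
next
  show "profile a b (polar_gauge K) s t" by (rule profile_gauge[OF K])
qed (use assms in blast)+

text \<open>The condition on the interior determines the piece as a maximal interval on which the
  boundary stays off the circle of radius \<open>1 / k\<close>, so that different pieces cannot overlap.\<close>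

definition piece :: "real \<Rightarrow> (real \<Rightarrow> real) \<Rightarrow> real \<Rightarrow> real \<Rightarrow> bool" where
  "piece k u q \<theta> \<longleftrightarrow> 0 < \<theta> \<and> u (q - \<theta>) = k \<and> u (q + \<theta>) = k \<and> (\<forall>x. \<bar>x - q\<bar> < \<theta> \<longrightarrow> u x \<noteq> k)
     \<and> (\<exists>\<delta>>0. \<forall>h. 0 < h \<and> h < \<delta> \<longrightarrow> k * cos h \<le> u (q + \<theta> + h))
     \<and> (\<exists>\<delta>>0. \<forall>h. 0 < h \<and> h < \<delta> \<longrightarrow> k * cos h \<le> u (q - \<theta> - h))"

lemma pieceD:
  assumes "piece k u q \<theta>"
  shows "0 < \<theta>" "u (q - \<theta>) = k" "u (q + \<theta>) = k" "\<bar>x - q\<bar> < \<theta> \<Longrightarrow> u x \<noteq> k"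
    "\<exists>\<delta>>0. \<forall>h. 0 < h \<and> h < \<delta> \<longrightarrow> k * cos h \<le> u (q + \<theta> + h)"
    "\<exists>\<delta>>0. \<forall>h. 0 < h \<and> h < \<delta> \<longrightarrow> k * cos h \<le> u (q - \<theta> - h)"
  using assms unfolding piece_def by simp_all

lemma pieces_disjoint:
  assumes p: "piece k u q \<theta>" and p': "piece k u q' \<theta>'" and "q < q'"
  shows "q + \<theta> \<le> q' - \<theta>'"
proof -
  have "\<not> \<bar>q + \<theta> - q'\<bar> < \<theta>'" "\<not> \<bar>q - \<theta> - q'\<bar> < \<theta>'"
    using pieceD(4)[OF p'] pieceD(2,3)[OF p] by blast+
  moreover have "\<not> \<bar>q' + \<theta>' - q\<bar> < \<theta>" "\<not> \<bar>q' - \<theta>' - q\<bar> < \<theta>"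
    using pieceD(4)[OF p] pieceD(2,3)[OF p'] by blast+
  ultimately show ?thesis using pieceD(1)[OF p] pieceD(1)[OF p'] \<open>q < q'\<close> by linarith
qed

lemma piece_unique_at_center:
  assumes p: "piece k u q \<theta>" and p': "piece k u q \<theta>'"
  shows "\<theta> = \<theta>'"
proof -
  have "\<not> \<bar>q + \<theta> - q\<bar> < \<theta>'" using pieceD(4)[OF p'] pieceD(3)[OF p] by blast
  moreover have "\<not> \<bar>q + \<theta>' - q\<bar> < \<theta>" using pieceD(4)[OF p] pieceD(3)[OF p'] by blast
  ultimately show ?thesis using pieceD(1)[OF p] pieceD(1)[OF p'] by linarith
qed

lemma piece_gauge_periodic:
  assumes "piece k (polar_gauge K) q \<theta>"
  shows "piece k (polar_gauge K) (q + 2 * pi) \<theta>"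
proof -
  have per: "polar_gauge K (x + 2 * pi) = polar_gauge K x" for x using gauge_periodic[of K x 1] by simp
  have eq: "q + 2 * pi - \<theta> = (q - \<theta>) + 2 * pi" "q + 2 * pi + \<theta> = (q + \<theta>) + 2 * pi"
    "q - \<theta> + 2 * pi - h = (q - \<theta> - h) + 2 * pi" "q + \<theta> + 2 * pi + h = (q + \<theta> + h) + 2 * pi" for h
    by simp_all
  have "polar_gauge K x \<noteq> k" if "\<bar>x - (q + 2 * pi)\<bar> < \<theta>" for x
    using pieceD(4)[OF assms, of "x - 2 * pi"] per[of "x - 2 * pi"] that by (simp add: algebra_simps)
  then show ?thesis
    using pieceD(1,2,3,5,6)[OF assms] unfolding piece_def eq per by blast
qed

text \<open>What is left of the boundary after removing one piece, or two, consists of arcs again and can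
  be reused in a competitor.\<close>

lemma split_off_piece:
  assumes K: "K \<in> C_class a b" and p: "piece k (polar_gauge K) q \<theta>"
  shows "\<exists>V. J lam K = arc_J lam (polar_gauge K) (q - \<theta>) (q + \<theta>) + V
             \<and> arc_value lam k (2 * pi - 2 * \<theta>) V"
proof -
  let ?u = "polar_gauge K"
  note P = pieceD[OF p] and P' = pieceD[OF piece_gauge_periodic[OF p]]
  have len: "q + \<theta> \<le> q + 2 * pi - \<theta>"
    using pieces_disjoint[OF p piece_gauge_periodic[OF p]] by simp
  have arc: "polar_arc k ?u (q + \<theta>) (q + 2 * pi - \<theta>)"
    by (rule arc_gauge[OF K len P(3) P'(2) P(5) P'(6)])
  have "J lam K = arc_J lam ?u (q - \<theta>) (q + 2 * pi - \<theta>)"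
    using J_eq_arc_J[OF K, of lam "q - \<theta>"] by (simp add: algebra_simps)
  also have "\<dots> = arc_J lam ?u (q - \<theta>) (q + \<theta>) + arc_J lam ?u (q + \<theta>) (q + 2 * pi - \<theta>)"
    using P(1) len by (intro arc_J_add[OF b_pos profile_gauge[OF K]]) auto
  finally have "J lam K = \<dots>" .
  moreover have "arc_value lam k (2 * pi - 2 * \<theta>) (arc_J lam ?u (q + \<theta>) (q + 2 * pi - \<theta>))"
    using arc_value_of_arc[OF arc, of lam] by simp
  ultimately show ?thesis by blast
qed

lemma split_off_two_pieces:
  assumes K: "K \<in> C_class a b"
    and p: "piece k (polar_gauge K) q \<theta>" and p': "piece k (polar_gauge K) q' \<theta>'"
    and q: "q < q'" "q' < q + 2 * pi"
  shows "\<exists>V. J lam K = arc_J lam (polar_gauge K) (q - \<theta>) (q + \<theta>)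
               + arc_J lam (polar_gauge K) (q' - \<theta>') (q' + \<theta>') + V
             \<and> arc_value lam k (2 * pi - 2 * \<theta> - 2 * \<theta>') V"
proof -
  let ?u = "polar_gauge K"
  note pp = piece_gauge_periodic[OF p]
  note P = pieceD[OF p] and P' = pieceD[OF p'] and PP = pieceD[OF pp]
  have o1: "q + \<theta> \<le> q' - \<theta>'" by (rule pieces_disjoint[OF p p' q(1)])
  have o2: "q' + \<theta>' \<le> q + 2 * pi - \<theta>" by (rule pieces_disjoint[OF p' pp q(2)])
  have arc1: "polar_arc k ?u (q + \<theta>) (q' - \<theta>')" by (rule arc_gauge[OF K o1 P(3) P'(2) P(5) P'(6)])
  have arc2: "polar_arc k ?u (q' + \<theta>') (q + 2 * pi - \<theta>)" by (rule arc_gauge[OF K o2 P'(3) PP(2) P'(5) PP(6)])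
  define A where "A = arc_J lam ?u"
  have add: "A s t = A s m + A m t" if "s \<le> m" "m \<le> t" "t \<le> s + 2 * pi" for s m t
    unfolding A_def by (rule arc_J_add[OF b_pos profile_gauge[OF K] that])
  have "J lam K = A (q - \<theta>) (q + 2 * pi - \<theta>)"
    unfolding A_def using J_eq_arc_J[OF K, of lam "q - \<theta>"] by (simp add: algebra_simps)
  also have "\<dots> = A (q - \<theta>) (q + \<theta>) + A (q + \<theta>) (q + 2 * pi - \<theta>)"
    using P(1) P'(1) o1 o2 by (intro add) linarith+
  also have "A (q + \<theta>) (q + 2 * pi - \<theta>) = A (q + \<theta>) (q' - \<theta>') + A (q' - \<theta>') (q + 2 * pi - \<theta>)"
    using P(1) P'(1) o1 o2 by (intro add) linarith+
  also have "A (q' - \<theta>') (q + 2 * pi - \<theta>) = A (q' - \<theta>') (q' + \<theta>') + A (q' + \<theta>') (q + 2 * pi - \<theta>)"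
    using P(1) P'(1) o1 o2 by (intro add) linarith+
  finally have J: "J lam K = A (q - \<theta>) (q + \<theta>) + A (q' - \<theta>') (q' + \<theta>')
      + (A (q + \<theta>) (q' - \<theta>') + A (q' + \<theta>') (q + 2 * pi - \<theta>))" by simp
  have "arc_value lam k ((q' - \<theta>' - (q + \<theta>)) + (q + 2 * pi - \<theta> - (q' + \<theta>')))
      (A (q + \<theta>) (q' - \<theta>') + A (q' + \<theta>') (q + 2 * pi - \<theta>))"
    unfolding A_def using P(1) P'(1)
    by (intro arc_value_add arc_value_of_arc arc1 arc2) linarith
  moreover have "(q' - \<theta>' - (q + \<theta>)) + (q + 2 * pi - \<theta> - (q' + \<theta>')) = 2 * pi - 2 * \<theta> - 2 * \<theta>'" by simp
  ultimately show ?thesis using J unfolding A_def by (intro exI conjI) simp_all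
qed

lemma arc_value_nonneg: "arc_value lam k l V \<Longrightarrow> 0 \<le> l"
  unfolding arc_value_def using arcD(1) by blast

lemma optimal_le_arc_value:
  assumes "optimal a b lam \<Omega>" "arc_value lam k (2 * pi) V"
  shows "J lam \<Omega> \<le> V"
  using closed_arc_competitor[OF assms(2)] assms(1) by (auto simp: optimal_def)

lemma replace_piece:
  assumes opt: "optimal a b lam \<Omega>" and p: "piece k (polar_gauge \<Omega>) q \<theta>"
    and new: "arc_value lam k (2 * \<theta>) F"
  shows "arc_J lam (polar_gauge \<Omega>) (q - \<theta>) (q + \<theta>) \<le> F"
proof -
  have "\<Omega> \<in> C_class a b" using opt by (simp add: optimal_def)
  then obtain V where V: "J lam \<Omega> = arc_J lam (polar_gauge \<Omega>) (q - \<theta>) (q + \<theta>) + V"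
    "arc_value lam k (2 * pi - 2 * \<theta>) V"
    using split_off_piece[OF _ p] by blast
  have "arc_value lam k (2 * \<theta> + (2 * pi - 2 * \<theta>)) (F + V)"
    by (rule arc_value_add[OF new V(2)]) simp
  then show ?thesis using optimal_le_arc_value[OF opt, of k "F + V"] V(1) by simp
qed

text \<open>Two pieces may be replaced by arcs whose angles differ from theirs but have the same sum; the
  arcs between them are rotated into place.\<close>

lemma exchange_pieces:
  assumes opt: "optimal a b lam \<Omega>"
    and p: "piece k (polar_gauge \<Omega>) q \<theta>" and p': "piece k (polar_gauge \<Omega>) q' \<theta>'"
    and q: "\<bar>q - q'\<bar> < 2 * pi" and ne: "(q, \<theta>) \<noteq> (q', \<theta>')"
    and new: "arc_value lam k (2 * \<eta>) F" "arc_value lam k (2 * \<eta>') F'" and sum: "\<eta> + \<eta>' = \<theta> + \<theta>'"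
  shows "arc_J lam (polar_gauge \<Omega>) (q - \<theta>) (q + \<theta>)
           + arc_J lam (polar_gauge \<Omega>) (q' - \<theta>') (q' + \<theta>') \<le> F + F'"
proof -
  have K: "\<Omega> \<in> C_class a b" using opt by (simp add: optimal_def)
  have "q \<noteq> q'" using ne piece_unique_at_center[of k "polar_gauge \<Omega>" q \<theta> \<theta>'] p p' by blast
  then obtain V where V: "J lam \<Omega> = arc_J lam (polar_gauge \<Omega>) (q - \<theta>) (q + \<theta>)
      + arc_J lam (polar_gauge \<Omega>) (q' - \<theta>') (q' + \<theta>') + V"
    "arc_value lam k (2 * pi - 2 * \<theta> - 2 * \<theta>') V" "0 \<le> 2 * pi - 2 * \<theta> - 2 * \<theta>'"
  proof (cases "q < q'")
    case True
    then obtain V where "J lam \<Omega> = arc_J lam (polar_gauge \<Omega>) (q - \<theta>) (q + \<theta>)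
        + arc_J lam (polar_gauge \<Omega>) (q' - \<theta>') (q' + \<theta>') + V"
      "arc_value lam k (2 * pi - 2 * \<theta> - 2 * \<theta>') V"
      using split_off_two_pieces[OF K p p'] q by auto
    moreover have "0 \<le> 2 * pi - 2 * \<theta> - 2 * \<theta>'"
      using arc_value_nonneg[OF calculation(2)] .
    ultimately show ?thesis by (rule that)
  next
    case False
    then obtain V where "J lam \<Omega> = arc_J lam (polar_gauge \<Omega>) (q' - \<theta>') (q' + \<theta>')
        + arc_J lam (polar_gauge \<Omega>) (q - \<theta>) (q + \<theta>) + V"
      "arc_value lam k (2 * pi - 2 * \<theta>' - 2 * \<theta>) V"
      using split_off_two_pieces[OF K p' p] q \<open>q \<noteq> q'\<close> by fastforce
    moreover have "0 \<le> 2 * pi - 2 * \<theta>' - 2 * \<theta>"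
      using arc_value_nonneg[OF calculation(2)] .
    ultimately show ?thesis by (intro that[of V]) (simp_all add: algebra_simps)
  qed
  have "2 * \<eta> + 2 * \<eta>' \<le> 2 * pi" using V(3) sum by simp
  then have "arc_value lam k (2 * \<eta> + 2 * \<eta>') (F + F')" by (rule arc_value_add[OF new])
  then have "arc_value lam k (2 * \<eta> + 2 * \<eta>' + (2 * pi - 2 * \<theta> - 2 * \<theta>')) (F + F' + V)"
    by (rule arc_value_add[OF _ V(2)]) (use sum in simp)
  moreover have "2 * \<eta> + 2 * \<eta>' + (2 * pi - 2 * \<theta> - 2 * \<theta>') = 2 * pi" using sum by simp
  ultimately have "arc_value lam k (2 * pi) (F + F' + V)" by simp
  then have "J lam \<Omega> \<le> F + F' + V" by (rule optimal_le_arc_value[OF opt])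
  then show ?thesis using V(1) by simp
qed

end

section \<open>The two kinds of pieces\<close>

lemma lipschitz_cos: "\<bar>cos x - cos y\<bar> \<le> \<bar>x - y\<bar>" for x y :: real
proof -
  have "\<bar>(direction x - direction y) $ 1\<bar> \<le> norm (direction x - direction y)"
    by (rule component_le_norm_cart)
  then show ?thesis using dist_direction_le[of x y] by (simp add: dist_norm)
qed

lemma cos_midpoint: "cos (x - h) + cos (x + h) = 2 * cos h * cos x" for x h :: real
  by (simp add: cos_add cos_diff)

text \<open>A kite consists of two right triangles with legs \<open>a\<close> and \<open>a * tan \<theta>\<close>; its area counts with
  the factor \<open>lam\<close>, its two outer legs with the factor \<open>- 1\<close>.\<close>

definition kite_value :: "real \<Rightarrow> real \<Rightarrow> real \<Rightarrow> real" where
  "kite_value a lam \<theta> = a * (lam * a - 2) * tan \<theta>"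

text \<open>Two right triangles with legs \<open>b * cos \<theta>\<close> and \<open>b * sin \<theta>\<close>.\<close>

definition chord_value :: "real \<Rightarrow> real \<Rightarrow> real \<Rightarrow> real" where
  "chord_value b lam \<theta> = lam * b\<^sup>2 * (sin \<theta> * cos \<theta>) - 2 * b * sin \<theta>"

context annulus
begin

text \<open>The vertex of the kite cuts it into two straight arcs. The feet of their perpendiculars are the
  tangency points, in the directions \<open>q - \<theta>\<close> and \<open>q + \<theta>\<close>.\<close>

lemma arc_J_kite:
  assumes th: "0 < \<theta>" "\<theta> < pi / 2" and prof: "profile a b u (q - \<theta>) (q + \<theta>)"
    and u: "\<And>x. \<bar>x - q\<bar> \<le> \<theta> \<Longrightarrow> u x = cos (\<theta> - \<bar>x - q\<bar>) / a"
  shows "arc_J lam u (q - \<theta>) (q + \<theta>) = kite_value a lam \<theta>"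
proof -
  have 1: "arc_J lam u (q - \<theta>) q = (lam * a\<^sup>2 / 2 - a) * (tan (q - (q - \<theta>)) - tan (q - \<theta> - (q - \<theta>)))"
  proof (rule arc_J_straight[OF a_pos])
    fix x assume x: "x \<in> {q - \<theta>..q}"
    then have eq: "\<theta> - \<bar>x - q\<bar> = x - (q - \<theta>)" by simp
    have "u x = cos (\<theta> - \<bar>x - q\<bar>) / a" using x by (intro u) simp
    then show "u x = cos (x - (q - \<theta>)) / a" by (simp only: eq)
  qed (use th in auto)
  have 2: "arc_J lam u q (q + \<theta>) = (lam * a\<^sup>2 / 2 - a) * (tan (q + \<theta> - (q + \<theta>)) - tan (q - (q + \<theta>)))"
  proof (rule arc_J_straight[OF a_pos])
    fix x assume x: "x \<in> {q..q + \<theta>}"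
    then have eq: "\<theta> - \<bar>x - q\<bar> = - (x - (q + \<theta>))" by simp
    have "u x = cos (\<theta> - \<bar>x - q\<bar>) / a" using x by (intro u) simp
    then show "u x = cos (x - (q + \<theta>)) / a" by (simp only: eq cos_minus)
  qed (use th in auto)
  have "arc_J lam u (q - \<theta>) (q + \<theta>) = arc_J lam u (q - \<theta>) q + arc_J lam u q (q + \<theta>)"
    using th by (intro arc_J_add[OF b_pos prof]) auto
  also have "\<dots> = kite_value a lam \<theta>"
    unfolding 1 2 by (simp add: kite_value_def power2_eq_square algebra_simps)
  finally show ?thesis .
qed

lemma arc_value_kite:
  assumes th: "0 < \<theta>" "\<theta> < pi / 2" "a / b \<le> cos \<theta>"
  shows "arc_value lam (1 / a) (2 * \<theta>) (kite_value a lam \<theta>)"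
proof -
  define u where "u x = cos (\<theta> - \<bar>x\<bar>) / a" for x
  have lip: "(1 / a)-lipschitz_on {- \<theta>..\<theta>} u"
  proof (rule lipschitz_onI)
    fix x y
    have "\<bar>cos (\<theta> - \<bar>x\<bar>) - cos (\<theta> - \<bar>y\<bar>)\<bar> \<le> \<bar>x - y\<bar>"
      using lipschitz_cos[of "\<theta> - \<bar>x\<bar>" "\<theta> - \<bar>y\<bar>"] by linarith
    then have "\<bar>cos (\<theta> - \<bar>x\<bar>) - cos (\<theta> - \<bar>y\<bar>)\<bar> / a \<le> \<bar>x - y\<bar> / a"
      using a_pos by (intro divide_right_mono) auto
    moreover have "u x - u y = (cos (\<theta> - \<bar>x\<bar>) - cos (\<theta> - \<bar>y\<bar>)) / a"
      by (simp only: u_def diff_divide_distrib)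
    ultimately show "dist (u x) (u y) \<le> 1 / a * dist x y"
      using a_pos by (simp only: dist_real_def abs_divide abs_of_pos) simp
  qed (use a_pos in simp)
  have bds: "1 / b \<le> u x \<and> u x \<le> 1 / a" if "x \<in> {- \<theta>..\<theta>}" for x
  proof -
    have "cos \<theta> \<le> cos (\<theta> - \<bar>x\<bar>)" using that th by (intro cos_monotone_0_pi_le) auto
    then have "a / b \<le> cos (\<theta> - \<bar>x\<bar>)" using th by linarith
    then have "a / b / a \<le> u x" unfolding u_def using a_pos by (intro divide_right_mono) auto
    then show ?thesis using a_pos by (simp add: u_def divide_right_mono)
  qed
  have prof: "profile a b u (- \<theta>) \<theta>" unfolding profile_def using lip bds by blast
  have "polar_arc (1 / a) u (- \<theta>) \<theta>"
  proof (rule arcI)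
    fix x assume x: "- \<theta> < x" "x < \<theta>"
    show "midpoint_convex_at u x" unfolding midpoint_convex_at_def
    proof (cases "x = 0")
      case True
      show "\<exists>\<delta>>0. \<forall>h. 0 < h \<and> h < \<delta> \<longrightarrow> 2 * cos h * u x \<le> u (x - h) + u (x + h)"
      proof (intro exI[of _ \<theta>] conjI allI impI th(1))
        fix h assume h: "0 < h \<and> h < \<theta>"
        (* the vertex is the only direction where the inequality is strict *)
        have "0 \<le> sin \<theta> * sin h" using h th by (intro mult_nonneg_nonneg sin_ge_zero) auto
        then have "2 * cos h * cos \<theta> \<le> 2 * cos (\<theta> - h)" by (simp add: cos_diff)
        then have "2 * cos h * cos \<theta> / a \<le> 2 * cos (\<theta> - h) / a" using a_pos by (intro divide_right_mono) auto
        then show "2 * cos h * u x \<le> u (x - h) + u (x + h)" using True h by (simp add: u_def)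
      qed
    next
      case False
      show "\<exists>\<delta>>0. \<forall>h. 0 < h \<and> h < \<delta> \<longrightarrow> 2 * cos h * u x \<le> u (x - h) + u (x + h)"
      proof (intro exI[of _ "\<bar>x\<bar>"] conjI allI impI)
        fix h assume h: "0 < h \<and> h < \<bar>x\<bar>"
        have "cos (\<theta> - \<bar>x - h\<bar>) + cos (\<theta> - \<bar>x + h\<bar>) = 2 * cos h * cos (\<theta> - \<bar>x\<bar>)"
        proof (cases "0 < x")
          case True
          then have eq: "\<theta> - \<bar>x - h\<bar> = (\<theta> - \<bar>x\<bar>) + h" "\<theta> - \<bar>x + h\<bar> = (\<theta> - \<bar>x\<bar>) - h" using h by auto
          show ?thesis unfolding eq cos_add[of _ h] cos_diff[of _ h] by simp
        next
          case False
          then have eq: "\<theta> - \<bar>x - h\<bar> = (\<theta> - \<bar>x\<bar>) - h" "\<theta> - \<bar>x + h\<bar> = (\<theta> - \<bar>x\<bar>) + h" using h by auto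
          show ?thesis unfolding eq cos_add[of _ h] cos_diff[of _ h] by simp
        qed
        then show "2 * cos h * u x \<le> u (x - h) + u (x + h)"
          unfolding u_def add_divide_distrib[symmetric] by simp
      qed (use False in simp)
    qed
  next
    show "\<exists>\<delta>>0. \<forall>h. 0 < h \<and> h < \<delta> \<and> - \<theta> + h \<le> \<theta> \<longrightarrow> 1 / a * cos h \<le> u (- \<theta> + h)"
    proof (intro exI[of _ \<theta>] conjI allI impI th(1))
      fix h assume h: "0 < h \<and> h < \<theta> \<and> - \<theta> + h \<le> \<theta>"
      then have "\<theta> - \<bar>- \<theta> + h\<bar> = h" by simp
      then show "1 / a * cos h \<le> u (- \<theta> + h)" by (simp add: u_def)
    qed
    show "\<exists>\<delta>>0. \<forall>h. 0 < h \<and> h < \<delta> \<and> - \<theta> \<le> \<theta> - h \<longrightarrow> 1 / a * cos h \<le> u (\<theta> - h)"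
    proof (intro exI[of _ \<theta>] conjI allI impI th(1))
      fix h assume h: "0 < h \<and> h < \<theta> \<and> - \<theta> \<le> \<theta> - h"
      then have "\<theta> - \<bar>\<theta> - h\<bar> = h" by simp
      then show "1 / a * cos h \<le> u (\<theta> - h)" by (simp add: u_def)
    qed
    show "- \<theta> \<le> \<theta>" "u (- \<theta>) = 1 / a" "u \<theta> = 1 / a" using th by (simp_all add: u_def)
  qed (rule prof)
  then have "arc_value lam (1 / a) (\<theta> - - \<theta>) (arc_J lam u (- \<theta>) \<theta>)" by (rule arc_value_of_arc)
  moreover have "arc_J lam u (0 - \<theta>) (0 + \<theta>) = kite_value a lam \<theta>"
    by (rule arc_J_kite[OF th(1,2)]) (use prof in \<open>simp_all add: u_def\<close>)
  ultimately show ?thesis by simp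
qed

lemma arc_J_chord:
  assumes th: "0 < \<theta>" "\<theta> < pi / 2"
    and u: "\<And>x. \<bar>x - q\<bar> \<le> \<theta> \<Longrightarrow> u x = cos (x - q) / (b * cos \<theta>)"
  shows "arc_J lam u (q - \<theta>) (q + \<theta>) = chord_value b lam \<theta>"
proof -
  have c: "0 < cos \<theta>" using th by (intro cos_gt_zero_pi) auto
  have "arc_J lam u (q - \<theta>) (q + \<theta>)
      = (lam * (b * cos \<theta>)\<^sup>2 / 2 - b * cos \<theta>) * (tan (q + \<theta> - q) - tan (q - \<theta> - q))"
    using b_pos c th by (intro arc_J_straight u) auto
  also have "\<dots> = (lam * (b * cos \<theta>)\<^sup>2 - 2 * b * cos \<theta>) * tan \<theta>" by (simp add: algebra_simps)
  also have "\<dots> = chord_value b lam \<theta>"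
    using c by (simp add: chord_value_def tan_def power2_eq_square field_simps)
  finally show ?thesis .
qed

lemma arc_value_chord:
  assumes th: "0 < \<theta>" "\<theta> < pi / 2" "a / b \<le> cos \<theta>"
  shows "arc_value lam (1 / b) (2 * \<theta>) (chord_value b lam \<theta>)"
proof -
  define p where "p = b * cos \<theta>"
  define u where "u x = cos x / p" for x
  have c: "0 < cos \<theta>" using th by (intro cos_gt_zero_pi) auto
  have ap: "a \<le> p" using th(3) b_pos by (simp add: p_def field_simps)
  have p: "0 < p" using ap a_pos by linarith
  have bp: "cos \<theta> / p = 1 / b" using c b_pos by (simp add: p_def)
  have lip: "(1 / p)-lipschitz_on {- \<theta>..\<theta>} u"
  proof (rule lipschitz_onI)
    fix x y
    have "\<bar>cos x - cos y\<bar> / p \<le> \<bar>x - y\<bar> / p" using lipschitz_cos p by (intro divide_right_mono) auto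
    moreover have "u x - u y = (cos x - cos y) / p" by (simp only: u_def diff_divide_distrib)
    ultimately show "dist (u x) (u y) \<le> 1 / p * dist x y"
      using p by (simp only: dist_real_def abs_divide abs_of_pos) simp
  qed (use p in simp)
  have lower: "1 / b \<le> u x" if "x \<in> {- \<theta>..\<theta>}" for x
  proof -
    have "cos \<theta> \<le> cos \<bar>x\<bar>" using that th by (intro cos_monotone_0_pi_le) auto
    then show ?thesis unfolding bp[symmetric] u_def using p by (intro divide_right_mono) auto
  qed
  have upper: "u x \<le> 1 / a" for x
  proof -
    have "u x \<le> 1 / p" unfolding u_def using p by (intro divide_right_mono) auto
    also have "\<dots> \<le> 1 / a" using ap a_pos by (intro divide_left_mono) auto
    finally show ?thesis .
  qed
  have prof: "profile a b u (- \<theta>) \<theta>" unfolding profile_def using lip lower upper by blast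
  have touch: "1 / b * cos h \<le> u x" if "x \<in> {- \<theta>..\<theta>}" for h x
  proof -
    have "1 / b * cos h \<le> 1 / b * 1" using b_pos by (intro mult_left_mono) auto
    then show ?thesis using lower[OF that] by simp
  qed
  have "polar_arc (1 / b) u (- \<theta>) \<theta>"
  proof (rule arcI)
    show "midpoint_convex_at u x" for x unfolding midpoint_convex_at_def
    proof (intro exI[of _ 1] conjI allI impI)
      show "2 * cos h * u x \<le> u (x - h) + u (x + h)" for h
        unfolding u_def add_divide_distrib[symmetric] cos_midpoint by simp
    qed simp
    show "\<exists>\<delta>>0. \<forall>h. 0 < h \<and> h < \<delta> \<and> - \<theta> + h \<le> \<theta> \<longrightarrow> 1 / b * cos h \<le> u (- \<theta> + h)"
      by (intro exI[of _ 1] conjI allI impI touch) auto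
    show "\<exists>\<delta>>0. \<forall>h. 0 < h \<and> h < \<delta> \<and> - \<theta> \<le> \<theta> - h \<longrightarrow> 1 / b * cos h \<le> u (\<theta> - h)"
      by (intro exI[of _ 1] conjI allI impI touch) auto
    show "u (- \<theta>) = 1 / b" "u \<theta> = 1 / b" using bp by (simp_all add: u_def)
    show "- \<theta> \<le> \<theta>" using th by simp
  qed (rule prof)
  then have "arc_value lam (1 / b) (\<theta> - - \<theta>) (arc_J lam u (- \<theta>) \<theta>)" by (rule arc_value_of_arc)
  moreover have "arc_J lam u (0 - \<theta>) (0 + \<theta>) = chord_value b lam \<theta>"
    by (rule arc_J_chord[OF th(1,2)]) (simp add: u_def p_def)
  ultimately show ?thesis by simp
qed

text \<open>On the kite the boundary follows the tangent line of the inner circle, so the midpoint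
  inequality at the tangency point keeps it on the inner side of this line beyond the kite.\<close>

lemma piece_kite:
  assumes K: "K \<in> C_class a b" and th: "0 < \<theta>" "\<theta> < pi / 2"
    and u: "\<And>x. \<bar>x - q\<bar> \<le> \<theta> \<Longrightarrow> polar_gauge K x = cos (\<theta> - \<bar>x - q\<bar>) / a"
  shows "piece (1 / a) (polar_gauge K) q \<theta>"
proof -
  have ends: "polar_gauge K (q - \<theta>) = 1 / a" "polar_gauge K (q + \<theta>) = 1 / a"
    using u[of "q - \<theta>"] u[of "q + \<theta>"] th by simp_all
  have inner: "polar_gauge K x \<noteq> 1 / a" if x: "\<bar>x - q\<bar> < \<theta>" for x
  proof -
    have "cos (\<theta> - \<bar>x - q\<bar>) < cos 0" using x th by (intro cos_monotone_0_pi) auto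
    then show ?thesis using u[of x] x a_pos by simp
  qed
  have touch: "1 / a * cos h \<le> polar_gauge K (q + \<theta> + h)" "1 / a * cos h \<le> polar_gauge K (q - \<theta> - h)"
    if h: "0 < h \<and> h < \<theta>" for h
  proof -
    have c: "0 < cos h" using h th by (intro cos_gt_zero_pi) auto
    have "polar_gauge K (q + \<theta> - h) = cos h / a" "polar_gauge K (q - \<theta> + h) = cos h / a"
      using u[of "q + \<theta> - h"] u[of "q - \<theta> + h"] h by (simp_all add: abs_if)
    then show "1 / a * cos h \<le> polar_gauge K (q + \<theta> + h)" "1 / a * cos h \<le> polar_gauge K (q - \<theta> - h)"
      using gauge_midpoint[OF K c, of "q + \<theta>"] gauge_midpoint[OF K c, of "q - \<theta>"] ends by simp_all
  qed
  show ?thesis unfolding piece_def using th(1) ends inner touch by blast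
qed

text \<open>At the end of a chord the condition of a piece holds because the set lies in the outer disc.\<close>

lemma piece_chord:
  assumes K: "K \<in> C_class a b" and th: "0 < \<theta>" "\<theta> < pi / 2"
    and u: "\<And>x. \<bar>x - q\<bar> \<le> \<theta> \<Longrightarrow> polar_gauge K x = cos (x - q) / (b * cos \<theta>)"
  shows "piece (1 / b) (polar_gauge K) q \<theta>"
proof -
  have c: "0 < cos \<theta>" using th by (intro cos_gt_zero_pi) auto
  have ends: "polar_gauge K (q - \<theta>) = 1 / b" "polar_gauge K (q + \<theta>) = 1 / b"
    using u[of "q - \<theta>"] u[of "q + \<theta>"] th c b_pos by simp_all
  have inner: "polar_gauge K x \<noteq> 1 / b" if x: "\<bar>x - q\<bar> < \<theta>" for x
  proof -
    have "cos \<theta> < cos \<bar>x - q\<bar>" using x th by (intro cos_monotone_0_pi) auto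
    then have "cos \<theta> < polar_gauge K x * (b * cos \<theta>)" using u[of x] x c b_pos by simp
    then show ?thesis using b_pos by auto
  qed
  have touch: "1 / b * cos h \<le> polar_gauge K x" for h x
  proof -
    have "1 / b * cos h \<le> 1 / b * 1" using b_pos by (intro mult_left_mono) auto
    then show ?thesis using gauge_bounds(2)[OF K, of x] by simp
  qed
  show ?thesis unfolding piece_def using th(1) ends inner touch zero_less_one by blast
qed

end

section \<open>Boundary segments as pieces\<close>

lemma direction_of_cos_eq:
  assumes "cos (p - q) = cos \<theta>"
  shows "direction p = direction (q - \<theta>) \<or> direction p = direction (q + \<theta>)"
proof -
  have p: "direction p = direction (q + (p - q))" by simp
  have "(sin (p - q))\<^sup>2 = (sin \<theta>)\<^sup>2" using assms by (simp add: sin_squared_eq)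
  then consider "sin (p - q) = sin \<theta>" | "sin (p - q) = - sin \<theta>" using power2_eq_iff by blast
  then show ?thesis
  proof cases
    case 1
    then have "direction p = direction (q + \<theta>)"
      unfolding p unfolding plane_eq_iff direction_component cos_add sin_add assms by simp
    then show ?thesis ..
  next
    case 2
    then have "direction p = direction (q - \<theta>)"
      unfolding p unfolding plane_eq_iff direction_component cos_add sin_add cos_diff[of q \<theta>]
        sin_diff[of q \<theta>] assms by simp
    then show ?thesis ..
  qed
qed

lemma polar_point_in_segment:
  assumes st: "m - pi / 2 < s" "t < m + pi / 2" and x: "s \<le> x" "x \<le> t"
  shows "(p / cos (x - m)) *\<^sub>R direction x
           \<in> closed_segment ((p / cos (s - m)) *\<^sub>R direction s) ((p / cos (t - m)) *\<^sub>R direction t)"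
proof -
  have c: "cos (y - m) \<noteq> 0" if "s \<le> y" "y \<le> t" for y
    using cos_gt_zero_pi[of "y - m"] that st by simp
  have "tan (s - m) \<le> tan (x - m)" "tan (x - m) \<le> tan (t - m)" using st x by (auto intro!: tan_mono_le)
  then have "tan (x - m) \<in> closed_segment (tan (s - m)) (tan (t - m))"
    by (simp add: closed_segment_eq_real_ivl)
  then obtain w where w: "0 \<le> w" "w \<le> 1" "tan (x - m) = (1 - w) * tan (s - m) + w * tan (t - m)"
    by (auto simp: closed_segment_def)
  have "(p / cos (x - m)) *\<^sub>R direction x
      = (1 - w) *\<^sub>R ((p / cos (s - m)) *\<^sub>R direction s) + w *\<^sub>R ((p / cos (t - m)) *\<^sub>R direction t)"
    unfolding line_in_polar_coordinates[OF c[OF x]]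
      line_in_polar_coordinates[OF c[OF order.refl order.trans[OF x]]]
      line_in_polar_coordinates[OF c[OF order.trans[OF x] order.refl]] w(3)
    by (simp add: plane_eq_iff algebra_simps)
  then show ?thesis using w unfolding closed_segment_def by blast
qed

text \<open>The point of the line nearest to the origin lies in the disc because \<open>P\<close> does, so by tangency it
  is \<open>P\<close>. The line leaves the disc at the distance \<open>sqrt (a\<^sup>2 - P \<bullet> P)\<close> from \<open>P\<close>, so by tangency
  this distance is zero.\<close>

lemma tangent_at_endpoint:
  assumes tan: "line_tangent_at a P Q P" and a: "0 < a"
  shows "norm P = a" "P \<bullet> Q = a\<^sup>2"
proof -
  define D where "D = Q - P"
  note tan = tan[unfolded line_tangent_at_def]
  have "P \<noteq> Q" and hull: "affine hull {P, Q} \<inter> cball 0 a = {P}"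
    by (rule conjunct1[OF tan], rule conjunct2[OF tan])
  have D0: "D \<noteq> 0" using \<open>P \<noteq> Q\<close> by (simp add: D_def)
  then have D: "0 < D \<bullet> D" by simp
  have "P \<in> affine hull {P, Q} \<inter> cball 0 a" unfolding hull by (rule singletonI)
  then have "P \<in> cball 0 a" by (rule IntD2)
  then have "norm P \<le> a" by simp
  then have PP: "P \<bullet> P \<le> a\<^sup>2" using power_mono[of "norm P" a 2] by (simp flip: power2_norm_eq_inner)
  have only: "s = 0" if s: "P \<bullet> P + 2 * s * (P \<bullet> D) + s\<^sup>2 * (D \<bullet> D) \<le> a\<^sup>2" for s
  proof -
    have "(norm (P + s *\<^sub>R D))\<^sup>2 = P \<bullet> P + 2 * s * (P \<bullet> D) + s\<^sup>2 * (D \<bullet> D)"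
      unfolding power2_norm_eq_inner inner_add_left inner_add_right inner_scaleR_left
        inner_scaleR_right inner_commute[of D P]
      by (simp only: power2_eq_square algebra_simps)
    then have "norm (P + s *\<^sub>R D) \<le> a" using s a by (auto intro!: power2_le_imp_le[of "norm (P + s *\<^sub>R D)" a])
    moreover have "P + s *\<^sub>R D = (1 - s) *\<^sub>R P + s *\<^sub>R Q" by (simp add: D_def algebra_simps)
    then have "P + s *\<^sub>R D \<in> affine hull {P, Q}"
      unfolding affine_hull_2 by (intro CollectI exI[of _ "1 - s"] exI[of _ s]) simp
    ultimately have "P + s *\<^sub>R D \<in> {P}" unfolding hull[symmetric] by simp
    then show "s = 0" using D0 by simp
  qed
  define s where "s = - (P \<bullet> D) / (D \<bullet> D)"
  have "2 * s * (P \<bullet> D) + s\<^sup>2 * (D \<bullet> D) = - ((P \<bullet> D)\<^sup>2 / (D \<bullet> D))"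
    using D by (simp add: s_def power2_eq_square field_simps)
  moreover have "0 \<le> (P \<bullet> D)\<^sup>2 / (D \<bullet> D)" using D by (intro divide_nonneg_nonneg) auto
  ultimately have "P \<bullet> P + 2 * s * (P \<bullet> D) + s\<^sup>2 * (D \<bullet> D) \<le> a\<^sup>2" using PP by linarith
  then have "s = 0" by (rule only)
  then have PD: "P \<bullet> D = 0" using D by (simp add: s_def)
  have "(sqrt ((a\<^sup>2 - P \<bullet> P) / (D \<bullet> D)))\<^sup>2 * (D \<bullet> D) = a\<^sup>2 - P \<bullet> P" using PP D by simp
  then have "sqrt ((a\<^sup>2 - P \<bullet> P) / (D \<bullet> D)) = 0" by (intro only) (simp add: PD)
  then have "P \<bullet> P = a\<^sup>2" using D by simp
  then show "P \<bullet> Q = a\<^sup>2" using PD by (simp add: D_def inner_diff_right)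
  show "norm P = a" using \<open>P \<bullet> P = a\<^sup>2\<close> a by (simp add: norm_eq_sqrt_inner)
qed

context annulus
begin

text \<open>A point that could be moved outwards within \<open>K\<close> would be interior, because \<open>0\<close> is interior.\<close>

lemma gauge_at_frontier:
  assumes K: "K \<in> C_class a b" and r: "0 \<le> r" and fr: "r *\<^sub>R direction t \<in> frontier K"
  shows "polar_gauge K t = 1 / r"
proof -
  let ?g = "polar_gauge K t"
  have K': "compact K" "convex K" "cball 0 a \<subseteq> K" using K by (auto simp: C_class_def)
  have g: "0 < ?g" by (rule gauge_bounds(1)[OF K])
  have "r *\<^sub>R direction t \<in> K" using fr K'(1) by (simp add: frontier_def compact_imp_closed)
  then have le: "r * ?g \<le> 1" using mem_iff_gauge[OF K r] by simp
  have "\<not> r * ?g < 1"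
  proof
    assume lt: "r * ?g < 1"
    have "ball 0 a \<subseteq> interior K" using K'(3) ball_subset_cball by (intro interior_maximal) auto
    then have 0: "0 \<in> interior K" using a_pos by auto
    have w: "(1 / ?g) *\<^sub>R direction t \<in> K" using mem_iff_gauge[OF K, of "1 / ?g" t] g by simp
    have "(1 / ?g) *\<^sub>R direction t - (1 - r * ?g) *\<^sub>R ((1 / ?g) *\<^sub>R direction t - 0) \<in> interior K"
      using lt r g by (intro mem_interior_convex_shrink[OF K'(2) 0 w]) auto
    moreover have "(1 / ?g) *\<^sub>R direction t - (1 - r * ?g) *\<^sub>R ((1 / ?g) *\<^sub>R direction t - 0)
        = r *\<^sub>R direction t"
      using g by (simp add: scaleR_diff_left flip: scaleR_diff_left) (simp add: field_simps)
    ultimately show False using fr by (simp add: frontier_def)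
  qed
  then have "r * ?g = 1" using le by simp
  then show ?thesis by (metis mult_zero_left nonzero_eq_divide_eq zero_neq_one mult.commute)
qed

lemma norm_frontier:
  assumes K: "K \<in> C_class a b" and z: "z \<in> frontier K"
  shows "a \<le> norm z" "norm z \<le> b"
proof -
  obtain t where t: "z = norm z *\<^sub>R direction t" by (rule polar_form)
  then have "polar_gauge K t = 1 / norm z" using gauge_at_frontier[OF K norm_ge_zero, of z t] z by simp
  then have g: "0 < 1 / norm z" "1 / b \<le> 1 / norm z" "1 / norm z \<le> 1 / a"
    using gauge_bounds[OF K, of t] by simp_all
  then have "0 < norm z" by simp
  then show "a \<le> norm z" "norm z \<le> b" using g(2,3) a_pos b_pos by (simp_all add: field_simps)
qed

definition kite_boundary :: "real \<Rightarrow> real \<Rightarrow> (real^2) set" where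
  "kite_boundary q \<theta> = closed_segment (a *\<^sub>R direction (q - \<theta>)) ((a / cos \<theta>) *\<^sub>R direction q)
     \<union> closed_segment ((a / cos \<theta>) *\<^sub>R direction q) (a *\<^sub>R direction (q + \<theta>))"

text \<open>The two tangency points are the two points of the inner circle whose directions differ by \<open>\<theta>\<close>
  from the direction \<open>q\<close> of the vertex.\<close>

lemma upper_a_element_polar:
  assumes K: "K \<in> C_class a b" and E: "upper_a_element a b K \<theta> E"
  obtains q where "0 \<le> q" "q < 2 * pi" "0 < \<theta>" "\<theta> < pi / 2" "a / b < cos \<theta>"
    "E = kite_boundary q \<theta>"
    "\<And>x. \<bar>x - q\<bar> \<le> \<theta> \<Longrightarrow> polar_gauge K x = cos (\<theta> - \<bar>x - q\<bar>) / a"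
proof -
  obtain P Q R where PR: "P \<noteq> R" and Qb: "norm Q \<noteq> b"
    and tP: "line_tangent_at a P Q P" and tR: "line_tangent_at a R Q R"
    and frP: "closed_segment P Q \<subseteq> frontier K" and frR: "closed_segment Q R \<subseteq> frontier K"
    and EQ: "E = closed_segment P Q \<union> closed_segment Q R" and th: "\<theta> = angle_at_O P Q"
    using E unfolding upper_a_element_def by blast
  note P = tangent_at_endpoint[OF tP a_pos] and R = tangent_at_endpoint[OF tR a_pos]
  obtain q where q: "0 \<le> q" "q < 0 + 2 * pi" "Q = norm Q *\<^sub>R direction q" by (rule polar_form)
  define \<rho> where "\<rho> = norm Q"
  have Q: "Q = \<rho> *\<^sub>R direction q" using q(3) by (simp add: \<rho>_def)
  have "Q \<in> frontier K" using frP by auto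
  then have \<rho>b: "\<rho> < b" using norm_frontier(2)[OF K] Qb by (simp add: \<rho>_def less_le)
  have "a < \<rho>"
  proof -
    have "0 < (norm (Q - P))\<^sup>2" using tP by (auto simp: line_tangent_at_def)
    also have "(norm (Q - P))\<^sup>2 = Q \<bullet> Q - 2 * (P \<bullet> Q) + P \<bullet> P"
      unfolding power2_norm_eq_inner by (simp add: inner_diff inner_commute)
    also have "\<dots> = \<rho>\<^sup>2 - a\<^sup>2" using P by (simp add: \<rho>_def flip: power2_norm_eq_inner)
    finally show ?thesis using power_less_imp_less_base[of a 2 \<rho>] by (simp add: \<rho>_def)
  qed
  then have \<rho>: "0 < \<rho>" "a / \<rho> < 1" "0 < a / \<rho>" using a_pos by simp_all
  have "P \<bullet> Q / (norm P * norm Q) = a / \<rho>" using P a_pos by (simp add: \<rho>_def power2_eq_square)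
  then have th': "\<theta> = arccos (a / \<rho>)" unfolding th angle_at_O_def by simp
  then have cth: "cos \<theta> = a / \<rho>" using \<rho> by simp
  have th0: "0 < \<theta>" "\<theta> < pi / 2"
    using arccos_less_arccos[of "a / \<rho>" 1] arccos_less_arccos[of 0 "a / \<rho>"] \<rho> by (simp_all add: th')
  have cpos: "0 < cos \<theta>" using cth \<rho> by simp
  have \<rho>_eq: "\<rho> = a / cos \<theta>" using a_pos by (simp add: cth)
  have cab: "a / b < cos \<theta>" unfolding cth using \<rho>b \<rho> a_pos by (intro divide_strict_left_mono) auto
  have foot: "S = a *\<^sub>R direction (q - \<theta>) \<or> S = a *\<^sub>R direction (q + \<theta>)"
    if S: "norm S = a" "S \<bullet> Q = a\<^sup>2" for S
  proof -
    obtain s where "S = norm S *\<^sub>R direction s" by (rule polar_form)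
    then have s: "S = a *\<^sub>R direction s" using S(1) by simp
    have "a * (\<rho> * cos (s - q)) = a\<^sup>2" using S(2) unfolding s Q by (simp add: inner_direction mult_ac)
    then have "\<rho> * cos (s - q) = a" using a_pos by (simp add: power2_eq_square)
    then have "cos (s - q) = cos \<theta>" unfolding cth using \<rho>(1) by (simp add: field_simps)
    then show ?thesis unfolding s using direction_of_cos_eq by metis
  qed
  let ?A = "a *\<^sub>R direction (q - \<theta>)" and ?B = "a *\<^sub>R direction (q + \<theta>)"
  consider "P = ?A" "R = ?B" | "P = ?B" "R = ?A" using foot[OF P] foot[OF R] PR by blast
  then have fr: "closed_segment ?A Q \<subseteq> frontier K \<and> closed_segment Q ?B \<subseteq> frontier K
        \<and> E = closed_segment ?A Q \<union> closed_segment Q ?B"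
  proof cases
    case 1
    then show ?thesis using frP frR EQ by simp
  next
    case 2
    then have "closed_segment P Q = closed_segment Q ?B" "closed_segment Q R = closed_segment ?A Q"
      by (simp_all only: closed_segment_commute)
    then show ?thesis using frP frR EQ by blast
  qed
  then have Ek: "E = kite_boundary q \<theta>" unfolding kite_boundary_def \<rho>_eq[symmetric] Q[symmetric] by blast
  have "polar_gauge K x = cos (\<theta> - \<bar>x - q\<bar>) / a" if x: "\<bar>x - q\<bar> \<le> \<theta>" for x
  proof (cases "x \<le> q")
    case True
    have "(a / cos (x - (q - \<theta>))) *\<^sub>R direction x
        \<in> closed_segment ((a / cos (q - \<theta> - (q - \<theta>))) *\<^sub>R direction (q - \<theta>))
            ((a / cos (q - (q - \<theta>))) *\<^sub>R direction q)"
      using x True th0 by (intro polar_point_in_segment) auto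
    also have "\<dots> \<subseteq> frontier K" using fr unfolding Q \<rho>_eq by simp
    finally have "polar_gauge K x = 1 / (a / cos (x - (q - \<theta>)))"
      using x True th0 a_pos
      by (intro gauge_at_frontier[OF K] divide_nonneg_nonneg cos_ge_zero) auto
    moreover have eq: "\<theta> - \<bar>x - q\<bar> = x - (q - \<theta>)" using True by simp
    ultimately show ?thesis unfolding eq by simp
  next
    case False
    have "(a / cos (x - (q + \<theta>))) *\<^sub>R direction x
        \<in> closed_segment ((a / cos (q - (q + \<theta>))) *\<^sub>R direction q)
            ((a / cos (q + \<theta> - (q + \<theta>))) *\<^sub>R direction (q + \<theta>))"
      using x False th0 by (intro polar_point_in_segment) auto
    also have "\<dots> \<subseteq> frontier K" using fr unfolding Q \<rho>_eq by simp
    finally have "polar_gauge K x = 1 / (a / cos (x - (q + \<theta>)))"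
      using x False th0 a_pos
      by (intro gauge_at_frontier[OF K] divide_nonneg_nonneg cos_ge_zero) auto
    moreover have eq: "x - (q + \<theta>) = - (\<theta> - \<bar>x - q\<bar>)" using False by simp
    ultimately show ?thesis unfolding eq cos_minus by simp
  qed
  then show ?thesis using that[of q] q(1,2) th0 cab Ek by simp
qed

text \<open>The midpoint of a chord is a boundary point of \<open>K\<close>, so its distance from the origin is at least
  \<open>a\<close>, and it differs from \<open>a\<close> because otherwise the chord would be tangent to the inner disc. The
  end points have directions that differ by \<open>\<eta>\<close> from the direction \<open>q\<close> of the midpoint.\<close>

lemma lower_b_element_polar:
  assumes K: "K \<in> C_class a b" and E: "lower_b_element a b K \<eta> E"
  obtains q where "0 \<le> q" "q < 2 * pi" "0 < \<eta>" "\<eta> < pi / 2" "a / b < cos \<eta>"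
    "E = closed_segment (b *\<^sub>R direction (q - \<eta>)) (b *\<^sub>R direction (q + \<eta>))"
    "\<And>x. \<bar>x - q\<bar> \<le> \<eta> \<Longrightarrow> polar_gauge K x = cos (x - q) / (b * cos \<eta>)"
proof -
  obtain P Q where PQ: "P \<noteq> Q" and P: "norm P = b" and Q: "norm Q = b"
    and notan: "\<not> (\<exists>T. line_tangent_at a P Q T)" and fr: "closed_segment P Q \<subseteq> frontier K"
    and EQ: "E = closed_segment P Q" and eta: "\<eta> = angle_at_O P (midpoint P Q)"
    using E unfolding lower_b_element_def by blast
  define M where "M = midpoint P Q"
  define D where "D = Q - P"
  have D: "D \<noteq> 0" using PQ by (simp add: D_def)
  have PP: "P \<bullet> P = b\<^sup>2" "Q \<bullet> Q = b\<^sup>2" using P Q by (simp_all flip: power2_norm_eq_inner)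
  have Peq: "P = M - (1 / 2) *\<^sub>R D" and Qeq: "Q = M + (1 / 2) *\<^sub>R D"
    by (simp_all add: M_def D_def midpoint_def plane_eq_iff field_simps)
  have MD: "M \<bullet> D = 0"
    using PP unfolding M_def D_def midpoint_def
    by (simp add: inner_add_left inner_diff_right inner_commute[of Q P])
  define \<rho> where "\<rho> = norm M"
  obtain q where q: "0 \<le> q" "q < 0 + 2 * pi" "M = norm M *\<^sub>R direction q" by (rule polar_form)
  have Mq: "M = \<rho> *\<^sub>R direction q" using q(3) by (simp add: \<rho>_def)
  have MM: "M \<bullet> M = \<rho>\<^sup>2" unfolding \<rho>_def by (rule power2_norm_eq_inner[symmetric])
  have "M \<in> frontier K" using fr midpoint_in_closed_segment[of P Q] by (auto simp: M_def)
  then have "a \<le> \<rho>" using norm_frontier(1)[OF K] by (simp add: \<rho>_def)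
  moreover have "\<rho> \<noteq> a"
  proof
    assume \<rho>a: "\<rho> = a"
    have "affine hull {P, Q} \<inter> cball 0 a = {M}"
    proof (intro equalityI subsetI)
      fix z assume z: "z \<in> affine hull {P, Q} \<inter> cball 0 a"
      then obtain c d where cd: "z = c *\<^sub>R P + d *\<^sub>R Q" "c + d = 1" by (auto simp: affine_hull_2)
      have c: "c = 1 - d" using cd(2) by simp
      have zM: "z = M + (d - 1 / 2) *\<^sub>R D"
        unfolding cd(1) c Peq Qeq by (simp add: plane_eq_iff field_simps)
      have "norm z \<le> a" using z by simp
      then have "(norm z)\<^sup>2 \<le> a\<^sup>2" by (intro power_mono) auto
      moreover have "(norm z)\<^sup>2 = \<rho>\<^sup>2 + (d - 1 / 2)\<^sup>2 * (D \<bullet> D)"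
        unfolding power2_norm_eq_inner zM inner_add_left inner_add_right inner_scaleR_left
          inner_scaleR_right inner_commute[of D M] MD MM by algebra
      ultimately have "(d - 1 / 2)\<^sup>2 * (D \<bullet> D) \<le> 0" using \<rho>a by simp
      moreover have "0 < D \<bullet> D" using D by simp
      ultimately have "(d - 1 / 2)\<^sup>2 \<le> 0" by (simp add: mult_le_0_iff)
      then have "d - 1 / 2 = 0" by simp
      then show "z \<in> {M}" using zM by simp
    next
      fix z assume "z \<in> {M}"
      then have z: "z = (1 / 2) *\<^sub>R P + (1 / 2) *\<^sub>R Q" "norm z \<le> a"
        using \<rho>a by (simp_all add: M_def midpoint_def \<rho>_def algebra_simps)
      have "z \<in> affine hull {P, Q}"
        unfolding affine_hull_2 z(1) by (intro CollectI exI[of _ "1 / 2"]) simp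
      then show "z \<in> affine hull {P, Q} \<inter> cball 0 a" using z(2) by simp
    qed
    then show False using notan PQ unfolding line_tangent_at_def by blast
  qed
  ultimately have a\<rho>: "a < \<rho>" by simp
  then have \<rho>: "0 < \<rho>" using a_pos by simp
  have "b\<^sup>2 = \<rho>\<^sup>2 + (D \<bullet> D) / 4"
    using PP(2) unfolding Qeq inner_add_left inner_add_right inner_scaleR_left
      inner_scaleR_right inner_commute[of D M] MD MM by simp
  moreover have "0 < D \<bullet> D" using D by simp
  ultimately have "\<rho>\<^sup>2 < b\<^sup>2" by simp
  then have \<rho>b: "\<rho> < b" using b_pos by (intro power_less_imp_less_base[of \<rho> 2 b]) auto
  have PM: "P \<bullet> M = \<rho>\<^sup>2" "Q \<bullet> M = \<rho>\<^sup>2"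
    unfolding Peq Qeq inner_add_left inner_diff_left inner_scaleR_left inner_commute[of D M] MD MM
    by simp_all
  have "P \<bullet> M / (norm P * norm M) = \<rho> / b" using PM P \<rho> by (simp add: power2_eq_square flip: \<rho>_def)
  then have eta': "\<eta> = arccos (\<rho> / b)" unfolding eta angle_at_O_def M_def[symmetric] by simp
  have \<rho>b1: "\<rho> / b < 1" "0 < \<rho> / b" using \<rho> \<rho>b b_pos by simp_all
  then have ceta: "cos \<eta> = \<rho> / b" by (simp add: eta')
  have eta0: "0 < \<eta>" "\<eta> < pi / 2"
    using arccos_less_arccos[of "\<rho> / b" 1] arccos_less_arccos[of 0 "\<rho> / b"] \<rho>b1 by (simp_all add: eta')
  have \<rho>_eq: "\<rho> = b * cos \<eta>" using ceta b_pos by simp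
  have cab: "a / b < cos \<eta>" unfolding ceta using a\<rho> b_pos by (intro divide_strict_right_mono)
  have ends: "S = b *\<^sub>R direction (q - \<eta>) \<or> S = b *\<^sub>R direction (q + \<eta>)"
    if S: "norm S = b" "S \<bullet> M = \<rho>\<^sup>2" for S
  proof -
    obtain s where "S = norm S *\<^sub>R direction s" by (rule polar_form)
    then have s: "S = b *\<^sub>R direction s" using S(1) by simp
    have "b * (\<rho> * cos (s - q)) = \<rho>\<^sup>2" using S(2) unfolding s Mq by (simp add: inner_direction mult_ac)
    then have "b * cos (s - q) = \<rho>" using \<rho> by (simp add: power2_eq_square)
    then have "cos (s - q) = cos \<eta>" unfolding ceta using b_pos by (simp add: field_simps)
    then show ?thesis unfolding s using direction_of_cos_eq by metis
  qed
  have Es: "E = closed_segment (b *\<^sub>R direction (q - \<eta>)) (b *\<^sub>R direction (q + \<eta>))"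
  proof -
    consider "P = b *\<^sub>R direction (q - \<eta>)" "Q = b *\<^sub>R direction (q + \<eta>)"
      | "P = b *\<^sub>R direction (q + \<eta>)" "Q = b *\<^sub>R direction (q - \<eta>)"
      using ends[OF P PM(1)] ends[OF Q PM(2)] PQ by blast
    then show ?thesis unfolding EQ by cases (simp_all only: closed_segment_commute)
  qed
  have "polar_gauge K x = cos (x - q) / (b * cos \<eta>)" if x: "\<bar>x - q\<bar> \<le> \<eta>" for x
  proof -
    have "(\<rho> / cos (x - q)) *\<^sub>R direction x
        \<in> closed_segment ((\<rho> / cos (q - \<eta> - q)) *\<^sub>R direction (q - \<eta>))
            ((\<rho> / cos (q + \<eta> - q)) *\<^sub>R direction (q + \<eta>))"
      using x eta0 by (intro polar_point_in_segment) auto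
    also have "\<dots> = E"
    proof -
      have "\<rho> / cos \<eta> = b" using \<rho> by (simp add: ceta)
      then show ?thesis unfolding Es by simp
    qed
    also have "\<dots> \<subseteq> frontier K" using fr EQ by simp
    finally have "polar_gauge K x = 1 / (\<rho> / cos (x - q))"
      using x eta0 \<rho> by (intro gauge_at_frontier[OF K] divide_nonneg_nonneg cos_ge_zero) auto
    then show ?thesis unfolding \<rho>_eq by simp
  qed
  then show ?thesis using that[of q] q(1,2) eta0 cab Es by simp
qed

end

section \<open>Optimal angles\<close>

lemma tan_diff_eq: "cos x \<noteq> 0 \<Longrightarrow> cos y \<noteq> 0 \<Longrightarrow> tan x - tan y = sin (x - y) / (cos x * cos y)"
  for x y :: real
  by (simp add: tan_def sin_diff field_simps)

text \<open>Strict convexity of the tangent: moving angle from the smaller to the larger one increases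
  the sum.\<close>

lemma tan_spread:
  assumes "0 < e" "e < y" "y \<le> x" "x + e < pi / 2"
  shows "tan x + tan y < tan (x + e) + tan (y - e)"
proof -
  have c: "0 < cos z" if "0 \<le> z" "z \<le> x + e" for z using that assms by (intro cos_gt_zero_pi) auto
  have 1: "tan (x + e) - tan x = sin e / (cos (x + e) * cos x)"
    using tan_diff_eq[of "x + e" x] c[of "x + e"] c[of x] assms by simp
  have 2: "tan y - tan (y - e) = sin e / (cos y * cos (y - e))"
    using tan_diff_eq[of y "y - e"] c[of y] c[of "y - e"] assms by simp
  have "cos (x + e) < cos y" using assms by (intro cos_monotone_0_pi) auto
  moreover have "cos x < cos (y - e)" using assms by (intro cos_monotone_0_pi) auto
  ultimately have "cos (x + e) * cos x < cos y * cos (y - e)"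
    using c[of "x + e"] c[of x] c[of y] assms by (intro mult_strict_mono) auto
  moreover have "0 < sin e" using assms by (intro sin_gt_zero) auto
  ultimately have "sin e / (cos y * cos (y - e)) < sin e / (cos (x + e) * cos x)"
    using c[of "x + e"] c[of x] c[of y] c[of "y - e"] assms
    by (intro divide_strict_left_mono mult_pos_pos) auto
  then show ?thesis using 1 2 by linarith
qed

lemma tan_half_less:
  assumes "0 < x" "x < pi / 2"
  shows "2 * tan (x / 2) < tan x"
proof -
  have c: "0 < cos x" "0 < cos (x / 2)" using assms by (auto intro!: cos_gt_zero_pi)
  have s: "0 < sin (x / 2)" using assms by (intro sin_gt_zero) auto
  have "tan x - tan (x / 2) = sin (x - x / 2) / (cos x * cos (x / 2))"
    using c by (intro tan_diff_eq) auto
  also have "\<dots> = tan (x / 2) / cos x" by (simp add: tan_def)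
  also have "\<dots> > tan (x / 2)"
  proof -
    have "cos x < cos 0" using assms by (intro cos_monotone_0_pi) auto
    moreover have "0 < tan (x / 2)" using c s by (simp add: tan_def)
    ultimately show ?thesis using c by (simp add: field_simps)
  qed
  finally show ?thesis by simp
qed

lemma chord_value_deriv:
  "(chord_value b lam has_real_derivative lam * b\<^sup>2 * (2 * (cos x)\<^sup>2 - 1) - 2 * b * cos x) (at x)"
proof -
  have "((\<lambda>x. lam * b\<^sup>2 * (sin x * cos x) - 2 * b * sin x) has_real_derivative
      lam * b\<^sup>2 * (cos x * cos x - sin x * sin x) - 2 * b * cos x) (at x)"
    by (auto intro!: derivative_eq_intros)
  moreover have "cos x * cos x - sin x * sin x = 2 * (cos x)\<^sup>2 - 1"
    using sin_cos_squared_add[of x] by (simp add: power2_eq_square)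
  ultimately show ?thesis by (simp add: chord_value_def[abs_def])
qed

context annulus
begin

lemma room_for_perturbation:
  assumes "0 < x" "x < pi / 2" "a / b < cos x"
  obtains d where "0 < d" "\<And>e. \<bar>e\<bar> < d \<Longrightarrow> 0 < x + e \<and> x + e < pi / 2 \<and> a / b \<le> cos (x + e)"
proof (rule that[of "min (min x (pi / 2 - x)) (cos x - a / b)"])
  fix e assume e: "\<bar>e\<bar> < min (min x (pi / 2 - x)) (cos x - a / b)"
  then show "0 < x + e \<and> x + e < pi / 2 \<and> a / b \<le> cos (x + e)"
    using lipschitz_cos[of "x + e" x] by (auto simp: abs_if split: if_splits)
qed (use assms in simp)

text \<open>The first variation of the exchange of angle between two chords.\<close>

lemma chord_stationary:
  assumes x: "0 < x" "x < pi / 2" "a / b < cos x" and y: "0 < y" "y < pi / 2" "a / b < cos y"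
    and opt: "\<And>x' y'. 0 < x' \<Longrightarrow> x' < pi / 2 \<Longrightarrow> a / b \<le> cos x' \<Longrightarrow>
                0 < y' \<Longrightarrow> y' < pi / 2 \<Longrightarrow> a / b \<le> cos y' \<Longrightarrow> x' + y' = x + y \<Longrightarrow>
                chord_value b lam x + chord_value b lam y \<le> chord_value b lam x' + chord_value b lam y'"
    and ne: "x \<noteq> y"
  shows "lam * b * (cos x + cos y) = 1"
proof -
  obtain d1 where d1: "0 < d1" "\<And>e. \<bar>e\<bar> < d1 \<Longrightarrow> 0 < x + e \<and> x + e < pi / 2 \<and> a / b \<le> cos (x + e)"
    using room_for_perturbation[OF x] by blast
  obtain d2 where d2: "0 < d2" "\<And>e. \<bar>e\<bar> < d2 \<Longrightarrow> 0 < y + e \<and> y + e < pi / 2 \<and> a / b \<le> cos (y + e)"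
    using room_for_perturbation[OF y] by blast
  let ?f = "\<lambda>e. chord_value b lam (x + e) + chord_value b lam (y - e)"
  let ?D = "\<lambda>z. lam * b\<^sup>2 * (2 * (cos z)\<^sup>2 - 1) - 2 * b * cos z"
  have "(?f has_real_derivative ?D x * 1 + ?D y * (- 1)) (at 0)"
  proof (intro DERIV_add)
    have "((\<lambda>e. x + e) has_real_derivative 1) (at 0)" "((\<lambda>e. y - e) has_real_derivative - 1) (at 0)"
      by (auto intro!: derivative_eq_intros)
    then show "((\<lambda>e. chord_value b lam (x + e)) has_real_derivative ?D x * 1) (at 0)"
      "((\<lambda>e. chord_value b lam (y - e)) has_real_derivative ?D y * (- 1)) (at 0)"
      using DERIV_chain2[of "chord_value b lam" "?D x" "\<lambda>e. x + e" 0 1 UNIV]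
        DERIV_chain2[of "chord_value b lam" "?D y" "\<lambda>e. y - e" 0 "- 1" UNIV]
        chord_value_deriv[of b lam x] chord_value_deriv[of b lam y] by simp_all
  qed
  moreover have "\<forall>e. \<bar>0 - e\<bar> < min d1 d2 \<longrightarrow> ?f 0 \<le> ?f e"
  proof (intro allI impI)
    fix e assume e: "\<bar>0 - e\<bar> < min d1 d2"
    have "chord_value b lam x + chord_value b lam y \<le> chord_value b lam (x + e) + chord_value b lam (y - e)"
      using d1(2)[of e] d2(2)[of "- e"] e by (intro opt) auto
    then show "?f 0 \<le> ?f e" by simp
  qed
  ultimately have "?D x * 1 + ?D y * (- 1) = 0"
    using d1(1) d2(1) by (intro DERIV_local_min[of ?f _ 0 "min d1 d2"]) auto
  then have "2 * b * (cos x - cos y) * (lam * b * (cos x + cos y) - 1) = 0"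
    by (simp add: power2_eq_square algebra_simps)
  moreover have "cos x \<noteq> cos y" using ne x y cos_inj_pi[of x y] by auto
  ultimately show ?thesis using b_pos by simp
qed

text \<open>The second variation for two equal chords.\<close>

lemma equal_chords_stable:
  assumes y: "0 < y" "y < pi / 2" "a / b < cos y"
    and opt: "\<And>x' y'. 0 < x' \<Longrightarrow> x' < pi / 2 \<Longrightarrow> a / b \<le> cos x' \<Longrightarrow>
                0 < y' \<Longrightarrow> y' < pi / 2 \<Longrightarrow> a / b \<le> cos y' \<Longrightarrow> x' + y' = y + y \<Longrightarrow>
                chord_value b lam y + chord_value b lam y \<le> chord_value b lam x' + chord_value b lam y'"
  shows "2 * (lam * b * cos y) \<le> 1"
proof (rule ccontr)
  define X where "X = lam * b * cos y"
  assume "\<not> 2 * (lam * b * cos y) \<le> 1"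
  then have X: "1 < 2 * X" by (simp add: X_def)
  obtain d where d: "0 < d" "\<And>e. \<bar>e\<bar> < d \<Longrightarrow> 0 < y + e \<and> y + e < pi / 2 \<and> a / b \<le> cos (y + e)"
    using room_for_perturbation[OF y] by blast
  (* The exchange inequality reads X * (1 + cos e) \<le> 1; it fails for small e since 2 * X > 1. *)
  define e where "e = min (min (d / 2) 1) ((2 * X - 1) / (2 * X))"
  have e: "0 < e" "e < d" "e \<le> 1" "e \<le> (2 * X - 1) / (2 * X)" using d(1) X by (auto simp: e_def)
  have "chord_value b lam y + chord_value b lam y \<le> chord_value b lam (y + e) + chord_value b lam (y - e)"
    using d(2)[of e] d(2)[of "- e"] e by (intro opt) auto
  also have "\<dots> = 2 * lam * b\<^sup>2 * (sin y * cos y) * (2 * (cos e)\<^sup>2 - 1) - 4 * b * sin y * cos e"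
  proof -
    have s: "sin (y + e) + sin (y - e) = 2 * sin y * cos e" by (simp add: sin_add sin_diff)
    have "sin (y + e) * cos (y + e) + sin (y - e) * cos (y - e)
        = 2 * sin y * cos y * ((cos e)\<^sup>2 - (sin e)\<^sup>2)"
      by (simp add: sin_add sin_diff cos_add cos_diff power2_eq_square algebra_simps)
    also have "(cos e)\<^sup>2 - (sin e)\<^sup>2 = 2 * (cos e)\<^sup>2 - 1" unfolding sin_squared_eq by simp
    finally have sc: "sin (y + e) * cos (y + e) + sin (y - e) * cos (y - e)
        = 2 * sin y * cos y * (2 * (cos e)\<^sup>2 - 1)" .
    have "chord_value b lam (y + e) + chord_value b lam (y - e)
        = lam * b\<^sup>2 * (sin (y + e) * cos (y + e) + sin (y - e) * cos (y - e))
          - 2 * b * (sin (y + e) + sin (y - e))"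
      by (simp add: chord_value_def distrib_left)
    then show ?thesis unfolding s sc by (simp add: mult_ac)
  qed
  also have "\<dots> = chord_value b lam y + chord_value b lam y
      + (4 * b * sin y) * ((1 - cos e) * (1 - X * (1 + cos e)))"
    unfolding chord_value_def X_def by algebra
  finally have "0 \<le> (4 * b * sin y) * ((1 - cos e) * (1 - X * (1 + cos e)))" by simp
  moreover have "0 < 4 * b * sin y" using b_pos y sin_gt_zero[of y] by simp
  ultimately have "0 \<le> (1 - cos e) * (1 - X * (1 + cos e))" by (simp add: zero_le_mult_iff)
  moreover have "cos e < cos 0" using e pi_gt3 by (intro cos_monotone_0_pi) auto
  ultimately have "X * (1 + cos e) \<le> 1" by (simp add: zero_le_mult_iff)
  moreover have "1 - cos e < e"
  proof -
    have "1 - cos e = 2 * (sin (e / 2))\<^sup>2" using cos_double_sin[of "e / 2"] by simp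
    also have "\<dots> \<le> 2 * (e / 2)\<^sup>2"
      using abs_sin_x_le_abs_x[of "e / 2"] by (simp only: abs_le_square_iff)
    also have "\<dots> = e * e / 2" by (simp add: power2_eq_square)
    also have "\<dots> < e" using e mult_left_mono[of e 1 e] by simp
    finally show ?thesis .
  qed
  then have "X * (2 - e) < X * (1 + cos e)" using X by (intro mult_strict_left_mono) auto
  moreover have "e * (2 * X) \<le> 2 * X - 1" using e(4) X by (simp add: field_simps)
  moreover have "X * (2 - e) = 2 * X - e * (2 * X) / 2" by (simp add: algebra_simps)
  ultimately show False using X by linarith
qed

lemma upper_a_element_piece:
  assumes K: "K \<in> C_class a b" and E: "upper_a_element a b K \<theta> E"
  obtains q where "0 \<le> q" "q < 2 * pi" "E = kite_boundary q \<theta>" "piece (1 / a) (polar_gauge K) q \<theta>"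
    "\<forall>lam. arc_J lam (polar_gauge K) (q - \<theta>) (q + \<theta>) = kite_value a lam \<theta>"
proof (rule upper_a_element_polar[OF K E])
  fix q assume q: "0 \<le> q" "q < 2 * pi" "0 < \<theta>" "\<theta> < pi / 2" "E = kite_boundary q \<theta>"
    and u: "\<And>x. \<bar>x - q\<bar> \<le> \<theta> \<Longrightarrow> polar_gauge K x = cos (\<theta> - \<bar>x - q\<bar>) / a"
  have "piece (1 / a) (polar_gauge K) q \<theta>" by (rule piece_kite[OF K q(3,4) u])
  moreover have "\<forall>lam. arc_J lam (polar_gauge K) (q - \<theta>) (q + \<theta>) = kite_value a lam \<theta>"
    by (intro allI arc_J_kite[OF q(3,4) profile_gauge[OF K] u])
  ultimately show thesis by (rule that[OF q(1,2,5)])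
qed

lemma lower_b_element_piece:
  assumes K: "K \<in> C_class a b" and E: "lower_b_element a b K \<eta> E"
  obtains q where "0 \<le> q" "q < 2 * pi"
    "E = closed_segment (b *\<^sub>R direction (q - \<eta>)) (b *\<^sub>R direction (q + \<eta>))"
    "piece (1 / b) (polar_gauge K) q \<eta>"
    "\<forall>lam. arc_J lam (polar_gauge K) (q - \<eta>) (q + \<eta>) = chord_value b lam \<eta>"
proof (rule lower_b_element_polar[OF K E])
  fix q assume q: "0 \<le> q" "q < 2 * pi" "0 < \<eta>" "\<eta> < pi / 2"
    "E = closed_segment (b *\<^sub>R direction (q - \<eta>)) (b *\<^sub>R direction (q + \<eta>))"
    and u: "\<And>x. \<bar>x - q\<bar> \<le> \<eta> \<Longrightarrow> polar_gauge K x = cos (x - q) / (b * cos \<eta>)"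
  have "piece (1 / b) (polar_gauge K) q \<eta>" by (rule piece_chord[OF K q(3,4) u])
  moreover have "\<forall>lam. arc_J lam (polar_gauge K) (q - \<eta>) (q + \<eta>) = chord_value b lam \<eta>"
    by (intro allI arc_J_chord[OF q(3,4) u])
  ultimately show thesis by (rule that[OF q(1,2,5)])
qed

lemma upper_a_element_angle:
  assumes "K \<in> C_class a b" "upper_a_element a b K \<theta> E"
  shows "0 < \<theta>" "\<theta> < pi / 2" "a / b < cos \<theta>"
  by (rule upper_a_element_polar[OF assms]; assumption)+

lemma lower_b_element_angle:
  assumes "K \<in> C_class a b" "lower_b_element a b K \<eta> E"
  shows "0 < \<eta>" "\<eta> < pi / 2" "a / b < cos \<eta>"
  by (rule lower_b_element_polar[OF assms]; assumption)+

text \<open>Two different boundary elements of the same kind correspond to two different pieces, so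
  that angle can be exchanged between them.\<close>

lemma exchange_kites:
  assumes opt: "optimal a b lam \<Omega>"
    and E: "upper_a_element a b \<Omega> \<theta> E" "upper_a_element a b \<Omega> \<theta>' E'" and ne: "(\<theta>, E) \<noteq> (\<theta>', E')"
    and x: "0 < x" "x < pi / 2" "a / b \<le> cos x" and y: "0 < y" "y < pi / 2" "a / b \<le> cos y"
    and sum: "x + y = \<theta> + \<theta>'"
  shows "kite_value a lam \<theta> + kite_value a lam \<theta>' \<le> kite_value a lam x + kite_value a lam y"
proof -
  have K: "\<Omega> \<in> C_class a b" using opt by (simp add: optimal_def)
  obtain q where q: "0 \<le> q" "q < 2 * pi" "E = kite_boundary q \<theta>"
    and p: "piece (1 / a) (polar_gauge \<Omega>) q \<theta>"
    and J: "\<forall>lam. arc_J lam (polar_gauge \<Omega>) (q - \<theta>) (q + \<theta>) = kite_value a lam \<theta>"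
    by (rule upper_a_element_piece[OF K E(1)])
  obtain q' where q': "0 \<le> q'" "q' < 2 * pi" "E' = kite_boundary q' \<theta>'"
    and p': "piece (1 / a) (polar_gauge \<Omega>) q' \<theta>'"
    and J': "\<forall>lam. arc_J lam (polar_gauge \<Omega>) (q' - \<theta>') (q' + \<theta>') = kite_value a lam \<theta>'"
    by (rule upper_a_element_piece[OF K E(2)])
  have "\<bar>q - q'\<bar> < 2 * pi" using q(1,2) q'(1,2) by linarith
  moreover have "(q, \<theta>) \<noteq> (q', \<theta>')" using ne q(3) q'(3) by blast
  ultimately show ?thesis
    using exchange_pieces[OF opt p p' _ _ arc_value_kite[OF x] arc_value_kite[OF y] sum] J J' by simp
qed

lemma exchange_chords:
  assumes opt: "optimal a b lam \<Omega>"
    and E: "lower_b_element a b \<Omega> \<eta> E" "lower_b_element a b \<Omega> \<eta>' E'" and ne: "(\<eta>, E) \<noteq> (\<eta>', E')"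
    and x: "0 < x" "x < pi / 2" "a / b \<le> cos x" and y: "0 < y" "y < pi / 2" "a / b \<le> cos y"
    and sum: "x + y = \<eta> + \<eta>'"
  shows "chord_value b lam \<eta> + chord_value b lam \<eta>' \<le> chord_value b lam x + chord_value b lam y"
proof -
  have K: "\<Omega> \<in> C_class a b" using opt by (simp add: optimal_def)
  obtain q where q: "0 \<le> q" "q < 2 * pi" 
    "E = closed_segment (b *\<^sub>R direction (q - \<eta>)) (b *\<^sub>R direction (q + \<eta>))"
    and p: "piece (1 / b) (polar_gauge \<Omega>) q \<eta>"
    and J: "\<forall>lam. arc_J lam (polar_gauge \<Omega>) (q - \<eta>) (q + \<eta>) = chord_value b lam \<eta>"
    by (rule lower_b_element_piece[OF K E(1)])
  obtain q' where q': "0 \<le> q'" "q' < 2 * pi" 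
    "E' = closed_segment (b *\<^sub>R direction (q' - \<eta>')) (b *\<^sub>R direction (q' + \<eta>'))"
    and p': "piece (1 / b) (polar_gauge \<Omega>) q' \<eta>'"
    and J': "\<forall>lam. arc_J lam (polar_gauge \<Omega>) (q' - \<eta>') (q' + \<eta>') = chord_value b lam \<eta>'"
    by (rule lower_b_element_piece[OF K E(2)])
  have "\<bar>q - q'\<bar> < 2 * pi" using q(1,2) q'(1,2) by linarith
  moreover have "(q, \<eta>) \<noteq> (q', \<eta>')" using ne q(3) q'(3) by blast
  ultimately show ?thesis
    using exchange_pieces[OF opt p p' _ _ arc_value_chord[OF x] arc_value_chord[OF y] sum] J J' by simp
qed

text \<open>For \<open>lam * a > 2\<close> the value of a kite is a positive multiple of \<open>tan \<theta>\<close>, and two kites of half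
  the angle have the smaller value, by \<open>tan_half_less\<close>.\<close>

lemma no_kite_if_lam_large:
  assumes opt: "optimal a b lam \<Omega>" and lam: "2 < lam * a"
  shows "\<not> upper_a_element a b \<Omega> \<theta> E"
proof
  assume E: "upper_a_element a b \<Omega> \<theta> E"
  have K: "\<Omega> \<in> C_class a b" using opt by (simp add: optimal_def)
  note q = upper_a_element_angle[OF K E]
  obtain q where "0 \<le> q" "q < 2 * pi" "E = kite_boundary q \<theta>"
    and p: "piece (1 / a) (polar_gauge \<Omega>) q \<theta>"
    and J: "\<forall>lam. arc_J lam (polar_gauge \<Omega>) (q - \<theta>) (q + \<theta>) = kite_value a lam \<theta>"
    by (rule upper_a_element_piece[OF K E])
  have "cos \<theta> \<le> cos (\<theta> / 2)" using q by (intro cos_monotone_0_pi_le) auto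
  then have "arc_value lam (1 / a) (2 * (\<theta> / 2)) (kite_value a lam (\<theta> / 2))"
    using q by (intro arc_value_kite) auto
  then have "arc_value lam (1 / a) (2 * (\<theta> / 2) + 2 * (\<theta> / 2))
      (kite_value a lam (\<theta> / 2) + kite_value a lam (\<theta> / 2))"
    using q by (intro arc_value_add) auto
  then have "arc_J lam (polar_gauge \<Omega>) (q - \<theta>) (q + \<theta>) \<le> kite_value a lam (\<theta> / 2) + kite_value a lam (\<theta> / 2)"
    by (intro replace_piece[OF opt p]) simp
  then have "kite_value a lam \<theta> \<le> kite_value a lam (\<theta> / 2) + kite_value a lam (\<theta> / 2)" using J by simp
  then have "a * (lam * a - 2) * tan \<theta> \<le> a * (lam * a - 2) * (2 * tan (\<theta> / 2))"
    by (simp add: kite_value_def mult_ac)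
  moreover have "0 < a * (lam * a - 2)" using a_pos lam by simp
  ultimately have "tan \<theta> \<le> 2 * tan (\<theta> / 2)" by (simp only: mult_le_cancel_left_pos)
  then show False using tan_half_less[OF q(1,2)] by simp
qed

text \<open>For \<open>lam * a < 2\<close> the value of a kite is a negative multiple of \<open>tan \<theta>\<close>, and transferring angle
  from the smaller to the larger of two kites lowers the sum, by \<open>tan_spread\<close>.\<close>

lemma at_most_one_kite:
  assumes opt: "optimal a b lam \<Omega>" and lam: "lam \<noteq> 2 / a"
    and E: "upper_a_element a b \<Omega> \<theta> E" "upper_a_element a b \<Omega> \<theta>' E'"
  shows "\<theta> = \<theta>' \<and> E = E'"
proof (rule ccontr)
  assume contr: "\<not> (\<theta> = \<theta>' \<and> E = E')"
  have K: "\<Omega> \<in> C_class a b" using opt by (simp add: optimal_def)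
  have "\<not> 2 < lam * a" using no_kite_if_lam_large[OF opt] E(1) by blast
  moreover have "lam * a \<noteq> 2" using lam a_pos by (auto simp: field_simps)
  ultimately have neg: "a * (lam * a - 2) < 0" using a_pos by (simp add: mult_pos_neg)
  have *: False if E: "upper_a_element a b \<Omega> \<theta> E" "upper_a_element a b \<Omega> \<theta>' E'"
    and le: "\<theta>' \<le> \<theta>" and ne: "(\<theta>, E) \<noteq> (\<theta>', E')" for \<theta> \<theta>' E E'
  proof -
    note th = upper_a_element_angle[OF K E(1)] and th' = upper_a_element_angle[OF K E(2)]
    obtain d1 where d1: "0 < d1" "\<And>e. \<bar>e\<bar> < d1 \<Longrightarrow> 0 < \<theta> + e \<and> \<theta> + e < pi / 2 \<and> a / b \<le> cos (\<theta> + e)"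
      using room_for_perturbation[OF th] by blast
    obtain d2 where d2: "0 < d2"
      "\<And>e. \<bar>e\<bar> < d2 \<Longrightarrow> 0 < \<theta>' + e \<and> \<theta>' + e < pi / 2 \<and> a / b \<le> cos (\<theta>' + e)"
      using room_for_perturbation[OF th'] by blast
    define e where "e = min d1 d2 / 2"
    have e: "0 < e" "e < d1" "e < d2" using d1(1) d2(1) by (auto simp: e_def)
    have r: "0 < \<theta> + e" "\<theta> + e < pi / 2" "a / b \<le> cos (\<theta> + e)"
      using d1(2)[of e] e by auto
    have r': "0 < \<theta>' - e" "\<theta>' - e < pi / 2" "a / b \<le> cos (\<theta>' - e)"
      using d2(2)[of "- e"] e by auto
    have "kite_value a lam \<theta> + kite_value a lam \<theta>' \<le> kite_value a lam (\<theta> + e) + kite_value a lam (\<theta>' - e)"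
      by (rule exchange_kites[OF opt E ne r r']) simp
    then have "a * (lam * a - 2) * (tan \<theta> + tan \<theta>') \<le> a * (lam * a - 2) * (tan (\<theta> + e) + tan (\<theta>' - e))"
      by (simp only: kite_value_def distrib_left)
    then have "tan (\<theta> + e) + tan (\<theta>' - e) \<le> tan \<theta> + tan \<theta>'"
      using neg by (simp only: mult_le_cancel_left_neg)
    moreover have "tan \<theta> + tan \<theta>' < tan (\<theta> + e) + tan (\<theta>' - e)"
      using e r r' le by (intro tan_spread) auto
    ultimately show False by simp
  qed
  show False
    using *[OF E] *[OF E(2,1)] contr by (cases "\<theta>' \<le> \<theta>") auto
qed

lemma chords_different_angles:
  assumes opt: "optimal a b lam \<Omega>"
    and E: "lower_b_element a b \<Omega> x E" "lower_b_element a b \<Omega> y E'" and ne: "x \<noteq> y"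
  shows "lam * b * (cos x + cos y) = 1"
proof -
  have K: "\<Omega> \<in> C_class a b" using opt by (simp add: optimal_def)
  show ?thesis
    using lower_b_element_angle[OF K E(1)] lower_b_element_angle[OF K E(2)]
  proof (rule chord_stationary)
    show "chord_value b lam x + chord_value b lam y \<le> chord_value b lam x' + chord_value b lam y'"
      if "0 < x'" "x' < pi / 2" "a / b \<le> cos x'" "0 < y'" "y' < pi / 2" "a / b \<le> cos y'" "x' + y' = x + y"
      for x' y'
      by (rule exchange_chords[OF opt E _ that]) (use ne in simp)
  qed (rule ne)
qed

lemma chords_equal_angles:
  assumes opt: "optimal a b lam \<Omega>"
    and E: "lower_b_element a b \<Omega> y E" "lower_b_element a b \<Omega> y E'" and ne: "E \<noteq> E'"
  shows "2 * (lam * b * cos y) \<le> 1"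
proof -
  have K: "\<Omega> \<in> C_class a b" using opt by (simp add: optimal_def)
  show ?thesis
    using lower_b_element_angle[OF K E(1)]
  proof (rule equal_chords_stable)
    show "chord_value b lam y + chord_value b lam y \<le> chord_value b lam x' + chord_value b lam y'"
      if "0 < x'" "x' < pi / 2" "a / b \<le> cos x'" "0 < y'" "y' < pi / 2" "a / b \<le> cos y'" "x' + y' = y + y"
      for x' y'
      by (rule exchange_chords[OF opt E _ that]) (use ne in simp)
  qed
qed

text \<open>Midpoints of different chords of half-angle \<open>\<eta>\<close> have directions at least \<open>2 * \<eta>\<close> apart, so
  that each interval of length \<open>\<eta>\<close> contains at most one of them.\<close>

lemma finite_chords:
  assumes K: "K \<in> C_class a b"
  shows "finite {E. lower_b_element a b K \<eta> E}" (is "finite ?S")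
proof (cases "?S = {}")
  case False
  then have eta: "0 < \<eta>" "\<eta> < pi / 2" using lower_b_element_angle[OF K] by blast+
  define seg where "seg q = closed_segment (b *\<^sub>R direction (q - \<eta>)) (b *\<^sub>R direction (q + \<eta>))" for q
  have "\<exists>q. 0 \<le> q \<and> q < 2 * pi \<and> E = seg q \<and> piece (1 / b) (polar_gauge K) q \<eta>" if "E \<in> ?S" for E
  proof -
    have E: "lower_b_element a b K \<eta> E" using that by simp
    obtain q where "0 \<le> q" "q < 2 * pi"
      "E = closed_segment (b *\<^sub>R direction (q - \<eta>)) (b *\<^sub>R direction (q + \<eta>))"
      "piece (1 / b) (polar_gauge K) q \<eta>"
      "\<forall>lam. arc_J lam (polar_gauge K) (q - \<eta>) (q + \<eta>) = chord_value b lam \<eta>"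
      by (rule lower_b_element_piece[OF K E])
    then show ?thesis unfolding seg_def by blast
  qed
  then obtain f where f: "\<And>E. E \<in> ?S \<Longrightarrow> 0 \<le> f E \<and> f E < 2 * pi \<and> E = seg (f E)
      \<and> piece (1 / b) (polar_gauge K) (f E) \<eta>" by metis
  define g where "g E = \<lfloor>f E / \<eta>\<rfloor>" for E
  have "inj_on g ?S"
  proof (rule inj_onI)
    fix E E' assume E: "E \<in> ?S" "E' \<in> ?S" and eq: "g E = g E'"
    have "\<bar>f E / \<eta> - f E' / \<eta>\<bar> < 1" using eq unfolding g_def by linarith
    then have "\<bar>f E - f E'\<bar> < \<eta>"
      using eta by (simp add: abs_if diff_divide_distrib[symmetric] field_simps split: if_splits)
    then have "f E = f E'"
      using pieces_disjoint[of "1 / b" "polar_gauge K" "f E" \<eta> "f E'" \<eta>]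
        pieces_disjoint[of "1 / b" "polar_gauge K" "f E'" \<eta> "f E" \<eta>] f[OF E(1)] f[OF E(2)] eta
      by linarith
    then show "E = E'" using f[OF E(1)] f[OF E(2)] by metis
  qed
  moreover have "g ` ?S \<subseteq> {0..\<lfloor>2 * pi / \<eta>\<rfloor>}"
  proof
    fix k assume "k \<in> g ` ?S"
    then obtain E where E: "E \<in> ?S" "k = \<lfloor>f E / \<eta>\<rfloor>" unfolding g_def by blast
    have "0 \<le> f E / \<eta>" "f E / \<eta> \<le> 2 * pi / \<eta>"
      using f[OF E(1)] eta by (auto intro!: divide_right_mono)
    then show "k \<in> {0..\<lfloor>2 * pi / \<eta>\<rfloor>}" unfolding E(2) by (simp add: floor_mono)
  qed
  ultimately show ?thesis by (meson finite_atLeastAtMost_int finite_imageD finite_subset)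
qed simp

lemma A_upper_a_cases:
  assumes opt: "optimal a b lam \<Omega>" and lam: "lam \<noteq> 2 / a"
  shows "\<exists>\<theta>. 0 < \<theta> \<and> \<theta> < pi / 2 \<and>
           (A_upper_a a b \<Omega> \<noteq> of_mset {#} \<longrightarrow> A_upper_a a b \<Omega> = of_mset {#\<theta>#})"
proof (cases "\<exists>\<theta> E. upper_a_element a b \<Omega> \<theta> E")
  case True
  have K: "\<Omega> \<in> C_class a b" using opt by (simp add: optimal_def)
  obtain \<theta> E where E: "upper_a_element a b \<Omega> \<theta> E" using True by blast
  have "upper_a_element a b \<Omega> \<theta>' E' \<longleftrightarrow> \<theta>' = \<theta> \<and> E' = E" for \<theta>' E'
    using E at_most_one_kite[OF opt lam E, of \<theta>' E'] by blast
  then have "A_upper_a a b \<Omega> = of_mset {#\<theta>#}"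
    by (intro ext) (simp add: A_upper_a_def of_mset_def ecard_def)
  then show ?thesis using upper_a_element_angle[OF K E] by blast
next
  case False
  then have "A_upper_a a b \<Omega> = of_mset {#}"
    by (intro ext) (simp add: A_upper_a_def of_mset_def ecard_def)
  then show ?thesis using pi_gt3 by (intro exI[of _ 1]) simp
qed

text \<open>By the first variation any two different angles determine each other, so that there are at most
  two; by the second variation the smaller of two angles occurs once.\<close>

lemma A_lower_b_cases:
  assumes opt: "optimal a b lam \<Omega>" and nonempty: "A_lower_b a b \<Omega> \<noteq> of_mset {#}"
  obtains x n where "0 < x" "x < pi / 2" "n \<ge> 1" "A_lower_b a b \<Omega> = of_mset (replicate_mset n x)"
  | x y n where "0 < y" "x < pi / 2" "n \<ge> 1" "A_lower_b a b \<Omega> = of_mset (replicate_mset n x + {#y#})"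
      "x > y" "cos x + cos y = 1 / (b * lam)"
proof -
  have K: "\<Omega> \<in> C_class a b" using opt by (simp add: optimal_def)
  define N where "N \<eta> = {E. lower_b_element a b \<Omega> \<eta> E}" for \<eta>
  have fin: "finite (N \<eta>)" for \<eta> unfolding N_def by (rule finite_chords[OF K])
  have A: "A_lower_b a b \<Omega> = (\<lambda>\<eta>. enat (card (N \<eta>)))"
    using fin by (simp add: A_lower_b_def ecard_def N_def)
  have angle: "0 < \<eta>" "\<eta> < pi / 2" if "N \<eta> \<noteq> {}" for \<eta>
    using that lower_b_element_angle(1,2)[OF K] unfolding N_def by blast+
  have diff: "lam * b * (cos x + cos y) = 1" if "N x \<noteq> {}" "N y \<noteq> {}" "x \<noteq> y" for x y
    using that chords_different_angles[OF opt] unfolding N_def by blast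
  obtain x where x: "N x \<noteq> {}"
  proof (rule ccontr)
    assume "\<not> thesis"
    then have "N \<eta> = {}" for \<eta> using that by blast
    then have "A_lower_b a b \<Omega> = of_mset {#}" unfolding A by (simp add: of_mset_def)
    then show False using nonempty by simp
  qed
  have card1: "1 \<le> card (N \<eta>)" if "N \<eta> \<noteq> {}" for \<eta>
    using that fin by (simp add: Suc_le_eq card_gt_0_iff)
  show ?thesis
  proof (cases "\<exists>y. N y \<noteq> {} \<and> y \<noteq> x")
    case False
    define n where "n = card (N x)"
    from False have "N \<eta> = {}" if "\<eta> \<noteq> x" for \<eta> using that by blast
    then have "card (N \<eta>) = (if \<eta> = x then n else 0)" for \<eta> by (simp add: n_def)
    then have "A_lower_b a b \<Omega> = of_mset (replicate_mset n x)"
      unfolding A of_mset_def by (intro ext) simp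
    then show ?thesis by (rule that(1)[OF angle(1)[OF x] angle(2)[OF x] card1[OF x, folded n_def]])
  next
    case True
    then obtain y where y: "N y \<noteq> {}" "y \<noteq> x" by blast
    then consider "x < y" | "y < x" by linarith
    then obtain u v where uv: "N u \<noteq> {}" "N v \<noteq> {}" "v < u" by cases (use x y(1) in blast)+
    have uv1: "lam * b * (cos u + cos v) = 1" using diff uv by simp
    then have lb: "lam * b \<noteq> 0" by auto
    have "cos u < cos v" using angle[OF uv(1)] angle[OF uv(2)] uv(3) by (intro cos_monotone_0_pi) auto
    have "0 < cos u" "0 < cos v" using angle[OF uv(1)] angle[OF uv(2)] by (auto intro!: cos_gt_zero_pi)
    then have "0 < cos u + cos v" by simp
    then have lbpos: "0 < lam * b" using zero_less_mult_pos2[of "lam * b" "cos u + cos v"] uv1 by simp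
    have only: "t = u \<or> t = v" if t: "N t \<noteq> {}" for t
    proof (rule ccontr)
      assume ne: "\<not> (t = u \<or> t = v)"
      have "lam * b * (cos u + cos t) = 1" using diff[OF uv(1) t] ne by blast
      then have "lam * b * (cos u + cos t) = lam * b * (cos u + cos v)" using uv1 by simp
      then have "cos t = cos v" using lb by simp
      then have "t = v" using angle[OF t] angle[OF uv(2)] cos_inj_pi[of t v] by simp
      then show False using ne by simp
    qed
    have "card (N v) = 1"
    proof -
      have "E = E'" if "E \<in> N v" "E' \<in> N v" for E E'
      proof (rule ccontr)
        assume "E \<noteq> E'"
        then have "2 * (lam * b * cos v) \<le> 1"
          using that chords_equal_angles[OF opt] unfolding N_def by blast
        moreover have "lam * b * cos u < lam * b * cos v"
          using \<open>cos u < cos v\<close> lbpos by (rule mult_strict_left_mono)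
        ultimately show False using uv1 by (simp add: distrib_left)
      qed
      then obtain E where "N v = {E}" using uv(2) by blast
      then show ?thesis by simp
    qed
    define n where "n = card (N u)"
    have "card (N \<eta>) = (if \<eta> = u then n else if \<eta> = v then 1 else 0)" for \<eta>
    proof (cases "N \<eta> = {}")
      case True
      then show ?thesis using uv(1,2) by auto
    next
      case False
      then show ?thesis using only[OF False] \<open>card (N v) = 1\<close> by (auto simp: n_def)
    qed
    then have "A_lower_b a b \<Omega> = of_mset (replicate_mset n u + {#v#})"
      unfolding A of_mset_def using uv(3) by (intro ext) (simp add: one_enat_def)
    moreover have "cos u + cos v = 1 / (b * lam)" using uv1 lb by (simp add: field_simps)
    ultimately show ?thesis
      by (intro that(2)[OF angle(1)[OF uv(2)] angle(2)[OF uv(1)] card1[OF uv(1), folded n_def] _ uv(3)])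
  qed
qed

end

theorem theorem2p9:
  fixes a b lam :: real and \<Omega> :: "(real^2) set"
  assumes "0 < a" and "a < b" and "lam \<ge> 0"
    and "optimal a b lam \<Omega>" and "\<Omega> \<in> K_class a b"
  shows "(lam \<noteq> 2 / a \<longrightarrow>
            (\<exists>\<theta>. 0 < \<theta> \<and> \<theta> < pi / 2 \<and>
               (A_upper_a a b \<Omega> \<noteq> of_mset {#} \<longrightarrow> A_upper_a a b \<Omega> = of_mset {#\<theta>#})))
       \<and> (\<exists>x y. 0 < x \<and> x < pi / 2 \<and> 0 < y \<and> y < pi / 2 \<and>
            (A_lower_b a b \<Omega> \<noteq> of_mset {#} \<longrightarrow>
               (\<exists>z. A_lower_b a b \<Omega> = of_mset {#z#})
             \<or> (\<exists>n\<ge>1. A_lower_b a b \<Omega> = of_mset (replicate_mset n x))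
             \<or> (\<exists>n\<ge>1. A_lower_b a b \<Omega> = of_mset (replicate_mset n x + {#y#})
                      \<and> x > y \<and> cos x + cos y = 1 / (b * lam))))"
proof -
  interpret annulus a b using assms(1,2) by unfold_locales
  note opt = assms(4)
  have one: "(0::real) < 1 \<and> (1::real) < pi / 2" using pi_gt3 by simp
  have "\<exists>x y. 0 < x \<and> x < pi / 2 \<and> 0 < y \<and> y < pi / 2 \<and>
            (A_lower_b a b \<Omega> \<noteq> of_mset {#} \<longrightarrow>
               (\<exists>z. A_lower_b a b \<Omega> = of_mset {#z#})
             \<or> (\<exists>n\<ge>1. A_lower_b a b \<Omega> = of_mset (replicate_mset n x))
             \<or> (\<exists>n\<ge>1. A_lower_b a b \<Omega> = of_mset (replicate_mset n x + {#y#})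
                      \<and> x > y \<and> cos x + cos y = 1 / (b * lam)))"
  proof (cases "A_lower_b a b \<Omega> = of_mset {#}")
    case True
    then show ?thesis using one by blast
  next
    case False
    from opt this show ?thesis
    proof (cases rule: A_lower_b_cases)
      case (1 x n)
      then show ?thesis using one by (intro exI[of _ x] exI[of _ 1]) auto
    next
      case (2 y x n)
      then have "0 < x" "y < pi / 2" by simp_all
      then show ?thesis using 2 by (intro exI[of _ x] exI[of _ y]) auto
    qed
  qed
  then show ?thesis using A_upper_a_cases[OF opt] by (intro conjI impI)
qed

end
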